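(* Let $p\in\mathbb{C}$. The linear map $\varphi:U_q[gl(n/m)]\to W(n-1/m)$ defined on the generators by $$\varphi(h_1)=p-N,\qquad \varphi(h_i)=N_{i-1},\quad i=2,\ldots,n+m,$$ $$\varphi(e_1)=\frac{[N_1+1]}{N_1+1}\,[p-N]\,A_1^-,\qquad \varphi(e_i)=\frac{[N_i+1]}{N_i+1}\,A_{i-1}^+A_i^-,\quad i=2,\ldots,n-1,$$ $$\varphi(e_i)=A_{i-1}^+A_i^-,\quad i=n,\ldots,n+m-1\ (i\ge 2),$$ $$\varphi(f_1)=A_1^+,\qquad \varphi(f_i)=\frac{[N_{i-1}+1]}{N_{i-1}+1}\,A_i^+A_{i-1}^-,\quad i=2,\ldots,n\ (i\le n+m-1),$$ $$\varphi(f_i)=A_i^+A_{i-1}^-,\quad i=n+1,\ldots,n+m-1,$$ is a homomorphism of $U_q[gl(n/m)]$ into $W(n-1/m)$ (that is, these assignments extend to a homomorphism of associative unital $\mathbb{C}[[h]]$-superalgebras).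
   Context: Throughout $n\ge 1$, $m\ge 0$ are integers with $r:=n+m\ge 2$; $\mathbb{C}[[h]]$ is the algebra of formal power series in the indeterminate $h$, $q=e^{h/2}\in\mathbb{C}[[h]]$, and $\bar q=q^{-1}$. For $x$ a number or an operator, $[x]=\dfrac{q^x-\bar q^{\,x}}{q-\bar q}$. The parities $\theta_i\in\mathbb{Z}_2=\{\bar 0,\bar 1\}$ are $\theta_i=\bar 0$ if $i<n$ and $\theta_i=\bar 1$ if $i\ge n$. **The superalgebra $U_q[gl(n/m)]$.** It is the associative unital superalgebra over $\mathbb{C}[[h]]$, topologically free as a $\mathbb{C}[[h]]$-module (complete in the $h$-adic topology), with generators $h_j$ ($j=1,\ldots,r$) and $e_i,f_i$ ($i=1,\ldots,r-1$), with degrees $\deg(h_i)=\bar 0$, $\deg(e_j)=\deg(f_j)=\theta_{j-1}+\theta_j$ (so $e_n,f_n$ are odd and all other generators are even), subject to the following relations, where indices run over all values for which the generators involved exist. (It also carries a Hopf structure, which is not used here.) Cartan-Kac relations (the $h_i$ commute with each other): $[h_i,e_j]=(\delta_{ij}-\delta_{i,j+1})e_j$; $[h_i,f_j]=(-\delta_{ij}+\delta_{i,j+1})f_j$; $e_if_j-f_je_i=0$ if $i\ne j$; $e_if_i-f_ie_i=\dfrac{q^{h_i-h_{i+1}}-q^{-h_i+h_{i+1}}}{q-q^{-1}}$ if $i\neq n$; $e_nf_n+f_ne_n=\dfrac{q^{h_n+h_{n+1}}-q^{-h_n-h_{n+1}}}{q-q^{-1}}$. $e$-Serre relations: $e_ie_j=e_je_i$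 if $|i-j|\ne 1$; $e_n^2=0$; $e_i^2e_{i+1}-(q+q^{-1})e_ie_{i+1}e_i+e_{i+1}e_i^2=0$ for $i\in\{1,\ldots,n-1\}\cup\{n+1,\ldots,n+m-2\}$; $e_{i+1}^2e_i-(q+q^{-1})e_{i+1}e_ie_{i+1}+e_ie_{i+1}^2=0$ for $i\in\{1,\ldots,n-2\}\cup\{n,\ldots,n+m-2\}$; $e_ne_{n-1}e_ne_{n+1}+e_{n-1}e_ne_{n+1}e_n+e_ne_{n+1}e_ne_{n-1}+e_{n+1}e_ne_{n-1}e_n-(q+q^{-1})e_ne_{n-1}e_{n+1}e_n=0$. $f$-Serre relations: those obtained from the $e$-Serre relations by replacing every $e_i$ by $f_i$. **The algebra $W(n-1/m)$.** It is the associative unital superalgebra over $\mathbb{C}[[h]]$, topologically free as a $\mathbb{C}[[h]]$-module (complete in the $h$-adic topology), with generators $A_1^\pm,\ldots,A_{n+m-1}^\pm$ of degrees $\deg(A_i^\pm)=\theta_i$, subject to the relations $[\![A_i^-,A_j^+]\!]=\delta_{ij}$, $[\![A_i^+,A_j^+]\!]=[\![A_i^-,A_j^-]\!]=0$, where $[\![x,y]\!]=xy-(-1)^{\deg(x)\deg(y)}yx$ for homogeneous $x,y$. Thus $A_1^\pm,\ldots,A_{n-1}^\pm$ are Bose creation and annihilation operators, $A_n^\pm,\ldots,A_{n+m-1}^\pm$ are Fermi creation and annihilation operators, and Bose operators commute with Fermi operators. Set $N_i=A_i^+A_i^-$ and $N=N_1+\cdots+N_{n+m-1}$. The expressions $[p-N]$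 and $\frac{[N_i+1]}{N_i+1}$ are understood as elements of $W(n-1/m)$ through their expansions in powers of $h$, whose coefficients are polynomials in $N$, respectively in $N_i$. *)

theory Defs
  imports
    "HOL-Computational_Algebra.Formal_Power_Series"
    "HOL-Computational_Algebra.Polynomial"
    "HOL-Library.Poly_Mapping"
    "HOL-Library.Z2"
    "HOL-Algebra.QuotRing"
    "HOL-Algebra.Module"
begin

section \<open>Completed free algebras over \<open>C[[h]]\<close>\<close>

datatype 'x monomial = Mon (letters: "'x list")

instantiation monomial :: (type) monoid_add
begin

definition zero_monomial :: "'a monomial" where
  "zero_monomial = Mon []"

definition plus_monomial :: "'a monomial \<Rightarrow> 'a monomial \<Rightarrow> 'a monomial" where
  "plus_monomial u v = Mon (letters u @ letters v)"

instance
  by standard (auto simp: zero_monomial_def plus_monomial_def)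

end

text \<open>
  A noncommutative polynomial is a finitely supported function on words; the library's convolution
  product on \<^typ>\<open>'k \<Rightarrow>\<^sub>0 complex\<close>, with concatenation as the addition of keys, is then
  the product of the free algebra \<open>C<X>\<close>.  The completed free algebra is \<open>C<X>[[h]]\<close>;
  the topology of the type \<^typ>\<open>'a fps\<close> is the \<open>h\<close>-adic one.
\<close>

type_synonym 'x free_alg = "'x monomial \<Rightarrow>\<^sub>0 complex"
type_synonym 'x cfree_alg = "'x free_alg fps"

definition const :: "complex \<Rightarrow> 'x free_alg" where
  "const c = Poly_Mapping.single 0 c"

definition var :: "'x \<Rightarrow> 'x free_alg" where
  "var x = Poly_Mapping.single (Mon [x]) 1"

definition scalar :: "complex fps \<Rightarrow> 'x cfree_alg" where
  "scalar c = Abs_fps (\<lambda>k. const (fps_nth c k))"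

definition words_over :: "'x set \<Rightarrow> 'x cfree_alg set" where
  "words_over X = {x. \<forall>k. \<forall>w \<in> Poly_Mapping.keys (fps_nth x k). set (letters w) \<subseteq> X}"

definition parity :: "('x \<Rightarrow> bit) \<Rightarrow> 'x monomial \<Rightarrow> bit" where
  "parity deg w = sum_list (map deg (letters w))"

section \<open>Superalgebras given by generators and relations\<close>

text \<open>The field \<open>homog d\<close> is the homogeneous component of degree \<open>d\<close> in \<open>Z\<^sub>2\<close>.\<close>

record ('a, 'b) superalgebra = "('a, 'b) module" +
  homog :: "bit \<Rightarrow> 'b set"

definition superalg_hom ::
  "('c, 'a, 'm) superalgebra_scheme \<Rightarrow> ('c, 'b, 'n) superalgebra_scheme \<Rightarrow> ('a \<Rightarrow> 'b) set" where
  "superalg_hom A B = {\<phi> \<in> ring_hom A B.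
     (\<forall>c. \<forall>x \<in> carrier A. \<phi> (c \<odot>\<^bsub>A\<^esub> x) = c \<odot>\<^bsub>B\<^esub> \<phi> x) \<and>
     (\<forall>d. \<forall>x \<in> homog A d. \<phi> x \<in> homog B d)}"

definition free_superalg ::
  "'x set \<Rightarrow> ('x \<Rightarrow> bit) \<Rightarrow> (complex fps, 'x cfree_alg) superalgebra" where
  "free_superalg X deg =
    \<lparr>carrier = words_over X, mult = (*), one = 1, zero = 0, add = (+),
     smult = (\<lambda>c x. scalar c * x),
     homog = (\<lambda>d. {x \<in> words_over X.
       \<forall>k. \<forall>w \<in> Poly_Mapping.keys (fps_nth x k). parity deg w = d})\<rparr>"

text \<open>
  The quotient by a closed ideal is \<open>h\<close>-adically separated and complete, and the last condition
  makes it \<open>h\<close>-torsion free; together this says that the quotient is topologically free.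
  (\<^const>\<open>fps_X\<close> is \<open>h\<close>.)
\<close>

definition relation_ideal :: "'x set \<Rightarrow> ('x \<Rightarrow> bit) \<Rightarrow> 'x cfree_alg set \<Rightarrow> 'x cfree_alg set" where
  "relation_ideal X deg R = \<Inter>{I. ideal I (free_superalg X deg) \<and> R \<subseteq> I \<and> closed I \<and>
     (\<forall>x \<in> words_over X. fps_X * x \<in> I \<longrightarrow> x \<in> I)}"

definition residue ::
  "'x set \<Rightarrow> ('x \<Rightarrow> bit) \<Rightarrow> 'x cfree_alg set \<Rightarrow> 'x cfree_alg \<Rightarrow> 'x cfree_alg set" where
  "residue X deg R x = relation_ideal X deg R +>\<^bsub>free_superalg X deg\<^esub> x"

definition presented_superalg ::
  "'x set \<Rightarrow> ('x \<Rightarrow> bit) \<Rightarrow> 'x cfree_alg set \<Rightarrow> (complex fps, 'x cfree_alg set) superalgebra" where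
  "presented_superalg X deg R =
    (let A = free_superalg X deg; Q = A Quot relation_ideal X deg R in
    \<lparr>carrier = carrier Q, mult = mult Q, one = one Q, zero = zero Q, add = add Q,
     smult = (\<lambda>c C. \<Union>x\<in>C. residue X deg R (c \<odot>\<^bsub>A\<^esub> x)),
     homog = (\<lambda>d. residue X deg R ` homog A d)\<rparr>)"

section \<open>The expressions \<open>[x]\<close> and \<open>[x]/x\<close>\<close>

definition qh :: "complex fps" where
  "qh = fps_exp (1/2)"

text \<open>
  The power series \<open>q\<^sup>X = exp(hX/2)\<close>, \<open>q\<^sup>-\<^sup>X\<close>, \<open>[X]\<close> and \<open>[X]/X\<close> in \<open>C[X][[h]]\<close>.  Both numerator and
  denominator of \<open>[X]\<close> are divisible by \<open>h\<close>, which is cancelled first; the coefficients of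
  \<open>[X]\<close> are divisible by \<open>X\<close>.  See \<open>q_num_eq\<close> and \<open>q_num_quot_eq\<close> below.
\<close>

definition q_power :: "complex poly fps" where
  "q_power = Abs_fps (\<lambda>k. monom ((1/2) ^ k / fact k) k)"

definition q_power_neg :: "complex poly fps" where
  "q_power_neg = Abs_fps (\<lambda>k. monom ((-1/2) ^ k / fact k) k)"

definition poly_scalar :: "complex fps \<Rightarrow> complex poly fps" where
  "poly_scalar c = Abs_fps (\<lambda>k. [:fps_nth c k:])"

definition q_num :: "complex poly fps" where
  "q_num = fps_shift 1 (q_power - q_power_neg) * poly_scalar (fps_X / (qh - inverse qh))"

definition q_num_quot :: "complex poly fps" where
  "q_num_quot = Abs_fps (\<lambda>k. fps_nth q_num k div [:0, 1:])"

definition subst_poly :: "complex poly \<Rightarrow> 'x free_alg \<Rightarrow> 'x free_alg" where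
  "subst_poly P x = (\<Sum>j\<le>degree P. const (coeff P j) * x ^ j)"

definition subst :: "complex poly fps \<Rightarrow> 'x free_alg \<Rightarrow> 'x cfree_alg" where
  "subst P x = Abs_fps (\<lambda>k. subst_poly (fps_nth P k) x)"

definition qbr :: "'x free_alg \<Rightarrow> 'x cfree_alg" where
  "qbr x = subst q_num x"

definition qbr_quot :: "'x free_alg \<Rightarrow> 'x cfree_alg" where
  "qbr_quot x = subst q_num_quot x"

section \<open>The superalgebra \<open>U\<^sub>q[gl(n/m)]\<close>\<close>

definition theta :: "nat \<Rightarrow> nat \<Rightarrow> bit" where
  "theta n i = (if i < n then 0 else 1)"

datatype ugen = H nat | E nat | F nat

definition U_gens :: "nat \<Rightarrow> nat \<Rightarrow> ugen set" where
  "U_gens n m = H ` {1..n+m} \<union> E ` {1..n+m-1} \<union> F ` {1..n+m-1}"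

fun U_deg :: "nat \<Rightarrow> ugen \<Rightarrow> bit" where
  "U_deg n (H i) = 0"
| "U_deg n (E i) = theta n (i - 1) + theta n i"
| "U_deg n (F i) = theta n (i - 1) + theta n i"

abbreviation hh :: "nat \<Rightarrow> ugen cfree_alg" where "hh i \<equiv> fps_const (var (H i))"
abbreviation ee :: "nat \<Rightarrow> ugen cfree_alg" where "ee i \<equiv> fps_const (var (E i))"
abbreviation ff :: "nat \<Rightarrow> ugen cfree_alg" where "ff i \<equiv> fps_const (var (F i))"

text \<open>In the following sets an element \<open>x\<close> stands for the relation \<open>x = 0\<close>.\<close>

inductive_set cartan_kac_rels :: "nat \<Rightarrow> nat \<Rightarrow> ugen cfree_alg set" for n m :: nat where
  hh: "hh i * hh j - hh j * hh i \<in> cartan_kac_rels n m"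
    if "i \<in> {1..n+m}" "j \<in> {1..n+m}"
| he: "hh i * ee j - ee j * hh i - (of_bool (i = j) - of_bool (i = j + 1)) * ee j
        \<in> cartan_kac_rels n m"
    if "i \<in> {1..n+m}" "j \<in> {1..n+m-1}"
| hf: "hh i * ff j - ff j * hh i - (- of_bool (i = j) + of_bool (i = j + 1)) * ff j
        \<in> cartan_kac_rels n m"
    if "i \<in> {1..n+m}" "j \<in> {1..n+m-1}"
| ef: "ee i * ff j - ff j * ee i \<in> cartan_kac_rels n m"
    if "i \<in> {1..n+m-1}" "j \<in> {1..n+m-1}" "i \<noteq> j"
| ef_even: "ee i * ff i - ff i * ee i - qbr (var (H i) - var (H (i + 1))) \<in> cartan_kac_rels n m"
    if "i \<in> {1..n+m-1}" "i \<noteq> n"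
| ef_odd: "ee n * ff n + ff n * ee n - qbr (var (H n) + var (H (n + 1))) \<in> cartan_kac_rels n m"
    if "n \<in> {1..n+m-1}"

inductive_set serre_rels ::
  "nat \<Rightarrow> nat \<Rightarrow> (nat \<Rightarrow> ugen cfree_alg) \<Rightarrow> ugen cfree_alg set"
  for n m :: nat and g :: "nat \<Rightarrow> ugen cfree_alg" where
  comm: "g i * g j - g j * g i \<in> serre_rels n m g"
    if "i \<in> {1..n+m-1}" "j \<in> {1..n+m-1}" "\<bar>int i - int j\<bar> \<noteq> 1"
| square: "g n ^ 2 \<in> serre_rels n m g"
    if "n \<in> {1..n+m-1}"
| cubic_up: "g i ^ 2 * g (i+1) - scalar (qh + inverse qh) * (g i * g (i+1) * g i) + g (i+1) * g i ^ 2
        \<in> serre_rels n m g"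
    if "i \<in> {1..n-1} \<union> {n+1..n+m-2}" "i + 1 \<le> n+m-1"
| cubic_down: "g (i+1) ^ 2 * g i - scalar (qh + inverse qh) * (g (i+1) * g i * g (i+1)) + g i * g (i+1) ^ 2
        \<in> serre_rels n m g"
    if "i \<in> {1..n-2} \<union> {n..n+m-2}" "i + 1 \<le> n+m-1"
| quartic: "g n * g (n-1) * g n * g (n+1) + g (n-1) * g n * g (n+1) * g n
        + g n * g (n+1) * g n * g (n-1) + g (n+1) * g n * g (n-1) * g n
        - scalar (qh + inverse qh) * (g n * g (n-1) * g (n+1) * g n) \<in> serre_rels n m g"
    if "1 \<le> n - 1" "n + 1 \<le> n+m-1"

definition U_rels :: "nat \<Rightarrow> nat \<Rightarrow> ugen cfree_alg set" where
  "U_rels n m = cartan_kac_rels n m \<union> serre_rels n m ee \<union> serre_rels n m ff"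

definition U_alg :: "nat \<Rightarrow> nat \<Rightarrow> (complex fps, ugen cfree_alg set) superalgebra" where
  "U_alg n m = presented_superalg (U_gens n m) (U_deg n) (U_rels n m)"

definition U_elt :: "nat \<Rightarrow> nat \<Rightarrow> ugen cfree_alg \<Rightarrow> ugen cfree_alg set" where
  "U_elt n m = residue (U_gens n m) (U_deg n) (U_rels n m)"

section \<open>The superalgebra \<open>W(n-1/m)\<close>\<close>

datatype wgen = Cr nat | An nat  \<comment> \<open>creation \<open>A\<^sub>i\<^sup>+\<close> and annihilation \<open>A\<^sub>i\<^sup>-\<close>\<close>

definition W_gens :: "nat \<Rightarrow> nat \<Rightarrow> wgen set" where
  "W_gens n m = Cr ` {1..n+m-1} \<union> An ` {1..n+m-1}"

fun W_deg :: "nat \<Rightarrow> wgen \<Rightarrow> bit" where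
  "W_deg n (Cr i) = theta n i"
| "W_deg n (An i) = theta n i"

abbreviation Ap :: "nat \<Rightarrow> wgen cfree_alg" where "Ap i \<equiv> fps_const (var (Cr i))"
abbreviation Am :: "nat \<Rightarrow> wgen cfree_alg" where "Am i \<equiv> fps_const (var (An i))"

definition superbracket :: "bit \<Rightarrow> bit \<Rightarrow> 'a::ring_1 \<Rightarrow> 'a \<Rightarrow> 'a" where
  "superbracket d d' x y = x * y - (if d * d' = 1 then - 1 else 1) * (y * x)"

inductive_set W_rels :: "nat \<Rightarrow> nat \<Rightarrow> wgen cfree_alg set" for n m :: nat where
  mp: "superbracket (theta n i) (theta n j) (Am i) (Ap j) - of_bool (i = j) \<in> W_rels n m"
    if "i \<in> {1..n+m-1}" "j \<in> {1..n+m-1}"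
| pp: "superbracket (theta n i) (theta n j) (Ap i) (Ap j) \<in> W_rels n m"
    if "i \<in> {1..n+m-1}" "j \<in> {1..n+m-1}"
| mm: "superbracket (theta n i) (theta n j) (Am i) (Am j) \<in> W_rels n m"
    if "i \<in> {1..n+m-1}" "j \<in> {1..n+m-1}"

text \<open>In the context of \<open>n\<close> and \<open>m\<close>, this is \<open>W(n-1/m)\<close>, not \<open>W(n/m)\<close>.\<close>

definition W_alg :: "nat \<Rightarrow> nat \<Rightarrow> (complex fps, wgen cfree_alg set) superalgebra" where
  "W_alg n m = presented_superalg (W_gens n m) (W_deg n) (W_rels n m)"

definition W_elt :: "nat \<Rightarrow> nat \<Rightarrow> wgen cfree_alg \<Rightarrow> wgen cfree_alg set" where
  "W_elt n m = residue (W_gens n m) (W_deg n) (W_rels n m)"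

definition Num :: "nat \<Rightarrow> wgen free_alg" where
  "Num i = var (Cr i) * var (An i)"

definition Ntot :: "nat \<Rightarrow> nat \<Rightarrow> wgen free_alg" where
  "Ntot n m = (\<Sum>i=1..n+m-1. Num i)"

section \<open>Well-definedness\<close>

lemma keys_mult_words:
  fixes a b :: "'x free_alg"
  assumes "w \<in> Poly_Mapping.keys (a * b)"
  shows "\<exists>u v. w = Mon (letters u @ letters v) \<and> u \<in> Poly_Mapping.keys a \<and> v \<in> Poly_Mapping.keys b"
  using keys_mult[of a b] assms by (auto simp: plus_monomial_def)

definition poly_words_over :: "'x set \<Rightarrow> 'x free_alg set" where
  "poly_words_over X = {a. \<forall>w \<in> Poly_Mapping.keys a. set (letters w) \<subseteq> X}"

lemma poly_words_over_add: "a \<in> poly_words_over X \<Longrightarrow> b \<in> poly_words_over X \<Longrightarrow> a + b \<in> poly_words_over X"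
  unfolding poly_words_over_def using Poly_Mapping.keys_add[of a b] by blast
lemma poly_words_over_uminus: "a \<in> poly_words_over X \<Longrightarrow> - a \<in> poly_words_over X"
  unfolding poly_words_over_def by (simp add: in_keys_iff)
lemma poly_words_over_diff: "a \<in> poly_words_over X \<Longrightarrow> b \<in> poly_words_over X \<Longrightarrow> a - b \<in> poly_words_over X"
  using poly_words_over_add[of a X "-b"] poly_words_over_uminus[of b] by simp
lemma poly_words_over_mult: "a \<in> poly_words_over X \<Longrightarrow> b \<in> poly_words_over X \<Longrightarrow> a * b \<in> poly_words_over X"
  unfolding poly_words_over_def by (force dest!: keys_mult_words)
lemma poly_words_over_const: "const c \<in> poly_words_over X"
  by (auto simp: poly_words_over_def const_def zero_monomial_def)
lemma poly_words_over_0: "0 \<in> poly_words_over X" by (simp add: poly_words_over_def)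
lemma poly_words_over_1: "1 \<in> poly_words_over X"
  using poly_words_over_const[of 1 X] by (simp add: const_def)
lemma poly_words_over_var: "x \<in> X \<Longrightarrow> var x \<in> poly_words_over X"
  by (auto simp: poly_words_over_def var_def)
lemma poly_words_over_sum: "(\<And>i. i \<in> I \<Longrightarrow> f i \<in> poly_words_over X) \<Longrightarrow> sum f I \<in> poly_words_over X"
  by (induction I rule: infinite_finite_induct) (auto intro: poly_words_over_add poly_words_over_0)
lemma poly_words_over_pow: "a \<in> poly_words_over X \<Longrightarrow> a ^ j \<in> poly_words_over X"
  by (induction j) (auto intro: poly_words_over_1 poly_words_over_mult)
lemmas poly_words_over_intros = poly_words_over_add poly_words_over_uminus poly_words_over_diff poly_words_over_mult poly_words_over_const poly_words_over_0 poly_words_over_1 poly_words_over_var poly_words_over_sum poly_words_over_pow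

lemma words_over_iff: "x \<in> words_over X \<longleftrightarrow> (\<forall>k. fps_nth x k \<in> poly_words_over X)"
  by (simp add: words_over_def poly_words_over_def)

lemma words_over_mult: "x \<in> words_over X \<Longrightarrow> y \<in> words_over X \<Longrightarrow> x * y \<in> words_over X"
  by (auto simp: words_over_iff fps_mult_nth intro!: poly_words_over_intros)
lemma words_over_add: "x \<in> words_over X \<Longrightarrow> y \<in> words_over X \<Longrightarrow> x + y \<in> words_over X"
  by (auto simp: words_over_iff intro!: poly_words_over_intros)
lemma words_over_diff: "x \<in> words_over X \<Longrightarrow> y \<in> words_over X \<Longrightarrow> x - y \<in> words_over X"
  by (auto simp: words_over_iff intro!: poly_words_over_intros)
lemma words_over_uminus: "x \<in> words_over X \<Longrightarrow> - x \<in> words_over X"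
  by (auto simp: words_over_iff intro!: poly_words_over_intros)
lemma words_over_const: "a \<in> poly_words_over X \<Longrightarrow> fps_const a \<in> words_over X"
  by (auto simp: words_over_iff intro!: poly_words_over_intros)
lemma words_over_scalar: "scalar c \<in> words_over X"
  by (auto simp: words_over_iff scalar_def intro!: poly_words_over_intros)
lemma words_over_0: "0 \<in> words_over X"
  by (auto simp: words_over_iff  intro!: poly_words_over_intros)
lemma words_over_1: "1 \<in> words_over X"
  by (auto simp: words_over_iff  intro!: poly_words_over_intros)
lemma words_over_of_bool: "of_bool P \<in> words_over X"
  by (cases P) (auto simp: words_over_0 words_over_1)
lemma words_over_pow: "x \<in> words_over X \<Longrightarrow> x ^ j \<in> words_over X"
  by (induction j) (auto intro: words_over_1 words_over_mult)
lemma words_over_qbr: "a \<in> poly_words_over X \<Longrightarrow> qbr a \<in> words_over X"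
  by (auto simp: words_over_iff qbr_def subst_def subst_poly_def intro!: poly_words_over_intros)
lemmas words_over_intros = words_over_mult words_over_add words_over_diff words_over_uminus
  words_over_const words_over_scalar words_over_0 words_over_1 words_over_of_bool words_over_pow words_over_qbr

lemma U_rels_words_over:
  assumes "n \<ge> 1" shows "U_rels n m \<subseteq> words_over (U_gens n m)"
proof -
  have H: "i \<in> {1..n+m} \<Longrightarrow> hh i \<in> words_over (U_gens n m)" for i
    by (auto intro!: words_over_intros poly_words_over_intros simp: U_gens_def)
  have H': "i \<in> {1..n+m} \<Longrightarrow> var (H i) \<in> poly_words_over (U_gens n m)" for i
    by (auto intro!: words_over_intros poly_words_over_intros simp: U_gens_def)
  have E: "i \<in> {1..n+m-1} \<Longrightarrow> ee i \<in> words_over (U_gens n m)" for i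
    by (auto intro!: words_over_intros poly_words_over_intros simp: U_gens_def)
  have F: "i \<in> {1..n+m-1} \<Longrightarrow> ff i \<in> words_over (U_gens n m)" for i
    by (auto intro!: words_over_intros poly_words_over_intros simp: U_gens_def)
  have 1: "x \<in> words_over (U_gens n m)" if "x \<in> cartan_kac_rels n m" for x
    using that
    by induction (intro words_over_intros poly_words_over_intros H H' E F; fastforce)+
  have 2: "serre_rels n m g \<subseteq> words_over (U_gens n m)"
    if g: "\<And>i. i \<in> {1..n+m-1} \<Longrightarrow> g i \<in> words_over (U_gens n m)" for g
  proof
    fix x assume "x \<in> serre_rels n m g"
    then show "x \<in> words_over (U_gens n m)"
    proof cases
      case comm show ?thesis unfolding comm(1) by (intro words_over_intros g comm)
    next
      case square show ?thesis unfolding square(1) by (intro words_over_intros g square)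
    next
      case (cubic_up i)
      then have "i \<in> {1..n+m-1}" "i + 1 \<in> {1..n+m-1}" by auto
      then show ?thesis unfolding cubic_up(1) by (intro words_over_intros g)
    next
      case (cubic_down i)
      then have "i \<in> {1..n+m-1}" "i + 1 \<in> {1..n+m-1}" using assms by auto
      then show ?thesis unfolding cubic_down(1) by (intro words_over_intros g)
    next
      case quartic
      then have "n \<in> {1..n+m-1}" "n + 1 \<in> {1..n+m-1}" "n - 1 \<in> {1..n+m-1}" by auto
      then show ?thesis unfolding quartic(1) by (intro words_over_intros g)
    qed
  qed
  show ?thesis unfolding U_rels_def using 1 2[of ee, OF E] 2[of ff, OF F] by blast
qed

lemma W_rels_words_over: "W_rels n m \<subseteq> words_over (W_gens n m)"
proof
  fix x assume "x \<in> W_rels n m"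
  then show "x \<in> words_over (W_gens n m)"
    by induction
      (auto intro!: words_over_intros poly_words_over_intros simp: W_gens_def superbracket_def)
qed

lemma ring_free_superalg: "ring (free_superalg X deg)"
proof (rule ringI)
  show "abelian_group (free_superalg X deg)"
    by (rule abelian_groupI)
      (auto simp: free_superalg_def words_over_intros algebra_simps intro!: bexI[of _ "- x" for x] words_over_intros)
  show "Group.monoid (free_superalg X deg)"
    by (rule Group.monoidI) (auto simp: free_superalg_def words_over_intros algebra_simps)
qed (auto simp: free_superalg_def algebra_simps)

lemma closed_words_over: "closed (words_over X)"
  unfolding closed_def open_dist
proof (intro ballI)
  fix x :: "'a cfree_alg" assume "x \<in> - words_over X"
  then obtain k where k: "fps_nth x k \<notin> poly_words_over X" by (auto simp: words_over_iff)
  show "\<exists>e>0. \<forall>y. dist y x < e \<longrightarrow> y \<in> - words_over X"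
  proof (intro exI[of _ "inverse (2 ^ k)"] conjI allI impI)
    fix y assume "dist y x < inverse (2 ^ k)"
    then have "fps_nth y k = fps_nth x k"
      using nth_less_subdegree_zero[of k "y - x"]
      by (cases "y = x") (auto simp: dist_fps_def)
    with k show "y \<in> - words_over X" by (metis ComplI words_over_iff)
  qed simp
qed

lemma ideal_relation_ideal:
  assumes "R \<subseteq> words_over X"
  shows "ideal (relation_ideal X deg R) (free_superalg X deg)"
proof -
  interpret ring "free_superalg X deg" by (rule ring_free_superalg)
  have "ideal (words_over X) (free_superalg X deg)"
    using oneideal by (simp add: free_superalg_def)
  then show ?thesis unfolding relation_ideal_def
    using assms closed_words_over[of X] by (intro i_Intersect) auto
qed

lemma poly_scalar_mult: "poly_scalar (a * b) = poly_scalar a * poly_scalar b"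
  by (auto simp: poly_scalar_def fps_eq_iff fps_mult_nth mult_ac poly_eq_iff coeff_sum)
     (simp add: coeff_pCons split: nat.splits)

lemma q_num_eq: "poly_scalar (qh - inverse qh) * q_num = q_power - q_power_neg"
proof -
  have i: "inverse qh = fps_exp (- (1/2))" by (simp add: qh_def fps_exp_neg)
  define d where "d = qh - inverse qh"
  have d0: "fps_nth d 0 = 0" "fps_nth d 1 = 1" by (simp_all add: d_def i, simp_all add: qh_def)
  then have sd: "subdegree d = 1" by (intro subdegreeI) auto
  have "d dvd fps_X" using d0 sd by (subst fps_dvd_iff) auto
  then have X: "d * (fps_X / d) = fps_X" by simp
  have pX: "poly_scalar fps_X = fps_X" by (auto simp: poly_scalar_def fps_eq_iff fps_X_def)
  have "poly_scalar d * q_num = poly_scalar (d * (fps_X / d)) * fps_shift 1 (q_power - q_power_neg)"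
    by (simp only: poly_scalar_mult q_num_def d_def mult_ac)
  also have "\<dots> = fps_shift 1 (q_power - q_power_neg) * fps_X" by (simp add: X pX mult_ac)
  also have "\<dots> = q_power - q_power_neg"
    by (rule fps_ext) (simp add: q_power_def q_power_neg_def)
  finally show ?thesis by (simp add: d_def)
qed

lemma q_num_quot_eq: "fps_const [:0, 1:] * q_num_quot = q_num"
proof -
  have "[:0, 1:] dvd fps_nth q_num k" for k
    by (auto simp: q_num_def fps_mult_nth q_power_def q_power_neg_def poly_eq_0_iff_dvd[of _ 0, simplified, symmetric] poly_sum poly_monom)
  then show ?thesis by (auto simp: fps_eq_iff q_num_quot_def fps_mult_left_const_nth simp del: mult_pCons_left)
qed

end

theory Submission
  imports Defs
begin

text \<open>
  Each Bose pair acts like a variable and a \<open>q\<close>-derivative: put \<open>D\<^sub>i = [N\<^sub>i + 1]/(N\<^sub>i + 1) A\<^sub>i\<^sup>-\<close>, so that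
  \<open>D\<^sub>i A\<^sub>i\<^sup>+ = [N\<^sub>i + 1]\<close> and \<open>A\<^sub>i\<^sup>+ D\<^sub>i = [N\<^sub>i]\<close>; for a Fermi mode put \<open>D\<^sub>i = A\<^sub>i\<^sup>-\<close>.  All images of generators
  then have one shape, \<open>e\<^sub>i = A\<^sub>i\<^sub>-\<^sub>1\<^sup>+ D\<^sub>i\<close> and \<open>f\<^sub>i = A\<^sub>i\<^sup>+ D\<^sub>i\<^sub>-\<^sub>1\<close>, except that at the end of the chain
  \<open>e\<^sub>1 = [p - N] D\<^sub>1\<close> and \<open>f\<^sub>1 = A\<^sub>1\<^sup>+\<close>.  Operators of different modes commute or anticommute, so every
  relation reduces to a statement about the modes that its factors share.  For a shared Fermi mode
  it follows from \<open>(A\<^sub>i\<^sup>\<plusminus>)\<^sup>2 = 0\<close> or from \<open>N\<^sub>i\<^sup>2 = N\<^sub>i\<close>.  For a shared Bose mode the Serre relations come down to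
  \<open>[x+1] + [x-1] = (q + q\<^sup>-\<^sup>1) [x]\<close>, and the relation for \<open>e\<^sub>i f\<^sub>i - f\<^sub>i e\<^sub>i\<close> comes down to
  \<open>[a+1][b] - [a][b+1] = [b-a]\<close> for commuting \<open>a\<close> and \<open>b\<close>.  The factor \<open>[p - N]\<close> plays the part of a zeroth
  mode: it commutes with every \<open>e\<^sub>j\<close>, \<open>f\<^sub>j\<close> for \<open>j \<ge> 2\<close>, and shifts its argument when it passes \<open>D\<^sub>1\<close> or \<open>A\<^sub>1\<^sup>+\<close>.

  To descend from the free algebra, it is enough that the relators of \<open>U\<^sub>q[gl(n/m)]\<close> evaluate into
  the relation ideal of \<open>W(n-1/m)\<close> (\<open>presented_superalg_hom\<close>): evaluation is \<open>h\<close>-adically continuous and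
  \<open>h\<close>-linear, so the preimage of a closed, \<open>h\<close>-saturated ideal is again closed and \<open>h\<close>-saturated.

  The identities themselves hold only modulo that ideal.  The ideal is closed, so an element lies in it
  as soon as all its coefficients do (\<open>relation_ideal_if_coeffs\<close>), and one can calculate with power series
  over a quotient of \<open>C<X>\<close>.  That quotient depends on \<open>n\<close> and \<open>m\<close> and hence is no type, but the
  product of all quotients of a ring is one, and it contains each quotient as a factor
  (\<open>quotient_at\<close>).  Congruences modulo the relations thus become equations in a ring.  The
  inclusion of a factor is not unital: the class of \<open>1\<close> is an idempotent that acts as a unit on the
  classes only.
\<close>

section \<open>All quotients of a ring inside one ring\<close>

definition two_sided_ideal :: "'a::ring_1 set \<Rightarrow> bool" where
  "two_sided_ideal I \<longleftrightarrow>
    0 \<in> I \<and> (\<forall>x\<in>I. \<forall>y\<in>I. x + y \<in> I) \<and> (\<forall>x\<in>I. \<forall>a. a * x \<in> I \<and> x * a \<in> I)"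

lemma two_sided_idealD:
  assumes "two_sided_ideal I"
  shows "0 \<in> I" "x \<in> I \<Longrightarrow> y \<in> I \<Longrightarrow> x + y \<in> I" "x \<in> I \<Longrightarrow> - x \<in> I"
    "x \<in> I \<Longrightarrow> y \<in> I \<Longrightarrow> x - y \<in> I" "x \<in> I \<Longrightarrow> a * x \<in> I" "x \<in> I \<Longrightarrow> x * a \<in> I"
proof -
  show neg: "- x \<in> I" if "x \<in> I" for x
  proof -
    have "(- 1) * x \<in> I" using assms that unfolding two_sided_ideal_def by blast
    then show ?thesis by simp
  qed
  show "x - y \<in> I" if "x \<in> I" "y \<in> I"
  proof -
    have "x + - y \<in> I" using assms that neg unfolding two_sided_ideal_def by blast
    then show ?thesis by simp
  qed
qed (use assms in \<open>auto simp: two_sided_ideal_def\<close>)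

text \<open>
  Nothing is required at an index that is not an ideal, so the factor there is the zero ring.
\<close>

definition cong_all_ideals :: "('a::ring_1 set \<Rightarrow> 'a) \<Rightarrow> ('a set \<Rightarrow> 'a) \<Rightarrow> bool" where
  "cong_all_ideals f g \<longleftrightarrow> (\<forall>I. two_sided_ideal I \<longrightarrow> f I - g I \<in> I)"

lemma equivp_cong_all_ideals: "equivp (cong_all_ideals :: ('a::ring_1 set \<Rightarrow> 'a) \<Rightarrow> _)"
proof (rule equivpI)
  show "reflp (cong_all_ideals :: ('a set \<Rightarrow> 'a) \<Rightarrow> _)"
    by (rule reflpI) (auto simp: cong_all_ideals_def two_sided_idealD)
  show "symp (cong_all_ideals :: ('a set \<Rightarrow> 'a) \<Rightarrow> _)"
    by (rule sympI) (metis cong_all_ideals_def minus_diff_eq two_sided_idealD(3))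
  show "transp (cong_all_ideals :: ('a set \<Rightarrow> 'a) \<Rightarrow> _)"
  proof (rule transpI)
    fix f g h :: "'a set \<Rightarrow> 'a"
    assume fg: "cong_all_ideals f g" and gh: "cong_all_ideals g h"
    have "f I - h I \<in> I" if "two_sided_ideal I" for I
      using two_sided_idealD(2)[OF that, of "f I - g I" "g I - h I"] fg gh that
      by (simp add: cong_all_ideals_def)
    then show "cong_all_ideals f h" by (simp add: cong_all_ideals_def)
  qed
qed

text \<open>
  The product of the rings \<open>R/I\<close> over all two-sided ideals \<open>I\<close> of \<open>R\<close>.
\<close>

quotient_type (overloaded) 'a quotients = "'a::ring_1 set \<Rightarrow> 'a" / cong_all_ideals
  by (rule equivp_cong_all_ideals)

instantiation quotients :: (ring_1) ring_1
begin

lift_definition zero_quotients :: "'a quotients" is "\<lambda>_. 0" .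
lift_definition one_quotients :: "'a quotients" is "\<lambda>_. 1" .
lift_definition plus_quotients :: "'a quotients \<Rightarrow> 'a quotients \<Rightarrow> 'a quotients"
  is "\<lambda>f g I. f I + g I"
proof (unfold cong_all_ideals_def, intro allI impI)
  fix f f' g g' :: "'a set \<Rightarrow> 'a" and I :: "'a set"
  assume "\<forall>I. two_sided_ideal I \<longrightarrow> f I - f' I \<in> I" "\<forall>I. two_sided_ideal I \<longrightarrow> g I - g' I \<in> I"
    and I: "two_sided_ideal I"
  then have "(f I - f' I) + (g I - g' I) \<in> I" by (intro two_sided_idealD(2)) auto
  then show "f I + g I - (f' I + g' I) \<in> I" by (simp add: algebra_simps)
qed
lift_definition uminus_quotients :: "'a quotients \<Rightarrow> 'a quotients" is "\<lambda>f I. - f I"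
proof (unfold cong_all_ideals_def, intro allI impI)
  fix f g :: "'a set \<Rightarrow> 'a" and I :: "'a set"
  assume "\<forall>I. two_sided_ideal I \<longrightarrow> f I - g I \<in> I" and I: "two_sided_ideal I"
  then have "- (f I - g I) \<in> I" by (intro two_sided_idealD(3)) auto
  then show "- f I - - g I \<in> I" by simp
qed
lift_definition minus_quotients :: "'a quotients \<Rightarrow> 'a quotients \<Rightarrow> 'a quotients"
  is "\<lambda>f g I. f I - g I"
proof (unfold cong_all_ideals_def, intro allI impI)
  fix f f' g g' :: "'a set \<Rightarrow> 'a" and I :: "'a set"
  assume "\<forall>I. two_sided_ideal I \<longrightarrow> f I - f' I \<in> I" "\<forall>I. two_sided_ideal I \<longrightarrow> g I - g' I \<in> I"
    and I: "two_sided_ideal I"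
  then have "(f I - f' I) - (g I - g' I) \<in> I" by (blast intro: two_sided_idealD(4))
  then show "f I - g I - (f' I - g' I) \<in> I" by (simp add: algebra_simps)
qed
lift_definition times_quotients :: "'a quotients \<Rightarrow> 'a quotients \<Rightarrow> 'a quotients"
  is "\<lambda>f g I. f I * g I"
proof (unfold cong_all_ideals_def, intro allI impI)
  fix f f' g g' :: "'a set \<Rightarrow> 'a" and I :: "'a set"
  assume "\<forall>I. two_sided_ideal I \<longrightarrow> f I - f' I \<in> I" "\<forall>I. two_sided_ideal I \<longrightarrow> g I - g' I \<in> I"
    and I: "two_sided_ideal I"
  then have "f I * (g I - g' I) + (f I - f' I) * g' I \<in> I"
    by (intro two_sided_idealD(2) two_sided_idealD(5,6)) auto
  then show "f I * g I - f' I * g' I \<in> I" by (simp add: algebra_simps)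
qed

instance
proof
  show "(0 :: 'a quotients) \<noteq> 1"
  proof (transfer, unfold cong_all_ideals_def, intro notI)
    assume a: "\<forall>I. two_sided_ideal I \<longrightarrow> (0::'a) - 1 \<in> I"
    have "two_sided_ideal {0::'a}" by (simp add: two_sided_ideal_def)
    with a show False by fastforce
  qed
qed (transfer; simp add: cong_all_ideals_def algebra_simps two_sided_idealD)+

end

text \<open>
  The map \<open>R \<rightarrow> R/I\<close> followed by the inclusion of the factor \<open>R/I\<close>.  It is additive and multiplicative,
  but sends \<open>1\<close> to the idempotent that cuts out this factor.
\<close>

lift_definition quotient_at :: "'a::ring_1 set \<Rightarrow> 'a \<Rightarrow> 'a quotients"
  is "\<lambda>I x J. if J = I then x else 0" .

lemma quotient_at_add: "quotient_at I (x + y) = quotient_at I x + quotient_at I y"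
  by transfer (simp add: cong_all_ideals_def two_sided_idealD)
lemma quotient_at_diff: "quotient_at I (x - y) = quotient_at I x - quotient_at I y"
  by transfer (simp add: cong_all_ideals_def two_sided_idealD)
lemma quotient_at_mult: "quotient_at I (x * y) = quotient_at I x * quotient_at I y"
  by transfer (simp add: cong_all_ideals_def two_sided_idealD)
lemma quotient_at_uminus: "quotient_at I (- x) = - quotient_at I x"
  by transfer (simp add: cong_all_ideals_def two_sided_idealD)
lemma quotient_at_0: "quotient_at I 0 = 0"
  by transfer (simp add: cong_all_ideals_def two_sided_idealD)
lemma quotient_at_eq_0_iff: "two_sided_ideal I \<Longrightarrow> quotient_at I x = 0 \<longleftrightarrow> x \<in> I"
  by transfer (auto simp: cong_all_ideals_def two_sided_idealD)
lemma quotient_at_sum: "quotient_at I (sum f A) = (\<Sum>a\<in>A. quotient_at I (f a))"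
  by (induction A rule: infinite_finite_induct) (simp_all add: quotient_at_0 quotient_at_add)
text \<open>
  A central element of \<open>R\<close> stays central in the whole product, since its components outside the factor
  are zero.
\<close>

lemma quotient_at_central:
  assumes "\<And>y. z * y = y * z" shows "quotient_at I z * t = t * quotient_at I z"
  using assms by transfer (simp add: cong_all_ideals_def two_sided_idealD)

section \<open>Graded commutation and the Serre expressions\<close>

text \<open>
  Commutation up to the sign \<open>-1\<close> if \<open>P\<close>.  Signs of products multiply, so the propositions combine by
  exclusive or.
\<close>

definition swaps :: "bool \<Rightarrow> 'b::ring_1 \<Rightarrow> 'b \<Rightarrow> bool" where
  "swaps P a b \<longleftrightarrow> a * b = (if P then - (b * a) else b * a)"

lemma swaps_sym: "swaps P a b \<Longrightarrow> swaps P b a"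
  by (auto simp: swaps_def)

lemma swaps_mult_right:
  assumes "swaps P a b" "swaps Q a c" shows "swaps (P \<noteq> Q) a (b * c)"
proof -
  have "a * (b * c) = (if P then - (b * (a * c)) else b * (a * c))"
    using assms(1) by (simp add: swaps_def mult.assoc [symmetric])
  then show ?thesis
    using assms(2) by (simp add: swaps_def mult.assoc)
qed

lemma swaps_mult_left: "swaps P a c \<Longrightarrow> swaps Q b c \<Longrightarrow> swaps (P \<noteq> Q) (a * b) c"
  by (metis swaps_sym swaps_mult_right)

text \<open>
  A weakening of commutation that still lets a factor \<open>u\<close> with \<open>u\<^sup>2 = 0\<close> annihilate \<open>u w u\<close>.  It covers
  \<open>w = [p - N]\<close>, which \<open>u\<close> shifts to \<open>w' = [p - N \<plusminus> 1]\<close>.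
\<close>

definition passes :: "'b::ring_1 \<Rightarrow> 'b \<Rightarrow> bool" where
  "passes u w \<longleftrightarrow> (\<exists>w'. u * w = w' * u)"

lemma passes_swaps: "swaps P u w \<Longrightarrow> passes u w"
  unfolding passes_def swaps_def by (metis mult_minus_left)

lemma passes_mult: "passes u v \<Longrightarrow> passes u w \<Longrightarrow> passes u (v * w)"
  unfolding passes_def by (metis mult.assoc)

lemma sandwich_zero:
  assumes "u * u = 0" "passes u w" shows "u * w * u = 0"
proof -
  from assms(2) obtain w' where "u * w = w' * u" by (auto simp: passes_def)
  then have "u * w * u = w' * (u * u)" by (simp add: mult.assoc)
  with assms(1) show ?thesis by simp
qed

text \<open>
  The constant \<open>c\<close> stands for \<open>q + q\<^sup>-\<^sup>1\<close>.
\<close>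

definition serre_cubic :: "'b::ring_1 \<Rightarrow> 'b \<Rightarrow> 'b \<Rightarrow> 'b" where
  "serre_cubic c a b = a ^ 2 * b - c * (a * b * a) + b * a ^ 2"

lemma serre_cubic_nilpotent: "a * a = 0 \<Longrightarrow> a * b * a = 0 \<Longrightarrow> serre_cubic c a b = 0"
  by (simp add: serre_cubic_def power2_eq_square)

text \<open>
  The neighbouring generators \<open>L D\<close> and \<open>x R\<close> share only the mode of \<open>D\<close> and \<open>x\<close>.  The factors \<open>L\<close> and \<open>R\<close>
  can be pulled out to the two sides, which leaves the cubic relation of this one mode.  The factor
  \<open>L'\<close> differs from \<open>L\<close> for \<open>L = [p - N]\<close>.
\<close>

lemma serre_cubic_up:
  assumes c: "\<And>t. c * t = t * c" and DL: "D * L = L' * D"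
    and xR: "x * R * L = L * (x * R)" "x * R * L' = L' * (x * R)" and R: "D * R = R * D"
    and S: "serre_cubic c D x = 0"
  shows "serre_cubic c (L * D) (x * R) = 0"
proof -
  have DL': "D * (L * t) = L' * (D * t)" and R': "R * (D * t) = D * (R * t)"
    and xL: "x * (R * (L * t)) = L * (x * (R * t))" "x * (R * (L' * t)) = L' * (x * (R * t))"
    and c': "c * (L * t) = L * (c * t)" "c * (L' * t) = L' * (c * t)" for t
    using DL R xR c[of L] c[of L'] by (metis mult.assoc)+
  have "serre_cubic c (L * D) (x * R) = L * (L' * (serre_cubic c D x * R))"
    by (simp add: serre_cubic_def power2_eq_square mult.assoc algebra_simps DL' R' R xL c')
  with S show ?thesis by simp
qed

text \<open>
  As for the other order, with the factor \<open>L\<close> occurring only once and therefore never meeting \<open>D\<close>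
  from the right.
\<close>

lemma serre_cubic_down:
  assumes c: "\<And>t. c * t = t * c"
    and xR: "x * R * L = L * (x * R)" and R: "x * R = R * x" "D * R = R * D"
    and S: "serre_cubic c x D = 0"
  shows "serre_cubic c (x * R) (L * D) = 0"
proof -
  have R': "R * (D * t) = D * (R * t)" "R * (x * t) = x * (R * t)" for t
    using R by (metis mult.assoc)+
  have "serre_cubic c z (L * D) = L * serre_cubic c z D" if "z * L = L * z" for z
  proof -
    have "z * (L * t) = L * (z * t)" "c * (L * t) = L * (c * t)" for t
      using that c[of L] by (metis mult.assoc)+
    then show ?thesis
      by (simp add: serre_cubic_def power2_eq_square mult.assoc algebra_simps)
  qed
  moreover have "serre_cubic c (x * R) D = serre_cubic c x D * (R * R)"
    by (simp add: serre_cubic_def power2_eq_square mult.assoc algebra_simps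
        R' R(2)[symmetric] R(1)[symmetric])
  ultimately show ?thesis using S xR by simp
qed

definition serre_quartic :: "'b::ring_1 \<Rightarrow> 'b \<Rightarrow> 'b \<Rightarrow> 'b \<Rightarrow> 'b" where
  "serre_quartic c a b z = a * b * a * z + b * a * z * a + a * z * a * b + z * a * b * a
    - c * (a * b * z * a)"

text \<open>
  The odd generator is \<open>x \<psi>\<close>, where \<open>\<psi>\<close> is Fermi.  The two terms in which \<open>z\<close> does not separate
  the two factors \<open>\<psi>\<close> vanish; the remaining three have the common right factor \<open>\<psi> z \<psi>\<close>, and their sum is
  the cubic relation of the Bose mode of \<open>x\<close> and \<open>D\<close>.
\<close>

lemma serre_quartic_zero:
  assumes c: "\<And>t. c * t = t * c"
    and L: "x * \<psi> * L = L * (x * \<psi>)" "z * L = L * z"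
    and comm: "\<psi> * x = x * \<psi>" "\<psi> * D = D * \<psi>" "z * x = x * z" "z * D = D * z"
    and nil: "\<psi> * \<psi> = 0"
    and S: "serre_cubic c x D = 0"
  shows "serre_quartic c (x * \<psi>) (L * D) z = 0"
proof -
  have comm': "\<psi> * (x * t) = x * (\<psi> * t)" "\<psi> * (D * t) = D * (\<psi> * t)"
      "z * (x * t) = x * (z * t)" "z * (D * t) = D * (z * t)"
    and nil': "\<psi> * (\<psi> * t) = 0" for t
    using nil comm by (metis mult.assoc mult_zero_left)+
  have "serre_quartic c a (L * D) z = L * serre_quartic c a D z" if "a * L = L * a" for a
  proof -
    have "a * (L * t) = L * (a * t)" "z * (L * t) = L * (z * t)" "c * (L * t) = L * (c * t)" for t
      using that L c[of L] by (metis mult.assoc)+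
    then show ?thesis
      by (simp add: serre_quartic_def mult.assoc algebra_simps)
  qed
  moreover have "serre_quartic c (x * \<psi>) D z = serre_cubic c x D * (\<psi> * z * \<psi>)"
    by (simp add: serre_cubic_def serre_quartic_def power2_eq_square mult.assoc algebra_simps
        comm comm' nil nil')
  ultimately show ?thesis using S L by simp
qed

text \<open>
  Weights with respect to \<open>h\<close> add.
\<close>

lemma weight_mult:
  assumes "h * a = a * h + s * a" "h * b = b * h + t * b" "t * a = a * (t::'b::ring_1)"
  shows "h * (a * b) = (a * b) * h + (s + t) * (a * b)"
proof -
  have t: "a * (t * b) = t * (a * b)"
    using assms(3) by (simp add: mult.assoc [symmetric])
  have "h * (a * b) = a * (h * b) + s * a * b"
    using assms(1) by (simp add: mult.assoc [symmetric] distrib_right)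
  then show ?thesis
    by (simp add: assms(2) t distrib_left distrib_right mult.assoc)
qed

lemma binomial_commuting:
  fixes x y :: "'b::ring_1"
  assumes "x * y = y * x"
  shows "(x + y) ^ n = (\<Sum>k\<le>n. of_nat (n choose k) * x ^ k * y ^ (n - k))"
proof (induction n)
  case (Suc n)
  let ?c = "\<lambda>n k. of_nat (n choose k) :: 'b"
  have yx: "y * (x ^ k * t) = x ^ k * (y * t)" for k t
    using power_commuting_commutes[OF assms, of k] by (simp add: mult.assoc [symmetric])
  have nat: "a * (of_nat j * b) = of_nat j * (a * b)" for a b :: 'b and j
    using mult_of_nat_commute[of j a] by (simp add: mult.assoc [symmetric])
  have "(x + y) ^ Suc n = x * (\<Sum>k\<le>n. ?c n k * x ^ k * y ^ (n - k)) + y * (\<Sum>k\<le>n. ?c n k * x ^ k * y ^ (n - k))"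
    by (simp add: Suc.IH distrib_right)
  also have "x * (\<Sum>k\<le>n. ?c n k * x ^ k * y ^ (n - k)) = (\<Sum>k\<le>n. ?c n k * x ^ Suc k * y ^ (n - k))"
    unfolding sum_distrib_left by (intro sum.cong refl) (simp add: nat mult.assoc)
  also have "y * (\<Sum>k\<le>n. ?c n k * x ^ k * y ^ (n - k)) = (\<Sum>k\<le>n. ?c n k * x ^ k * y ^ (Suc n - k))"
    unfolding sum_distrib_left
    by (intro sum.cong refl) (simp add: nat yx mult.assoc Suc_diff_le)
  also have "\<dots> = (\<Sum>k\<le>Suc n. ?c n k * x ^ k * y ^ (Suc n - k))"
    by (simp add: binomial_eq_0)
  also have "\<dots> = y ^ Suc n + (\<Sum>k\<le>n. ?c n (Suc k) * x ^ Suc k * y ^ (n - k))"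
    by (subst sum.atMost_Suc_shift) simp
  also have "(\<Sum>k\<le>n. ?c n k * x ^ Suc k * y ^ (n - k)) + \<dots>
      = y ^ Suc n + (\<Sum>k\<le>n. ?c (Suc n) (Suc k) * x ^ Suc k * y ^ (n - k))"
    by (simp only: binomial_Suc_Suc of_nat_add distrib_right sum.distrib add.left_commute)
  also have "\<dots> = (\<Sum>k\<le>Suc n. ?c (Suc n) k * x ^ k * y ^ (Suc n - k))"
    unfolding sum.atMost_Suc_shift[of _ n] by simp
  finally show ?case .
qed simp

section \<open>Scalars and substitution in the completed free algebra\<close>

lemma const_0 [simp]: "const 0 = 0" by (simp add: const_def)
lemma const_1 [simp]: "const 1 = 1" by (simp add: const_def)
lemma const_add: "const (a + b) = const a + const b" by (simp add: const_def single_add)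
lemma const_uminus: "const (- a) = - const a" by (simp add: const_def single_uminus)
lemma const_diff: "const (a - b) = const a - const b" by (simp add: const_def single_diff)
lemma const_mult: "const (a * b) = const a * const b" by (simp add: const_def mult_single)
lemma sum_single_keys: "(\<Sum>w\<in>Poly_Mapping.keys a. Poly_Mapping.single w (Poly_Mapping.lookup a w)) = a"
  by (rule poly_mapping_eqI)
    (simp add: lookup_sum lookup_single when_def in_keys_iff)

lemma free_alg_induct [case_names single add]:
  fixes a :: "'x free_alg"
  assumes "\<And>w c. P (Poly_Mapping.single w c)" and "\<And>a b. P a \<Longrightarrow> P b \<Longrightarrow> P (a + b)"
  shows "P a"
proof -
  have "P (\<Sum>w\<in>S. Poly_Mapping.single w (Poly_Mapping.lookup a w))" for S
    by (induction S rule: infinite_finite_induct) (use assms assms(1)[of _ 0] in auto)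
  from this[of "Poly_Mapping.keys a"] show ?thesis by (simp add: sum_single_keys)
qed

lemma const_central: "const c * a = a * const c"
  by (induction a rule: free_alg_induct) (simp_all add: const_def mult_single distrib_left distrib_right mult.commute)

lemma const_left_commute: "a * (const c * b) = const c * (a * b)"
  using const_central[of c a] by (simp add: mult.assoc [symmetric])

lemma const_sum: "const (sum f A) = (\<Sum>a\<in>A. const (f a))"
  by (induction A rule: infinite_finite_induct) (simp_all add: const_add)

lemma scalar_mult: "scalar (a * b) = scalar a * scalar b"
  by (rule fps_ext) (simp add: scalar_def fps_mult_nth const_mult const_sum)
lemma scalar_add: "scalar (a + b) = scalar a + scalar b"
  by (rule fps_ext) (simp add: scalar_def const_add)
lemma scalar_diff: "scalar (a - b) = scalar a - scalar b"
  by (rule fps_ext) (simp add: scalar_def const_diff)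
lemma scalar_fps_X: "scalar fps_X = fps_X"
  by (rule fps_ext) (simp add: scalar_def fps_X_def)
lemma scalar_1: "scalar 1 = 1"
  by (rule fps_ext) (simp add: scalar_def)
text \<open>
  An intertwining relation may be checked on coefficients, because the formal variable is central.
\<close>

lemma fps_mult_intertwine:
  fixes f g A :: "'a::semiring_0 fps"
  assumes "\<And>i j. fps_nth f i * fps_nth A j = fps_nth A j * fps_nth g i"
  shows "f * A = A * g"
proof (rule fps_ext)
  fix k
  have "fps_nth (f * A) k = (\<Sum>i=0..k. fps_nth A (k - i) * fps_nth g i)"
    by (simp add: fps_mult_nth assms)
  also have "\<dots> = (\<Sum>i=0..k. fps_nth A i * fps_nth g (k - i))"
    by (rule sum.reindex_bij_witness[of _ "\<lambda>i. k - i" "\<lambda>i. k - i"]) auto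
  finally show "fps_nth (f * A) k = fps_nth (A * g) k"
    by (simp add: fps_mult_nth)
qed

lemma scalar_central: "scalar c * x = x * scalar c"
  by (rule fps_mult_intertwine) (simp add: scalar_def const_central[of _ "fps_nth x _"])

lemma subst_poly_upto: "degree p \<le> n \<Longrightarrow> subst_poly p x = (\<Sum>j\<le>n. const (coeff p j) * x ^ j)"
  unfolding subst_poly_def by (rule sum.mono_neutral_left) (auto simp: coeff_eq_0)

lemma subst_poly_0 [simp]: "subst_poly 0 x = 0" by (simp add: subst_poly_def)

lemma subst_poly_add: "subst_poly (p + r) x = subst_poly p x + subst_poly r x"
proof -
  define n where "n = max (degree p) (degree r)"
  have "degree (p + r) \<le> n" "degree p \<le> n" "degree r \<le> n"
    by (auto simp: n_def degree_add_le_max)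
  then show ?thesis
    by (simp add: subst_poly_upto const_add distrib_right sum.distrib)
qed

lemma subst_poly_sum: "subst_poly (sum f A) x = (\<Sum>a\<in>A. subst_poly (f a) x)"
  by (induction A rule: infinite_finite_induct) (simp_all add: subst_poly_add)

lemma subst_poly_smult: "subst_poly (Polynomial.smult c p) x = const c * subst_poly p x"
  using subst_poly_upto[of "Polynomial.smult c p" "degree p"]
  by (simp add: subst_poly_def degree_smult_le sum_distrib_left const_mult mult.assoc)

lemma subst_poly_pCons: "subst_poly (pCons a p) x = const a + x * subst_poly p x"
proof -
  have "subst_poly (pCons a p) x = (\<Sum>j\<le>Suc (degree p). const (coeff (pCons a p) j) * x ^ j)"
    by (rule subst_poly_upto) (simp add: degree_pCons_le)
  also have "\<dots> = const a + (\<Sum>j\<le>degree p. const (coeff p j) * x ^ Suc j)"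
    by (subst sum.atMost_Suc_shift) simp
  also have "(\<Sum>j\<le>degree p. const (coeff p j) * x ^ Suc j) = x * subst_poly p x"
    unfolding subst_poly_def sum_distrib_left
    by (intro sum.cong refl) (simp add: const_left_commute)
  finally show ?thesis .
qed

lemma subst_poly_mult: "subst_poly (p * r) x = subst_poly p x * subst_poly r x"
  by (induction p)
    (simp_all add: subst_poly_add subst_poly_smult subst_poly_pCons distrib_right mult.assoc)

lemma subst_poly_monom: "subst_poly (monom c k) x = const c * x ^ k"
proof (induction k)
  case 0
  then show ?case by (simp add: monom_0 subst_poly_pCons)
next
  case (Suc k)
  then show ?case
    by (simp add: monom_Suc subst_poly_pCons const_left_commute)
qed

lemma subst_mult: "subst (P * Q) x = subst P x * subst Q x"
  by (rule fps_ext) (simp add: subst_def fps_mult_nth subst_poly_sum subst_poly_mult)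

lemma subst_diff: "subst (P - Q) x = subst P x - subst Q x"
proof -
  have "subst_poly (p - r) x = subst_poly p x - subst_poly r x" for p r
    using subst_poly_add[of "p - r" r x] by simp
  then show ?thesis by (intro fps_ext) (simp add: subst_def)
qed

lemma subst_poly_scalar: "subst (poly_scalar c) x = scalar c"
  by (rule fps_ext) (simp add: subst_def poly_scalar_def scalar_def subst_poly_pCons)

lemma subst_var: "subst (fps_const [:0, 1:]) x = fps_const x"
  by (rule fps_ext) (simp add: subst_def subst_poly_pCons)

section \<open>q-numbers\<close>

text \<open>
  Multiplication by \<open>q - q\<^sup>-\<^sup>1\<close> turns \<open>[x]\<close> into a difference of exponentials; identities between
  \<open>q\<close>-numbers are proved in this form, and the factor is cancelled at the end.
\<close>

lemma qbr_eq: "scalar (qh - inverse qh) * qbr x = subst q_power x - subst q_power (- x)"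
proof -
  have "subst q_power_neg x = subst q_power (- x)"
  proof (rule fps_ext)
    fix k
    have pow: "(- x) ^ k = const ((- 1) ^ k) * x ^ k"
      by (cases "even k") (simp_all add: const_uminus)
    have "(- 1 / 2) ^ k / fact k = (1 / 2) ^ k / fact k * (- 1 :: complex) ^ k"
      by (cases "even k") (simp_all add: power_divide)
    then have "const ((- 1 / 2) ^ k / fact k) * x ^ k
        = const ((1 / 2) ^ k / fact k) * (const ((- 1) ^ k) * x ^ k)"
      by (simp only: const_mult mult.assoc)
    with pow show "fps_nth (subst q_power_neg x) k = fps_nth (subst q_power (- x)) k"
      by (simp add: subst_def q_power_def q_power_neg_def subst_poly_monom)
  qed
  then show ?thesis
    unfolding qbr_def by (metis q_num_eq subst_diff subst_mult subst_poly_scalar)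
qed

lemma qbr_quot_mult: "qbr_quot x * fps_const x = qbr x"
  using subst_mult[of q_num_quot "fps_const [:0, 1:]" x] q_num_quot_eq
  by (simp add: qbr_def qbr_quot_def subst_var mult.commute)

text \<open>
  Since \<open>q - q\<^sup>-\<^sup>1 = h + \<dots>\<close>, cancelling it amounts to cancelling \<open>h\<close>.
\<close>

lemma q_difference_divides_h: "\<exists>v. scalar v * scalar (qh - inverse qh) = fps_X"
proof -
  have i: "inverse qh = fps_exp (- (1/2))" by (simp add: qh_def fps_exp_neg)
  have "fps_nth (qh - inverse qh) 0 = 0" "fps_nth (qh - inverse qh) 1 = 1"
    by (simp_all add: i, simp_all add: qh_def)
  then have "subdegree (qh - inverse qh) = 1" "qh - inverse qh \<noteq> 0"
    by (intro subdegreeI, auto)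
  then have "qh - inverse qh dvd fps_X"
    by (subst fps_dvd_iff) auto
  then obtain v where "fps_X = (qh - inverse qh) * v" by (rule dvdE)
  then show ?thesis by (metis scalar_mult scalar_fps_X mult.commute)
qed

lemma q_difference_cancel:
  assumes "scalar (qh - inverse qh) * x = scalar (qh - inverse qh) * y"
  shows "x = y"
proof -
  obtain v where v: "scalar v * scalar (qh - inverse qh) = (fps_X :: 'a cfree_alg)"
    using q_difference_divides_h by blast
  have "fps_X * x = fps_X * y"
    using assms v by (metis mult.assoc)
  then have "fps_nth (fps_X * x) (Suc k) = fps_nth (fps_X * y) (Suc k)" for k by simp
  then show ?thesis by (intro fps_ext) simp
qed

lemma subst_q_power_1: "subst q_power 1 = scalar qh"
  by (rule fps_ext) (simp add: subst_def q_power_def scalar_def qh_def subst_poly_monom)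

lemma subst_q_power_minus_1: "subst q_power (- 1) = scalar (inverse qh)"
proof (rule fps_ext)
  fix k
  have inv: "inverse qh = fps_exp (- (1/2))" by (simp add: qh_def fps_exp_neg)
  have "(- 1 :: 'a free_alg) ^ k = const ((- 1) ^ k)"
    by (cases "even k") (simp_all add: const_uminus)
  moreover have "(1 / 2) ^ k * (- 1) ^ k = (- (1 / 2) :: complex) ^ k"
    by (simp add: power_mult_distrib [symmetric])
  ultimately show "fps_nth (subst q_power (- 1 :: 'a free_alg)) k = fps_nth (scalar (inverse qh)) k"
    unfolding inv by (simp add: subst_def q_power_def scalar_def subst_poly_monom const_mult [symmetric])
qed

lemma qbr_0: "qbr 0 = 0"
  by (rule q_difference_cancel) (simp add: qbr_eq)

lemma qbr_1: "qbr 1 = 1"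
  by (rule q_difference_cancel)
    (simp add: qbr_eq subst_q_power_1 subst_q_power_minus_1, simp add: scalar_diff)

lemma qbr_minus_1: "qbr (- 1) = - 1"
  by (rule q_difference_cancel)
    (simp add: qbr_eq subst_q_power_1 subst_q_power_minus_1, simp add: scalar_diff)

lemma qbr_quot_1: "qbr_quot 1 = 1"
  using qbr_quot_mult[of 1] by (simp add: qbr_1)

section \<open>Evaluation homomorphisms\<close>

definition eval_free :: "(complex \<Rightarrow> 'b::ring_1) \<Rightarrow> ('x \<Rightarrow> 'b) \<Rightarrow> 'x free_alg \<Rightarrow> 'b" where
  "eval_free \<kappa> g a =
    (\<Sum>w\<in>Poly_Mapping.keys a. \<kappa> (Poly_Mapping.lookup a w) * prod_list (map g (letters w)))"

text \<open>
  The action of \<open>C\<close> on the target of an evaluation.  The targets of interest are \<open>C<Y>\<close> and \<open>C<Y>[[h]]\<close>.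
\<close>

locale central_scalars =
  fixes \<kappa> :: "complex \<Rightarrow> 'b::ring_1"
  assumes scalars_add: "\<kappa> (c + d) = \<kappa> c + \<kappa> d"
    and scalars_mult: "\<kappa> (c * d) = \<kappa> c * \<kappa> d"
    and scalars_1: "\<kappa> 1 = 1"
    and scalars_central: "\<kappa> c * t = t * \<kappa> c"
begin

lemma scalars_0: "\<kappa> 0 = 0"
  using scalars_add[of 0 0] by simp

lemma scalars_left_commute: "t * (\<kappa> c * u) = \<kappa> c * (t * u)"
  using scalars_central[of c t] by (simp add: mult.assoc [symmetric])

lemma eval_free_superset:
  assumes "finite S" "Poly_Mapping.keys a \<subseteq> S"
  shows "eval_free \<kappa> g a = (\<Sum>w\<in>S. \<kappa> (Poly_Mapping.lookup a w) * prod_list (map g (letters w)))"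
  unfolding eval_free_def using assms
  by (intro sum.mono_neutral_left) (auto simp: in_keys_iff scalars_0)

lemma eval_free_add: "eval_free \<kappa> g (a + b) = eval_free \<kappa> g a + eval_free \<kappa> g b"
proof -
  let ?S = "Poly_Mapping.keys a \<union> Poly_Mapping.keys b"
  have "Poly_Mapping.keys (a + b) \<subseteq> ?S" by (rule Poly_Mapping.keys_add)
  then show ?thesis
    by (simp add: eval_free_superset[of ?S] lookup_add scalars_add distrib_right sum.distrib)
qed

lemma eval_free_single: "eval_free \<kappa> g (Poly_Mapping.single w c) = \<kappa> c * prod_list (map g (letters w))"
  by (cases "c = 0") (simp_all add: eval_free_def scalars_0)

lemma eval_free_mult: "eval_free \<kappa> g (a * b) = eval_free \<kappa> g a * eval_free \<kappa> g b"
proof (induction a rule: free_alg_induct)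
  case (single w c)
  show ?case
  proof (induction b rule: free_alg_induct)
    case (single v d)
    show ?case
      using scalars_left_commute[of "prod_list (map g (letters w))" d]
      by (simp add: mult_single eval_free_single plus_monomial_def scalars_mult mult.assoc)
  qed (simp add: distrib_left eval_free_add)
qed (simp add: distrib_right eval_free_add)

lemma eval_free_const: "eval_free \<kappa> g (const c) = \<kappa> c"
  by (simp add: const_def eval_free_single zero_monomial_def)

lemma eval_free_var: "eval_free \<kappa> g (var x) = g x"
  by (simp add: var_def eval_free_single scalars_1)

lemma eval_free_0: "eval_free \<kappa> g 0 = 0"
  by (simp add: eval_free_def)

lemma eval_free_sum: "eval_free \<kappa> g (sum f A) = (\<Sum>a\<in>A. eval_free \<kappa> g (f a))"
  by (induction A rule: infinite_finite_induct) (simp_all add: eval_free_add eval_free_0)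

end

interpretation const_scalars: central_scalars "const :: complex \<Rightarrow> 'x free_alg"
  by standard (simp_all add: const_add const_mult, rule const_central)

lemma fps_const_const: "fps_const (const c) = scalar (fps_const c)"
  by (rule fps_ext) (simp add: scalar_def)

interpretation fps_const_scalars: central_scalars "\<lambda>c. fps_const (const c) :: 'x cfree_alg"
  by standard (simp_all add: const_add const_mult, unfold fps_const_const, rule scalar_central)

text \<open>
  The \<open>h\<close>-adically continuous extension of the substitution of \<open>g\<close>: the coefficient of \<open>h\<^sup>k\<close> collects the
  contributions of \<open>h\<^sup>i\<close> times the value of the \<open>i\<close>-th coefficient, for \<open>i \<le> k\<close>.
\<close>

definition evaluate :: "('x \<Rightarrow> 'y cfree_alg) \<Rightarrow> 'x cfree_alg \<Rightarrow> 'y cfree_alg" where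
  "evaluate g x = Abs_fps (\<lambda>k. \<Sum>i=0..k.
    fps_nth (eval_free (\<lambda>c. fps_const (const c)) g (fps_nth x i)) (k - i))"

lemma evaluate_add: "evaluate g (x + y) = evaluate g x + evaluate g y"
  by (rule fps_ext) (simp add: evaluate_def fps_const_scalars.eval_free_add sum.distrib)

lemma evaluate_diff: "evaluate g (x - y) = evaluate g x - evaluate g y"
  using evaluate_add[of g "x - y" y] by simp

lemma evaluate_mult: "evaluate g (x * y) = evaluate g x * evaluate g y"
proof (rule fps_ext)
  fix k
  let ?e = "\<lambda>x i s. fps_nth (eval_free (\<lambda>c. fps_const (const c)) g (fps_nth x i)) s"
  have "fps_nth (evaluate g (x * y)) k = (\<Sum>i=0..k. \<Sum>a=0..i. \<Sum>s=0..k-i. ?e x a s * ?e y (i - a) (k - i - s))"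
    by (simp add: evaluate_def fps_mult_nth fps_const_scalars.eval_free_sum
        fps_const_scalars.eval_free_mult fps_sum_nth)
  also have "\<dots> = (\<Sum>(i, a, s) \<in> (SIGMA i:{0..k}. {0..i} \<times> {0..k-i}). ?e x a s * ?e y (i - a) (k - i - s))"
    by (simp add: sum.Sigma sum.cartesian_product case_prod_unfold)
  \<comment> \<open>The orders \<open>a\<close> and \<open>b\<close> come from \<open>x\<close> and \<open>y\<close>, the rest from the values of \<open>g\<close>; the sum is regrouped from
    the total \<open>a + b\<close> of the former to the part \<open>j\<close> of \<open>k\<close> that the first factor contributes.\<close>
  also have "\<dots> = (\<Sum>(j, a, b) \<in> (SIGMA j:{0..k}. {0..j} \<times> {0..k-j}). ?e x a (j - a) * ?e y b (k - j - b))"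
    by (rule sum.reindex_bij_witness[of _ "\<lambda>(j, a, b). (a + b, a, j - a)" "\<lambda>(i, a, s). (a + s, a, i - a)"])
      (auto simp: algebra_simps)
  also have "\<dots> = (\<Sum>j=0..k. \<Sum>a=0..j. \<Sum>b=0..k-j. ?e x a (j - a) * ?e y b (k - j - b))"
    by (simp add: sum.Sigma sum.cartesian_product case_prod_unfold)
  also have "\<dots> = fps_nth (evaluate g x * evaluate g y) k"
    by (simp add: evaluate_def fps_mult_nth sum_product)
  finally show "fps_nth (evaluate g (x * y)) k = fps_nth (evaluate g x * evaluate g y) k" .
qed

lemma evaluate_fps_const: "evaluate g (fps_const a) = eval_free (\<lambda>c. fps_const (const c)) g a"
proof (rule fps_ext)
  fix k
  show "fps_nth (evaluate g (fps_const a)) k = fps_nth (eval_free (\<lambda>c. fps_const (const c)) g a) k"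
    by (simp add: evaluate_def fps_const_scalars.eval_free_0 sum.atLeast_Suc_atMost if_distrib cong: if_cong)
qed

lemma evaluate_var: "evaluate g (fps_const (var x)) = g x"
  by (simp add: evaluate_fps_const fps_const_scalars.eval_free_var)

lemma evaluate_scalar: "evaluate g (scalar c) = scalar c"
proof (rule fps_ext)
  fix k
  have "fps_nth (evaluate g (scalar c)) k = (\<Sum>i=0..k. if i = k then const (fps_nth c i) else 0)"
    unfolding evaluate_def scalar_def
    by (simp add: fps_const_scalars.eval_free_const)
  then show "fps_nth (evaluate g (scalar c)) k = fps_nth (scalar c) k"
    by (simp add: scalar_def)
qed

lemma evaluate_1: "evaluate g 1 = 1"
  using evaluate_scalar[of g 1] by (simp add: scalar_1)

lemma evaluate_0: "evaluate g 0 = 0"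
  using evaluate_diff[of g 0 0] by simp

lemma evaluate_subst:
  assumes "evaluate g (fps_const x) = fps_const y"
  shows "evaluate g (subst P x) = subst P y"
proof (rule fps_ext)
  fix k
  have x: "eval_free (\<lambda>c. fps_const (const c)) g x = fps_const y"
    using assms by (simp add: evaluate_fps_const)
  have "eval_free (\<lambda>c. fps_const (const c)) g (subst_poly p x) = fps_const (subst_poly p y)" for p
    by (induction p)
      (simp_all add: subst_poly_pCons fps_const_scalars.eval_free_0 fps_const_scalars.eval_free_add
        fps_const_scalars.eval_free_mult fps_const_scalars.eval_free_const x)
  then have "fps_nth (evaluate g (subst P x)) k = (\<Sum>i=0..k. if i = k then subst_poly (fps_nth P i) y else 0)"
    unfolding evaluate_def subst_def by simp
  then show "fps_nth (evaluate g (subst P x)) k = fps_nth (subst P y) k"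
    by (simp add: subst_def)
qed

text \<open>
  The coefficients of the value up to \<open>k\<close> depend only on those of the argument up to \<open>k\<close>.
\<close>

lemma continuous_evaluate: "continuous_on UNIV (evaluate g)"
proof (intro continuous_at_imp_continuous_on ballI)
  fix x :: "'a cfree_alg"
  show "isCont (evaluate g) x"
    unfolding isCont_def LIM_def
  proof (intro allI impI)
    fix e :: real assume "e > 0"
    then obtain k where k: "inverse (2 ^ k) < e"
      using reals_power_lt_ex[of e 2] by (auto simp: inverse_eq_divide power_divide)
    have "dist (evaluate g y) (evaluate g x) < e" if "dist y x < inverse (2 ^ k)" for y
    proof -
      have "fps_nth (evaluate g y) j = fps_nth (evaluate g x) j" if "j \<le> k" for j
        using dist_less_imp_nth_equal[OF \<open>dist y x < inverse (2 ^ k)\<close>] that by (simp add: evaluate_def)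
      then have "dist (evaluate g y) (evaluate g x) < inverse (2 ^ k)" by (rule nth_equal_imp_dist_less)
      with k show ?thesis by simp
    qed
    then show "\<exists>d>0. \<forall>y. y \<noteq> x \<and> dist y x < d \<longrightarrow> dist (evaluate g y) (evaluate g x) < e"
      by (intro exI[of _ "inverse (2 ^ k)"]) auto
  qed
qed

section \<open>Evaluation respects degrees and relations\<close>

definition graded_words :: "'x set \<Rightarrow> ('x \<Rightarrow> bit) \<Rightarrow> bit \<Rightarrow> 'x free_alg set" where
  "graded_words X deg d =
    {a. \<forall>w\<in>Poly_Mapping.keys a. set (letters w) \<subseteq> X \<and> parity deg w = d}"

lemma homog_iff: "x \<in> homog (free_superalg X deg) d \<longleftrightarrow> (\<forall>k. fps_nth x k \<in> graded_words X deg d)"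
  by (auto simp: free_superalg_def words_over_def graded_words_def)

lemma graded_words_add:
  "a \<in> graded_words X deg d \<Longrightarrow> b \<in> graded_words X deg d \<Longrightarrow> a + b \<in> graded_words X deg d"
  unfolding graded_words_def using Poly_Mapping.keys_add[of a b] by blast

lemma graded_words_0: "0 \<in> graded_words X deg d"
  by (simp add: graded_words_def)

lemma graded_words_sum:
  "(\<And>i. i \<in> I \<Longrightarrow> f i \<in> graded_words X deg d) \<Longrightarrow> sum f I \<in> graded_words X deg d"
  by (induction I rule: infinite_finite_induct) (auto intro: graded_words_add graded_words_0)

lemma graded_words_mult:
  "a \<in> graded_words X deg d \<Longrightarrow> b \<in> graded_words X deg d' \<Longrightarrow> a * b \<in> graded_words X deg (d + d')"
  unfolding graded_words_def parity_def by (force dest!: keys_mult_words)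

lemma graded_words_const: "const c \<in> graded_words X deg 0"
  by (simp add: graded_words_def const_def zero_monomial_def parity_def)

lemma graded_words_var: "x \<in> X \<Longrightarrow> var x \<in> graded_words X deg (deg x)"
  by (simp add: graded_words_def var_def parity_def)

lemma homog_mult:
  "x \<in> homog (free_superalg X deg) d \<Longrightarrow> y \<in> homog (free_superalg X deg) d' \<Longrightarrow>
    x * y \<in> homog (free_superalg X deg) (d + d')"
  unfolding homog_iff fps_mult_nth by (intro allI graded_words_sum graded_words_mult) auto

lemma homog_sum:
  "(\<And>i. i \<in> I \<Longrightarrow> f i \<in> homog (free_superalg X deg) d) \<Longrightarrow> sum f I \<in> homog (free_superalg X deg) d"
  by (auto simp: homog_iff fps_sum_nth intro!: graded_words_sum)

lemma homog_fps_const: "a \<in> graded_words X deg d \<Longrightarrow> fps_const a \<in> homog (free_superalg X deg) d"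
  by (auto simp: homog_iff graded_words_0)

lemma homog_1: "1 \<in> homog (free_superalg X deg) 0"
  using homog_fps_const[OF graded_words_const, of 1] by simp

lemma homog_subst:
  assumes "a \<in> graded_words X deg 0" shows "subst P a \<in> homog (free_superalg X deg) 0"
proof -
  have "a ^ j \<in> graded_words X deg 0" for j
    using assms graded_words_const[of 1 X deg] graded_words_mult[of a X deg 0 _ 0]
    by (induction j) auto
  then have "const c * a ^ j \<in> graded_words X deg (0 + 0)" for c j
    by (intro graded_words_mult graded_words_const)
  then show ?thesis
    by (auto simp: homog_iff subst_def subst_poly_def intro!: graded_words_sum)
qed

lemma homog_words_over: "x \<in> homog (free_superalg X deg) d \<Longrightarrow> x \<in> words_over X"
  by (simp add: free_superalg_def)

lemma evaluate_homog:
  assumes g: "\<And>y. y \<in> X \<Longrightarrow> g y \<in> homog (free_superalg X' deg') (deg y)"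
    and x: "x \<in> homog (free_superalg X deg) d"
  shows "evaluate g x \<in> homog (free_superalg X' deg') d"
proof -
  have pl: "prod_list (map g ys) \<in> homog (free_superalg X' deg') (sum_list (map deg ys))"
    if "set ys \<subseteq> X" for ys
    using that
  proof (induction ys)
    case (Cons y ys)
    then have "g y * prod_list (map g ys) \<in> homog (free_superalg X' deg') (deg y + sum_list (map deg ys))"
      by (intro homog_mult g) auto
    then show ?case by simp
  qed (simp add: homog_1)
  have "eval_free (\<lambda>c. fps_const (const c)) g a \<in> homog (free_superalg X' deg') d"
    if a: "a \<in> graded_words X deg d" for a
    unfolding eval_free_def
  proof (rule homog_sum)
    fix w assume "w \<in> Poly_Mapping.keys a"
    then have "prod_list (map g (letters w)) \<in> homog (free_superalg X' deg') d"
      using a pl[of "letters w"] by (auto simp: graded_words_def parity_def)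
    then have "fps_const (const (Poly_Mapping.lookup a w)) * prod_list (map g (letters w))
        \<in> homog (free_superalg X' deg') (0 + d)"
      by (intro homog_mult homog_fps_const graded_words_const)
    then show "fps_const (const (Poly_Mapping.lookup a w)) * prod_list (map g (letters w))
        \<in> homog (free_superalg X' deg') d" by (simp only: add_0)
  qed
  with x show ?thesis
    by (auto simp: homog_iff evaluate_def intro!: graded_words_sum)
qed

lemma evaluate_words_over:
  assumes g: "\<And>y. y \<in> X \<Longrightarrow> g y \<in> words_over X'" and x: "x \<in> words_over X"
  shows "evaluate g x \<in> words_over X'"
proof -
  have pl: "prod_list (map g ys) \<in> words_over X'" if "set ys \<subseteq> X" for ys
    using that by (induction ys) (auto intro: words_over_1 words_over_mult g)
  have sum: "sum f I \<in> words_over X'" if "\<And>i. i \<in> I \<Longrightarrow> f i \<in> words_over X'"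
    for I and f :: "'a monomial \<Rightarrow> 'b cfree_alg"
    using that by (induction I rule: infinite_finite_induct) (auto intro: words_over_0 words_over_add)
  have "eval_free (\<lambda>c. fps_const (const c)) g a \<in> words_over X'" if "a \<in> poly_words_over X" for a
    unfolding eval_free_def using that
    by (intro sum words_over_mult pl words_over_const poly_words_over_const)
      (auto simp: poly_words_over_def)
  with x show ?thesis
    by (auto simp: words_over_iff evaluate_def intro!: poly_words_over_sum)
qed

lemma fps_X_words_over: "fps_X \<in> words_over X"
  using words_over_scalar[of fps_X] by (simp add: scalar_fps_X)

lemma evaluate_fps_X: "evaluate g fps_X = fps_X"
  using evaluate_scalar[of g fps_X] by (simp add: scalar_fps_X)

lemma free_superalg_simps [simp]:
  "carrier (free_superalg X deg) = words_over X"
  "x \<otimes>\<^bsub>free_superalg X deg\<^esub> y = x * y" "\<one>\<^bsub>free_superalg X deg\<^esub> = 1"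
  "x \<oplus>\<^bsub>free_superalg X deg\<^esub> y = x + y" "\<zero>\<^bsub>free_superalg X deg\<^esub> = 0"
  "c \<odot>\<^bsub>free_superalg X deg\<^esub> x = scalar c * x"
  by (simp_all add: free_superalg_def)

lemma ideal_free_superalgI:
  assumes "0 \<in> I" "I \<subseteq> words_over X"
    and add: "\<And>x y. x \<in> I \<Longrightarrow> y \<in> I \<Longrightarrow> x + y \<in> I"
    and mult: "\<And>x a. x \<in> I \<Longrightarrow> a \<in> words_over X \<Longrightarrow> a * x \<in> I \<and> x * a \<in> I"
  shows "ideal I (free_superalg X deg)"
proof -
  interpret A: ring "free_superalg X deg" by (rule ring_free_superalg)
  have neg: "\<ominus>\<^bsub>free_superalg X deg\<^esub> x \<in> I" if "x \<in> I" for x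
  proof -
    have "(- 1) * x \<in> I" using mult[OF that, of "- 1"] by (simp add: words_over_uminus words_over_1)
    moreover have "\<ominus>\<^bsub>free_superalg X deg\<^esub> x = - x"
      using that assms(2) by (intro A.minus_equality) (auto intro: words_over_uminus)
    ultimately show ?thesis by simp
  qed
  show ?thesis
  proof (rule idealI)
    show "subgroup I (add_monoid (free_superalg X deg))"
      by (rule A.add.subgroupI) (use assms neg in \<open>auto simp: a_inv_def\<close>)
  qed (use mult A.ring_axioms in auto)
qed

lemma ideal_free_superalgD:
  assumes "ideal I (free_superalg X deg)"
  shows "0 \<in> I" "x \<in> I \<Longrightarrow> x \<in> words_over X" "x \<in> I \<Longrightarrow> y \<in> I \<Longrightarrow> x + y \<in> I"
    "x \<in> I \<Longrightarrow> a \<in> words_over X \<Longrightarrow> a * x \<in> I" "x \<in> I \<Longrightarrow> a \<in> words_over X \<Longrightarrow> x * a \<in> I"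
    "x \<in> I \<Longrightarrow> - x \<in> I" "x \<in> I \<Longrightarrow> y \<in> I \<Longrightarrow> x - y \<in> I"
proof -
  interpret ideal I "free_superalg X deg" by fact
  show *: "0 \<in> I" "x \<in> I \<Longrightarrow> x \<in> words_over X" "x \<in> I \<Longrightarrow> y \<in> I \<Longrightarrow> x + y \<in> I"
    "x \<in> I \<Longrightarrow> a \<in> words_over X \<Longrightarrow> a * x \<in> I" "x \<in> I \<Longrightarrow> a \<in> words_over X \<Longrightarrow> x * a \<in> I" for x y a
    using additive_subgroup.zero_closed[OF is_additive_subgroup] a_Hcarr
      additive_subgroup.a_closed[OF is_additive_subgroup] I_l_closed I_r_closed
    by auto
  show neg: "x \<in> I \<Longrightarrow> - x \<in> I" for x
    using *(4)[of x "- 1"] words_over_uminus[OF words_over_1, of X] by simp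
  show "x \<in> I \<Longrightarrow> y \<in> I \<Longrightarrow> x - y \<in> I"
    using *(3)[of x "- y"] neg[of y] by simp
qed

text \<open>
  The preimage of each closed, \<open>h\<close>-saturated ideal containing \<open>R'\<close> is such an ideal containing \<open>R\<close>.
\<close>

lemma evaluate_relation_ideal:
  assumes g: "\<And>y. y \<in> X \<Longrightarrow> g y \<in> words_over X'" and R: "R \<subseteq> words_over X"
    and rel: "\<And>r. r \<in> R \<Longrightarrow> evaluate g r \<in> relation_ideal X' deg' R'"
    and x: "x \<in> relation_ideal X deg R"
  shows "evaluate g x \<in> relation_ideal X' deg' R'"
  unfolding relation_ideal_def
proof (intro InterI, elim CollectE conjE)
  fix I assume I: "ideal I (free_superalg X' deg')" "R' \<subseteq> I" "closed I"
    and sat: "\<forall>x\<in>words_over X'. fps_X * x \<in> I \<longrightarrow> x \<in> I"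
  define K where "K = words_over X \<inter> evaluate g -` I"
  note ID = ideal_free_superalgD[OF I(1)]
  note ew = evaluate_words_over[of X g X', OF g]
  have "ideal K (free_superalg X deg)"
  proof (rule ideal_free_superalgI)
    show "a * x \<in> K \<and> x * a \<in> K" if "x \<in> K" "a \<in> words_over X" for x a
      using that ew[of a] ID(4,5)[of "evaluate g x" "evaluate g a"]
      by (simp add: K_def evaluate_mult words_over_mult)
  qed (use ID in \<open>auto simp: K_def evaluate_0 evaluate_add intro: words_over_0 words_over_add\<close>)
  moreover have "R \<subseteq> K"
    using R rel I sat by (auto simp: K_def relation_ideal_def)
  moreover have "closed K"
  proof -
    have "closed (evaluate g -` I)"
      using continuous_on_closed_vimage[of UNIV "evaluate g"] continuous_evaluate[of g] I(3) by auto
    then show ?thesis unfolding K_def by (intro closed_Int closed_words_over)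
  qed
  moreover have "\<forall>x\<in>words_over X. fps_X * x \<in> K \<longrightarrow> x \<in> K"
    using sat ew by (auto simp: K_def evaluate_mult evaluate_fps_X)
  ultimately have "x \<in> K"
    using x unfolding relation_ideal_def by blast
  then show "evaluate g x \<in> I" by (simp add: K_def)
qed

section \<open>Homomorphisms out of a presented superalgebra\<close>

lemma residue_eq: "residue X deg R x = (\<lambda>j. j + x) ` relation_ideal X deg R"
  by (auto simp: residue_def a_r_coset_def' free_superalg_def)

lemma residue_eq_iff:
  assumes "R \<subseteq> words_over X" 
  shows "residue X deg R x = residue X deg R y \<longleftrightarrow> x - y \<in> relation_ideal X deg R"
proof -
  note D = ideal_free_superalgD[OF ideal_relation_ideal[OF assms, of deg]]
  show ?thesis
  proof
    assume "residue X deg R x = residue X deg R y"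
    then have "0 + x \<in> (\<lambda>j. j + y) ` relation_ideal X deg R"
      using D(1) unfolding residue_eq by blast
    then show "x - y \<in> relation_ideal X deg R" by auto
  next
    assume xy: "x - y \<in> relation_ideal X deg R"
    have "(\<lambda>j. j + x) ` relation_ideal X deg R \<subseteq> (\<lambda>j. j + y) ` relation_ideal X deg R"
      if "x - y \<in> relation_ideal X deg R" for x y
    proof
      fix z assume "z \<in> (\<lambda>j. j + x) ` relation_ideal X deg R"
      then obtain j where j: "j \<in> relation_ideal X deg R" "z = j + x" by blast
      then have "z = (j + (x - y)) + y" "j + (x - y) \<in> relation_ideal X deg R"
        using D(3) that by auto
      then show "z \<in> (\<lambda>j. j + y) ` relation_ideal X deg R" by blast
    qed
    moreover have "y - x \<in> relation_ideal X deg R" using D(6)[OF xy] by simp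
    ultimately show "residue X deg R x = residue X deg R y"
      unfolding residue_eq using xy by blast
  qed
qed

lemma presented_superalg_simps:
  fixes deg :: "'x \<Rightarrow> bit" and X R
  assumes "R \<subseteq> words_over X"
  defines "P \<equiv> presented_superalg X deg R"
  shows "carrier P = residue X deg R ` words_over X"
    "x \<in> words_over X \<Longrightarrow> y \<in> words_over X \<Longrightarrow>
      residue X deg R x \<otimes>\<^bsub>P\<^esub> residue X deg R y = residue X deg R (x * y)"
    "x \<in> words_over X \<Longrightarrow> y \<in> words_over X \<Longrightarrow>
      residue X deg R x \<oplus>\<^bsub>P\<^esub> residue X deg R y = residue X deg R (x + y)"
    "\<one>\<^bsub>P\<^esub> = residue X deg R 1"
    "x \<in> words_over X \<Longrightarrow> c \<odot>\<^bsub>P\<^esub> residue X deg R x = residue X deg R (scalar c * x)"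
    "homog P d = residue X deg R ` homog (free_superalg X deg) d"
proof -
  let ?A = "free_superalg X deg" and ?J = "relation_ideal X deg R"
  interpret J: ideal ?J ?A by (rule ideal_relation_ideal[OF assms(1)])
  note D = ideal_free_superalgD[OF J.ideal_axioms]
  show "carrier P = residue X deg R ` words_over X"
    by (auto simp: P_def presented_superalg_def Let_def FactRing_def A_RCOSETS_def' residue_def)
  show "residue X deg R x \<otimes>\<^bsub>P\<^esub> residue X deg R y = residue X deg R (x * y)"
    if "x \<in> words_over X" "y \<in> words_over X"
    using J.rcoset_mult_add[of x y] that
    by (simp add: P_def presented_superalg_def Let_def FactRing_def residue_def)
  show "residue X deg R x \<oplus>\<^bsub>P\<^esub> residue X deg R y = residue X deg R (x + y)"
    if "x \<in> words_over X" "y \<in> words_over X"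
    using J.a_rcos_sum[of x y] that
    by (simp add: P_def presented_superalg_def Let_def FactRing_def residue_def)
  show "\<one>\<^bsub>P\<^esub> = residue X deg R 1"
    by (simp add: P_def presented_superalg_def Let_def FactRing_def residue_def)
  show "c \<odot>\<^bsub>P\<^esub> residue X deg R x = residue X deg R (scalar c * x)" if "x \<in> words_over X"
  proof -
    have "residue X deg R (scalar c * z) = residue X deg R (scalar c * x)"
      if "z \<in> residue X deg R x" for z
    proof -
      from that obtain j where "j \<in> ?J" "z = j + x" by (auto simp: residue_eq)
      then show ?thesis
        using D(4)[OF _ words_over_scalar] by (simp add: residue_eq_iff[OF assms(1)] algebra_simps)
    qed
    moreover have "0 + x \<in> residue X deg R x" using D(1) unfolding residue_eq by blast
    ultimately have "(\<Union>z\<in>residue X deg R x. residue X deg R (scalar c * z)) = residue X deg R (scalar c * x)"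
      by (intro UN_constant_eq ballI) blast+
    then show ?thesis
      by (simp add: P_def presented_superalg_def Let_def)
  qed
  show "homog P d = residue X deg R ` homog (free_superalg X deg) d"
    by (simp add: P_def presented_superalg_def Let_def)
qed

text \<open>
  The universal property of a superalgebra given by generators and relations.
\<close>

lemma presented_superalg_hom:
  assumes g: "\<And>y. y \<in> X \<Longrightarrow> g y \<in> homog (free_superalg X' deg') (deg y)"
    and R: "R \<subseteq> words_over X" and R': "R' \<subseteq> words_over X'"
    and rel: "\<And>r. r \<in> R \<Longrightarrow> evaluate g r \<in> relation_ideal X' deg' R'"
  shows "\<exists>\<phi> \<in> superalg_hom (presented_superalg X deg R) (presented_superalg X' deg' R').
    \<forall>y\<in>X. \<phi> (residue X deg R (fps_const (var y))) = residue X' deg' R' (g y)"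
proof -
  note P = presented_superalg_simps[OF R, where deg = deg]
    and P' = presented_superalg_simps[OF R', where deg = deg']
  have gw: "\<And>y. y \<in> X \<Longrightarrow> g y \<in> words_over X'" using g homog_words_over by blast
  note ew = evaluate_words_over[of X g X', OF gw]
  note D = ideal_free_superalgD[OF ideal_relation_ideal[OF R, of deg]]
  define \<phi> where "\<phi> C = residue X' deg' R' (evaluate g (SOME x. x \<in> C))" for C
  have \<phi>: "\<phi> (residue X deg R x) = residue X' deg' R' (evaluate g x)" for x
  proof -
    have "0 + x \<in> residue X deg R x" using D(1) unfolding residue_eq by blast
    then have "(SOME z. z \<in> residue X deg R x) \<in> residue X deg R x" by (rule someI)
    then obtain j where j: "j \<in> relation_ideal X deg R" "(SOME z. z \<in> residue X deg R x) = j + x"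
      by (auto simp: residue_eq)
    have "evaluate g j \<in> relation_ideal X' deg' R'"
      by (rule evaluate_relation_ideal[OF gw R rel j(1)])
    then show ?thesis
      by (simp add: \<phi>_def j(2) residue_eq_iff[OF R'] evaluate_add)
  qed
  have "\<phi> \<in> superalg_hom (presented_superalg X deg R) (presented_superalg X' deg' R')"
    unfolding superalg_hom_def ring_hom_def
    using evaluate_homog[of X g X' deg' deg, OF g]
    by (auto simp: P P' \<phi> ew evaluate_add evaluate_mult evaluate_1 evaluate_scalar
        words_over_mult words_over_add words_over_scalar)
  moreover have "\<phi> (residue X deg R (fps_const (var y))) = residue X' deg' R' (g y)" for y
    by (simp add: \<phi> evaluate_var)
  ultimately show ?thesis by blast
qed

section \<open>Reduction of coefficients modulo the relations\<close>

text \<open>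
  The retraction of the free algebra on all letters onto \<open>C<X>\<close> that kills the letters outside \<open>X\<close>.
\<close>

definition restrict_to :: "'x set \<Rightarrow> 'x free_alg \<Rightarrow> 'x free_alg" where
  "restrict_to X = eval_free const (\<lambda>x. if x \<in> X then var x else 0)"

lemma restrict_to_words: "restrict_to X a \<in> poly_words_over X"
proof -
  have "prod_list (map (\<lambda>x. if x \<in> X then var x else 0) ys) \<in> poly_words_over X" for ys
    by (induction ys) (auto intro!: poly_words_over_intros)
  then show ?thesis
    unfolding restrict_to_def eval_free_def by (intro poly_words_over_intros)
qed

lemma restrict_to_id:
  assumes "a \<in> poly_words_over X" shows "restrict_to X a = a"
proof -
  have "prod_list (map (\<lambda>x. if x \<in> X then var x else 0) ys) = Poly_Mapping.single (Mon ys) 1"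
    if "set ys \<subseteq> X" for ys
    using that
  proof (induction ys)
    case Nil
    then show ?case using single_one[where 'a="'a monomial"] by (simp add: zero_monomial_def)
  qed (simp add: var_def mult_single plus_monomial_def)
  then have "const c * prod_list (map (\<lambda>x. if x \<in> X then var x else 0) (letters w)) = Poly_Mapping.single w c"
    if "w \<in> Poly_Mapping.keys a" for w c
    using that assms
    by (simp add: poly_words_over_def const_def mult_single zero_monomial_def plus_monomial_def)
  then have "restrict_to X a = (\<Sum>w\<in>Poly_Mapping.keys a. Poly_Mapping.single w (Poly_Mapping.lookup a w))"
    unfolding restrict_to_def eval_free_def by (intro sum.cong refl)
  then show ?thesis by (simp add: sum_single_keys)
qed

text \<open>
  The relation ideal is an ideal of \<open>C<X>[[h]]\<close> only.  Pulled back along the retraction, its constants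
  form an ideal of the free algebra on all letters, so calculations need no membership conditions.
\<close>

definition relation_coeffs :: "'x set \<Rightarrow> ('x \<Rightarrow> bit) \<Rightarrow> 'x cfree_alg set \<Rightarrow> 'x free_alg set" where
  "relation_coeffs X deg R = {a. fps_const (restrict_to X a) \<in> relation_ideal X deg R}"

lemma two_sided_ideal_relation_coeffs:
  assumes "R \<subseteq> words_over X" shows "two_sided_ideal (relation_coeffs X deg R)"
proof -
  note D = ideal_free_superalgD[OF ideal_relation_ideal[OF assms, of deg]]
  have r: "restrict_to X 0 = 0" "restrict_to X (a + b) = restrict_to X a + restrict_to X b"
    "restrict_to X (a * b) = restrict_to X a * restrict_to X b" for a b
    by (simp_all add: restrict_to_def const_scalars.eval_free_0 const_scalars.eval_free_add
        const_scalars.eval_free_mult)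
  show ?thesis
    unfolding two_sided_ideal_def
  proof (intro conjI ballI allI)
    fix x y a assume x: "x \<in> relation_coeffs X deg R"
    show "a * x \<in> relation_coeffs X deg R" "x * a \<in> relation_coeffs X deg R"
      using x D(4,5)[of "fps_const (restrict_to X x)" "fps_const (restrict_to X a)"]
        words_over_const[OF restrict_to_words, of X a]
      by (simp_all add: relation_coeffs_def r)
    assume "y \<in> relation_coeffs X deg R"
    then show "x + y \<in> relation_coeffs X deg R"
      using x D(3) by (fastforce simp: relation_coeffs_def r)
  qed (use D(1) in \<open>simp add: relation_coeffs_def r\<close>)
qed

lemma closed_relation_ideal: "closed (relation_ideal X deg R)"
  unfolding relation_ideal_def by (rule closed_Inter) auto

text \<open>
  The partial sums lie in the ideal and converge to \<open>x\<close>, and the ideal is closed.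
\<close>

lemma relation_ideal_if_coeffs:
  assumes R: "R \<subseteq> words_over X" and c: "\<And>k. fps_const (fps_nth x k) \<in> relation_ideal X deg R"
  shows "x \<in> relation_ideal X deg R"
proof (rule ccontr)
  note D = ideal_free_superalgD[OF ideal_relation_ideal[OF R, of deg]]
  assume "x \<notin> relation_ideal X deg R"
  then obtain e where e: "e > 0" "\<And>y. dist y x < e \<Longrightarrow> y \<notin> relation_ideal X deg R"
    using closed_relation_ideal[of X deg R] unfolding closed_def open_dist by blast
  obtain k where k: "inverse (2 ^ k) < e"
    using reals_power_lt_ex[of e 2] e(1) by (auto simp: inverse_eq_divide power_divide)
  define y where "y = (\<Sum>i\<le>k. fps_const (fps_nth x i) * fps_X ^ i)"
  have sum: "sum f S \<in> relation_ideal X deg R" if "\<And>i. f i \<in> relation_ideal X deg R"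
    for f and S :: "nat set"
    using that by (induction S rule: infinite_finite_induct) (use D(1,3) in auto)
  have "y \<in> relation_ideal X deg R"
    unfolding y_def by (intro sum D(5) c words_over_pow fps_X_words_over)
  moreover have "fps_nth y j = fps_nth x j" if "j \<le> k" for j
    using that by (simp add: y_def fps_sum_nth if_distrib cong: if_cong)
  then have "dist y x < inverse (2 ^ k)" by (rule nth_equal_imp_dist_less)
  ultimately show False using e(2)[of y] k by simp
qed

text \<open>
  The coefficients of \<open>cls x\<close> lie in the factor at \<open>I\<close>, so the unit among these elements is \<open>cls 1\<close>, which
  differs from \<open>1\<close>.
\<close>

locale coefficient_quotient =
  fixes I :: "'x free_alg set"
  assumes ideal: "two_sided_ideal I"
begin

definition cls :: "'x cfree_alg \<Rightarrow> 'x free_alg quotients fps" where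
  "cls x = Abs_fps (\<lambda>k. quotient_at I (fps_nth x k))"

abbreviation con :: "'x free_alg \<Rightarrow> 'x free_alg quotients fps" where
  "con a \<equiv> cls (fps_const a)"

lemma cls_add: "cls (x + y) = cls x + cls y"
  by (rule fps_ext) (simp add: cls_def quotient_at_add)
lemma cls_diff: "cls (x - y) = cls x - cls y"
  by (rule fps_ext) (simp add: cls_def quotient_at_diff)
lemma cls_uminus: "cls (- x) = - cls x"
  by (rule fps_ext) (simp add: cls_def quotient_at_uminus)
lemma cls_0: "cls 0 = 0"
  by (rule fps_ext) (simp add: cls_def quotient_at_0)
lemma cls_mult: "cls (x * y) = cls x * cls y"
  by (rule fps_ext) (simp add: cls_def fps_mult_nth quotient_at_sum quotient_at_mult)
lemma con_eq: "con a = fps_const (quotient_at I a)"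
  by (rule fps_ext) (simp add: cls_def quotient_at_0)

lemma cls_eq_0_iff: "cls x = 0 \<longleftrightarrow> (\<forall>k. fps_nth x k \<in> I)"
  by (auto simp: cls_def fps_eq_iff quotient_at_eq_0_iff[OF ideal])

lemma cls_1_mult: "cls 1 * cls x = cls x" "cls x * cls 1 = cls x"
  by (simp_all add: cls_mult [symmetric])

lemma con_1_mult: "con 1 * cls x = cls x" "cls x * con 1 = cls x"
  using cls_1_mult by simp_all

lemma const_commutes: "quotient_at I (const c) * t = t * quotient_at I (const c)"
  by (rule quotient_at_central) (rule const_central)

lemma scalar_commutes: "cls (scalar c) * t = t * cls (scalar c)"
  by (rule fps_mult_intertwine) (simp add: cls_def scalar_def const_commutes[where t = "fps_nth t _"])

lemma scalar_left_commute: "t * (cls (scalar c) * u) = cls (scalar c) * (t * u)"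
  using scalar_commutes[of c t] by (simp add: mult.assoc [symmetric])

text \<open>
  Power series over any coefficient ring have no \<open>h\<close>-torsion.
\<close>

lemma q_difference_cancel_cls:
  assumes "cls (scalar (qh - inverse qh)) * cls x = cls (scalar (qh - inverse qh)) * cls y"
  shows "cls x = cls y"
proof -
  obtain v where v: "scalar v * scalar (qh - inverse qh) = (fps_X :: 'x cfree_alg)"
    using q_difference_divides_h by blast
  have "cls (scalar v * scalar (qh - inverse qh) * (x - y)) = 0"
    using assms by (simp add: cls_mult cls_diff mult.assoc right_diff_distrib)
  then have "fps_nth (fps_X * (x - y)) (Suc k) \<in> I" for k
    unfolding v cls_eq_0_iff by blast
  then have "cls (x - y) = 0" by (simp add: cls_eq_0_iff)
  then show ?thesis by (simp add: cls_diff)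
qed

section \<open>Functional calculus\<close>

text \<open>
  This is how functions of number operators are moved past creation and annihilation operators:
  from \<open>N A\<^sup>+ = A\<^sup>+ (N + 1)\<close> one gets \<open>P(N) A\<^sup>+ = A\<^sup>+ P(N + 1)\<close>.  Taking for \<open>A\<close> a spectral projection of \<open>x\<close>,
  it also evaluates \<open>P(x)\<close> at the eigenvalues of \<open>x\<close>.
\<close>

lemma subst_intertwines:
  assumes "con x * A = A * con y"
  shows "cls (subst P x) * A = A * cls (subst P y)"
proof -
  have x: "quotient_at I x * fps_nth A j = fps_nth A j * quotient_at I y" for j
    using assms unfolding con_eq by (metis fps_mult_left_const_nth fps_mult_right_const_nth)
  have p: "quotient_at I (subst_poly p x) * fps_nth A j = fps_nth A j * quotient_at I (subst_poly p y)" for p j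
  proof (induction p)
    case (pCons a p)
    have "quotient_at I (x * subst_poly p x) * fps_nth A j = fps_nth A j * quotient_at I (y * subst_poly p y)"
      by (simp add: quotient_at_mult mult.assoc pCons.IH) (simp add: x mult.assoc [symmetric])
    then show ?case
      by (simp add: subst_poly_pCons quotient_at_add distrib_left distrib_right const_commutes[of a "fps_nth A j"])
  qed (simp add: quotient_at_0)
  show ?thesis
    by (rule fps_mult_intertwine) (simp add: cls_def subst_def p)
qed

text \<open>
  \<open>q\<^sup>x q\<^sup>y = q\<^sup>x\<^sup>+\<^sup>y\<close> for commuting \<open>x\<close> and \<open>y\<close>, by the binomial theorem.
\<close>

lemma q_power_add:
  assumes "con x * con y = con y * con x"
  shows "cls (subst q_power x) * cls (subst q_power y) = cls (subst q_power (x + y))"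
proof (rule fps_ext)
  fix n
  let ?\<kappa> = "\<lambda>c. quotient_at I (const c)" and ?x = "quotient_at I x" and ?y = "quotient_at I y"
  let ?a = "\<lambda>k. (1 / 2) ^ k / fact k :: complex"
  have xy: "?x * ?y = ?y * ?x"
    using assms[THEN arg_cong[where f = "\<lambda>t. fps_nth t 0"]] unfolding con_eq by simp
  note c = const_commutes
  have lc: "t * (?\<kappa> c * u) = ?\<kappa> c * (t * u)" for t c u
    using c[of c t] by (simp add: mult.assoc [symmetric])
  have pow: "?\<kappa> c * quotient_at I (z ^ k) = ?\<kappa> c * quotient_at I z ^ k" for c z k
  proof (induction k)
    case (Suc k)
    have "?\<kappa> c * quotient_at I (z ^ Suc k) = quotient_at I z * (?\<kappa> c * quotient_at I (z ^ k))"
      using c[of c "quotient_at I z"] by (simp add: quotient_at_mult mult.assoc [symmetric])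
    also have "\<dots> = ?\<kappa> c * quotient_at I z ^ Suc k"
      unfolding Suc.IH using c[of c "quotient_at I z"] by (simp add: mult.assoc [symmetric])
    finally show ?case .
  qed (simp add: quotient_at_mult [symmetric])
  have nth: "fps_nth (cls (subst q_power z)) k = ?\<kappa> (?a k) * quotient_at I z ^ k" for z k
    by (simp add: cls_def subst_def q_power_def subst_poly_monom quotient_at_mult pow)
  have coeff: "?\<kappa> (?a i) * ?x ^ i * (?\<kappa> (?a (n - i)) * ?y ^ (n - i))
      = ?\<kappa> (?a n) * (of_nat (n choose i) * ?x ^ i * ?y ^ (n - i))" if "i \<le> n" for i
  proof -
    have *: "?\<kappa> (b * of_nat j) = ?\<kappa> b * of_nat j" for b j
      by (induction j) (simp_all add: distrib_left const_add quotient_at_add quotient_at_0)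
    have "?a i * ?a (n - i) = ?a n * of_nat (n choose i)"
      using that by (simp add: binomial_fact power_add [symmetric] field_simps)
    then have "?\<kappa> (?a i) * ?\<kappa> (?a (n - i)) = ?\<kappa> (?a n) * of_nat (n choose i)"
      using * by (metis const_mult quotient_at_mult)
    moreover have "?\<kappa> (?a i) * ?x ^ i * (?\<kappa> (?a (n - i)) * ?y ^ (n - i))
        = ?\<kappa> (?a i) * ?\<kappa> (?a (n - i)) * (?x ^ i * ?y ^ (n - i))"
      by (simp add: mult.assoc lc[of "?x ^ i"])
    ultimately show ?thesis by (simp add: mult.assoc)
  qed
  have "fps_nth (cls (subst q_power x) * cls (subst q_power y)) n
      = (\<Sum>i=0..n. ?\<kappa> (?a n) * (of_nat (n choose i) * ?x ^ i * ?y ^ (n - i)))"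
    unfolding fps_mult_nth nth by (intro sum.cong refl coeff) simp
  also have "\<dots> = ?\<kappa> (?a n) * (?x + ?y) ^ n"
    unfolding binomial_commuting[OF xy] by (simp add: sum_distrib_left atMost_atLeast0)
  finally show "fps_nth (cls (subst q_power x) * cls (subst q_power y)) n
      = fps_nth (cls (subst q_power (x + y))) n"
    by (simp add: nth quotient_at_add)
qed

abbreviation q_diff :: "'x free_alg quotients fps" where
  "q_diff \<equiv> cls (scalar (qh - inverse qh))"

lemma q_diff_qbr: "q_diff * cls (qbr x) = cls (subst q_power x) - cls (subst q_power (- x))"
  by (simp only: cls_mult [symmetric] qbr_eq cls_diff)

lemma q_diff_eq: "q_diff = cls (subst q_power 1) - cls (subst q_power (- 1))"
  by (simp add: scalar_diff cls_diff subst_q_power_1 subst_q_power_minus_1)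

lemma con_arith: "con (x + y) = con x + con y" "con (x - y) = con x - con y" "con (- x) = - con x"
  "con (x * y) = con x * con y" "con 0 = 0"
  by (simp_all add: cls_add [symmetric] cls_diff [symmetric] cls_uminus [symmetric]
      cls_mult [symmetric] cls_0)

lemma qbr_recurrence:
  "cls (qbr (x + 1)) + cls (qbr (x - 1)) = cls (scalar (qh + inverse qh)) * cls (qbr x)"
proof -
  let ?E = "\<lambda>x. cls (subst q_power x)"
  have E: "?E 1 * ?E y = ?E (1 + y)" "?E (- 1) * ?E y = ?E (- 1 + y)" for y
    by (rule q_power_add; simp add: con_arith con_1_mult cls_1_mult)+
  have c: "cls (scalar (qh + inverse qh)) = ?E 1 + ?E (- 1)"
    by (simp add: scalar_add cls_add subst_q_power_1 subst_q_power_minus_1)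
  have "q_diff * (cls (scalar (qh + inverse qh)) * cls (qbr x))
      = cls (scalar (qh + inverse qh)) * (q_diff * cls (qbr x))"
    by (rule scalar_left_commute)
  also have "\<dots> = q_diff * (cls (qbr (x + 1)) + cls (qbr (x - 1)))"
    unfolding distrib_left q_diff_qbr c by (simp add: algebra_simps E)
  finally show ?thesis
    using q_difference_cancel_cls[of "scalar (qh + inverse qh) * qbr x" "qbr (x + 1) + qbr (x - 1)"]
    by (simp only: cls_mult cls_add)
qed

text \<open>
  Multiplied by \<open>(q - q\<^sup>-\<^sup>1)\<^sup>2\<close>, both sides are sums of exponentials; the terms with exponents \<open>\<plusminus>(a + b + 1)\<close>
  cancel on the left.
\<close>

lemma qbr_commutator:
  assumes "con a * con b = con b * con a"
  shows "cls (qbr (a + 1)) * cls (qbr b) - cls (qbr a) * cls (qbr (b + 1)) = cls (qbr (b - a))"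
proof -
  let ?E = "\<lambda>x. cls (subst q_power x)"
  have two: "q_diff * (q_diff * (cls (qbr x) * cls (qbr y))) = (?E x - ?E (- x)) * (?E y - ?E (- y))" for x y
  proof -
    have "q_diff * (q_diff * (cls (qbr x) * cls (qbr y))) = (q_diff * cls (qbr x)) * (q_diff * cls (qbr y))"
      by (simp only: mult.assoc scalar_left_commute[of "cls (qbr x)"])
    then show ?thesis by (simp add: q_diff_qbr)
  qed
  have neg: "con (- x) * con y = con y * con (- x)" "con y * con (- x) = con (- x) * con y"
    and suc: "con (x + 1) * con y = con y * con (x + 1)" "con y * con (x + 1) = con (x + 1) * con y"
    if "con x * con y = con y * con x" for x y
    using that by (simp_all add: con_arith con_1_mult cls_1_mult distrib_left distrib_right)
  have one: "con 1 * con y = con y * con 1" for y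
    by (simp only: con_1_mult)
  have E: "?E (a + 1) * ?E b = ?E (a + 1 + b)" "?E (a + 1) * ?E (- b) = ?E (a + 1 + - b)"
    "?E (- (a + 1)) * ?E b = ?E (- (a + 1) + b)" "?E (- (a + 1)) * ?E (- b) = ?E (- (a + 1) + - b)"
    "?E a * ?E (b + 1) = ?E (a + (b + 1))" "?E a * ?E (- (b + 1)) = ?E (a + - (b + 1))"
    "?E (- a) * ?E (b + 1) = ?E (- a + (b + 1))" "?E (- a) * ?E (- (b + 1)) = ?E (- a + - (b + 1))"
    "?E 1 * ?E (b - a) = ?E (1 + (b - a))" "?E 1 * ?E (- (b - a)) = ?E (1 + - (b - a))"
    "?E (- 1) * ?E (b - a) = ?E (- 1 + (b - a))" "?E (- 1) * ?E (- (b - a)) = ?E (- 1 + - (b - a))"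
    by (intro q_power_add neg(1) suc(1) one neg(2) suc(2) assms assms [symmetric])+
  have "q_diff * (q_diff * (cls (qbr (a + 1)) * cls (qbr b) - cls (qbr a) * cls (qbr (b + 1))))
      = (?E (a + 1) - ?E (- (a + 1))) * (?E b - ?E (- b)) - (?E a - ?E (- a)) * (?E (b + 1) - ?E (- (b + 1)))"
    by (simp only: right_diff_distrib two)
  also have "\<dots> = (?E 1 - ?E (- 1)) * (?E (b - a) - ?E (- (b - a)))"
    by (simp only: left_diff_distrib right_diff_distrib E) (simp add: algebra_simps)
  also have "\<dots> = q_diff * (q_diff * cls (qbr (b - a)))"
    by (simp only: q_diff_eq [symmetric] q_diff_qbr)
  finally have "q_diff * cls (qbr (a + 1) * qbr b - qbr a * qbr (b + 1)) = q_diff * cls (qbr (b - a))"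
    using q_difference_cancel_cls[of
        "scalar (qh - inverse qh) * (qbr (a + 1) * qbr b - qbr a * qbr (b + 1))"
        "scalar (qh - inverse qh) * qbr (b - a)"]
    by (simp only: cls_mult cls_diff)
  from q_difference_cancel_cls[OF this] show ?thesis
    by (simp only: cls_mult cls_diff)
qed

text \<open>
  Where \<open>\<nu>\<close> has eigenvalue \<open>0\<close> or \<open>1\<close>, the operator \<open>b + \<nu>\<close> agrees with \<open>b\<close> or \<open>b + 1\<close>.
\<close>

lemma qbr_add_idempotent:
  assumes "con b * con \<nu> = con \<nu> * con b" "con \<nu> * con \<nu> = con \<nu>"
  shows "cls (qbr b) * (con 1 - con \<nu>) + cls (qbr (b + 1)) * con \<nu> = cls (qbr (b + \<nu>))"
proof -
  have "cls (qbr (b + \<nu>)) * con \<nu> = con \<nu> * cls (qbr (b + 1))"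
    "cls (qbr (b + 1)) * con \<nu> = con \<nu> * cls (qbr (b + 1))"
    "cls (qbr (b + \<nu>)) * (con 1 - con \<nu>) = (con 1 - con \<nu>) * cls (qbr b)"
    "cls (qbr b) * (con 1 - con \<nu>) = (con 1 - con \<nu>) * cls (qbr b)"
    unfolding qbr_def
    by (rule subst_intertwines; use assms in \<open>simp add: con_arith con_1_mult cls_1_mult algebra_simps\<close>)+
  then have "cls (qbr b) * (con 1 - con \<nu>) + cls (qbr (b + 1)) * con \<nu>
      = cls (qbr (b + \<nu>)) * (con 1 - con \<nu>) + cls (qbr (b + \<nu>)) * con \<nu>" by simp
  also have "\<dots> = cls (qbr (b + \<nu>))"
    by (simp add: algebra_simps con_1_mult cls_1_mult)
  finally show ?thesis .
qed

text \<open>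
  The eigenvalues of \<open>\<mu> - \<nu>\<close> are \<open>1\<close>, \<open>-1\<close> and \<open>0\<close>, and there \<open>[x] = x\<close>.
\<close>

lemma qbr_diff_idempotents:
  assumes "con \<mu> * con \<nu> = con \<nu> * con \<mu>" "con \<mu> * con \<mu> = con \<mu>" "con \<nu> * con \<nu> = con \<nu>"
  shows "cls (qbr (\<mu> - \<nu>)) = con (\<mu> - \<nu>)"
proof -
  let ?y = "\<mu> - \<nu>"
  have \<mu>\<nu>: "con \<mu> * (con \<nu> * t) = con \<nu> * (con \<mu> * t)" "con \<mu> * (con \<mu> * t) = con \<mu> * t"
     "con \<nu> * (con \<nu> * t) = con \<nu> * t" for t
    by (simp_all add: mult.assoc [symmetric] assms)
  \<comment> \<open>The spectral projections of \<open>\<mu> - \<nu>\<close> for the eigenvalues \<open>1\<close>, \<open>-1\<close> and \<open>0\<close>.\<close>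
  define A where "A = con \<mu> - con \<nu> * con \<mu>"
  define B where "B = con \<nu> - con \<nu> * con \<mu>"
  define C where "C = con 1 - A - B"
  have y: "con ?y * A = A * con 1" "con ?y * B = B * con (- 1)" "con ?y * C = C * con 0"
    by (simp_all add: A_def B_def C_def con_arith con_1_mult cls_1_mult cls_0 algebra_simps assms \<mu>\<nu>)
  have "cls (qbr ?y) * A = A * cls (qbr 1)" "cls (qbr ?y) * B = B * cls (qbr (- 1))"
      "cls (qbr ?y) * C = C * cls (qbr 0)"
    unfolding qbr_def by (rule subst_intertwines y)+
  then have *: "cls (qbr ?y) * A = A" "cls (qbr ?y) * B = - B" "cls (qbr ?y) * C = 0"
    by (simp_all add: qbr_1 qbr_0 qbr_minus_1 cls_0 cls_uminus)
       (simp_all add: A_def B_def algebra_simps con_1_mult cls_1_mult mult.assoc)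
  have "cls (qbr ?y) = cls (qbr ?y) * (A + B + C)"
    by (simp add: C_def con_1_mult cls_1_mult)
  also have "\<dots> = A - B" by (simp add: * distrib_left)
  also have "\<dots> = con (\<mu> - \<nu>)" by (simp add: A_def B_def con_arith)
  finally show ?thesis .
qed

end

section \<open>Boson and Fermi operators modulo the relations\<close>

lemma relation_ideal_if_cls_0:
  assumes "R \<subseteq> words_over X" "x \<in> words_over X"
    and "coefficient_quotient.cls (relation_coeffs X deg R) x = 0"
  shows "x \<in> relation_ideal X deg R"
proof -
  interpret coefficient_quotient "relation_coeffs X deg R"
    by standard (rule two_sided_ideal_relation_coeffs[OF assms(1)])
  show ?thesis
  proof (rule relation_ideal_if_coeffs[OF assms(1)])
    fix k
    have "fps_nth x k \<in> relation_coeffs X deg R" using assms(3) by (simp add: cls_eq_0_iff)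
    moreover have "fps_nth x k \<in> poly_words_over X" using assms(2) by (simp add: words_over_iff)
    ultimately show "fps_const (fps_nth x k) \<in> relation_ideal X deg R"
      by (simp add: relation_coeffs_def restrict_to_id)
  qed
qed

lemma relation_ideal_superset: "R \<subseteq> relation_ideal X deg R"
  unfolding relation_ideal_def by blast

locale boson_fermion =
  fixes n m :: nat and p :: complex
  assumes n: "n \<ge> 1"

sublocale boson_fermion \<subseteq> coefficient_quotient "relation_coeffs (W_gens n m) (W_deg n) (W_rels n m)"
  by standard (rule two_sided_ideal_relation_coeffs[OF W_rels_words_over])

context boson_fermion
begin

abbreviation mode :: "nat \<Rightarrow> bool" where "mode i \<equiv> 1 \<le> i \<and> i \<le> n + m - 1"
abbreviation fermi :: "nat \<Rightarrow> bool" where "fermi i \<equiv> n \<le> i"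
abbreviation ap where "ap i \<equiv> con (var (Cr i))"
abbreviation am where "am i \<equiv> con (var (An i))"

lemma con_relation:
  assumes "fps_const a \<in> W_rels n m" shows "con a = 0"
proof -
  have "fps_const a \<in> relation_ideal (W_gens n m) (W_deg n) (W_rels n m)"
    using assms relation_ideal_superset by blast
  moreover have "a \<in> poly_words_over (W_gens n m)"
    using W_rels_words_over assms words_over_iff[of "fps_const a"] by (metis fps_nth_fps_const subsetD)
  ultimately have "a \<in> relation_coeffs (W_gens n m) (W_deg n) (W_rels n m)"
    by (simp add: relation_coeffs_def restrict_to_id)
  moreover have "0 \<in> relation_coeffs (W_gens n m) (W_deg n) (W_rels n m)"
    using two_sided_idealD(1)[OF ideal] .
  ultimately show ?thesis by (simp add: cls_eq_0_iff)
qed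

lemma superbracket_theta:
  "superbracket (theta n i) (theta n j) x y = (if fermi i \<and> fermi j then x * y + y * x else x * y - y * x)"
  by (simp add: superbracket_def theta_def)

lemma W_relations:
  assumes "mode i" "mode j"
  shows "am i * ap j = (if fermi i \<and> fermi j then - (ap j * am i) else ap j * am i) + (if i = j then con 1 else 0)"
    and "swaps (fermi i \<and> fermi j) (ap i) (ap j)"
    and "swaps (fermi i \<and> fermi j) (am i) (am j)"
proof -
  have ij: "i \<in> {1..n+m-1}" "j \<in> {1..n+m-1}" using assms by auto
  have "fps_const (superbracket (theta n i) (theta n j) (var (An i)) (var (Cr j)) - of_bool (i = j))
      = superbracket (theta n i) (theta n j) (Am i) (Ap j) - of_bool (i = j)"
    by (cases "i = j") (simp_all add: superbracket_theta flip: fps_const_sub fps_const_add fps_const_mult)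
  then have "con (superbracket (theta n i) (theta n j) (var (An i)) (var (Cr j)) - of_bool (i = j)) = 0"
    using W_rels.mp[OF ij] by (intro con_relation) simp
  then show "am i * ap j = (if fermi i \<and> fermi j then - (ap j * am i) else ap j * am i) + (if i = j then con 1 else 0)"
    by (auto simp: superbracket_theta con_arith cls_0 algebra_simps eq_neg_iff_add_eq_0 split: if_splits)
  have "con (superbracket (theta n i) (theta n j) (var (Cr i)) (var (Cr j))) = 0"
    using W_rels.pp[OF ij] by (intro con_relation) (auto simp: superbracket_theta)
  then show "swaps (fermi i \<and> fermi j) (ap i) (ap j)"
    by (auto simp: swaps_def superbracket_theta con_arith eq_neg_iff_add_eq_0 split: if_splits)
  have "con (superbracket (theta n i) (theta n j) (var (An i)) (var (An j))) = 0"
    using W_rels.mm[OF ij] by (intro con_relation) (auto simp: superbracket_theta)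
  then show "swaps (fermi i \<and> fermi j) (am i) (am j)"
    by (auto simp: swaps_def superbracket_theta con_arith eq_neg_iff_add_eq_0 split: if_splits)
qed

lemma swaps_am_ap: "mode i \<Longrightarrow> mode j \<Longrightarrow> i \<noteq> j \<Longrightarrow> swaps (fermi i \<and> fermi j) (am i) (ap j)"
  using W_relations(1) by (simp add: swaps_def)

lemma swaps_ap_am: "mode i \<Longrightarrow> mode j \<Longrightarrow> i \<noteq> j \<Longrightarrow> swaps (fermi i \<and> fermi j) (ap i) (am j)"
  using swaps_sym[OF swaps_am_ap, of j i] by (simp add: conj_commute)

text \<open>
  Anticommuting with itself makes an element square to zero, because \<open>2\<close> is invertible.
\<close>

lemma con_double_eq_0:
  assumes "con a = - con a" shows "con a = 0"
proof -
  have "const (1 / 2) + const (1 / 2) = (1 :: wgen free_alg)"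
    using const_add[of "1 / 2" "1 / 2"] by simp
  then have "con a = con (const (1 / 2) * (a + a))"
    using distrib_right[of "const (1 / 2)" "const (1 / 2)" a] by (simp add: distrib_left)
  also have "\<dots> = con (const (1 / 2)) * (con a + con a)" by (simp only: con_arith)
  also have "con a + con a = 0" by (subst assms) simp
  finally show ?thesis by simp
qed

lemma fermi_square: "mode i \<Longrightarrow> fermi i \<Longrightarrow> ap i * ap i = 0" "mode i \<Longrightarrow> fermi i \<Longrightarrow> am i * am i = 0"
  using W_relations(2,3)[of i i] con_double_eq_0[of "var (Cr i) * var (Cr i)"]
    con_double_eq_0[of "var (An i) * var (An i)"]
  by (simp_all only: swaps_def con_arith) auto

abbreviation N where "N i \<equiv> con (Num i)"

lemma N_eq: "N i = ap i * am i"
  by (simp add: Num_def con_arith del: fps_const_mult)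

lemma N_ap:
  assumes "mode i" "mode j"
  shows "N i * ap j = ap j * N i + of_bool (i = j) * ap j"
proof (cases "i = j")
  case True
  have sq: "ap i * (ap i * t) = 0" if "fermi i" for t
    using fermi_square(1)[OF assms(1) that] by (simp add: mult.assoc [symmetric])
  have "N i * ap i = ap i * (am i * ap i)" by (simp only: N_eq mult.assoc)
  also have "\<dots> = ap i * N i + ap i"
    unfolding W_relations(1)[OF assms(1,1)] N_eq
    by (cases "fermi i") (simp_all add: sq distrib_left right_diff_distrib cls_1_mult)
  finally show ?thesis using True by simp
next
  case False
  have "swaps ((fermi i \<and> fermi j) \<noteq> (fermi i \<and> fermi j)) (ap i * am i) (ap j)"
    using False assms by (intro swaps_mult_left W_relations swaps_am_ap)
  then show ?thesis using False by (simp add: N_eq swaps_def)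
qed

lemma N_am:
  assumes "mode i" "mode j"
  shows "N i * am j = am j * N i + - of_bool (i = j) * am j"
proof (cases "i = j")
  case True
  have sq: "am i * am i = 0" if "fermi i"
    using fermi_square(2)[OF assms(1) that] .
  have "am i * N i = (am i * ap i) * am i" by (simp only: N_eq mult.assoc)
  also have "\<dots> = N i * am i + am i"
    unfolding W_relations(1)[OF assms(1,1)] N_eq
    by (cases "fermi i") (simp_all add: sq distrib_right left_diff_distrib mult.assoc cls_1_mult)
  finally show ?thesis using True by simp
next
  case False
  have "swaps ((fermi i \<and> fermi j) \<noteq> (fermi i \<and> fermi j)) (ap i * am i) (am j)"
    using False assms by (intro swaps_mult_left W_relations swaps_ap_am)
  then show ?thesis using False by (simp add: N_eq swaps_def)
qed

lemma N_commute: "mode i \<Longrightarrow> mode j \<Longrightarrow> N i * N j = N j * N i"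
  using weight_mult[OF N_ap N_am, of i j j] mult_of_int_commute[of "- of_bool (i = j)" "ap j"]
  by (simp add: N_eq)

section \<open>q-deformed annihilators\<close>

text \<open>
  In a Bose mode, realised on polynomials with \<open>A\<^sub>i\<^sup>+\<close> as multiplication by a variable, this is the
  \<open>q\<close>-derivative.
\<close>

definition D :: "nat \<Rightarrow> wgen free_alg quotients fps" where
  "D i = (if fermi i then am i else cls (qbr_quot (Num i + 1)) * am i)"

definition p_minus_N :: "wgen free_alg" where
  "p_minus_N = const p - Ntot n m"

lemma qbr_quot_commutes:
  assumes "N i * t = t * N i" "con 1 * t = t" "t * con 1 = t"
  shows "cls (qbr_quot (Num i + 1)) * t = t * cls (qbr_quot (Num i + 1))"
  unfolding qbr_quot_def
  by (rule subst_intertwines) (use assms in \<open>simp add: con_arith distrib_left distrib_right\<close>)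

lemma qbr_quot_swaps:
  assumes "mode i" "mode j" "i \<noteq> j"
  shows "swaps False (cls (qbr_quot (Num i + 1))) (ap j)" "swaps False (cls (qbr_quot (Num i + 1))) (am j)"
  unfolding swaps_def
  using N_ap[of i j] N_am[of i j] assms by (auto intro!: qbr_quot_commutes simp: cls_1_mult)

lemma D_boson: "\<not> fermi i \<Longrightarrow> D i = cls (qbr_quot (Num i + 1)) * am i"
  and D_fermi: "fermi i \<Longrightarrow> D i = am i"
  by (simp_all add: D_def)

lemma D_corner: "cls 1 * D i = D i" "D i * cls 1 = D i"
  by (simp_all add: D_def cls_1_mult flip: cls_mult)

lemma swaps_D_right:
  assumes "swaps P (am i) t" "swaps False (cls (qbr_quot (Num i + 1))) t"
  shows "swaps P (D i) t"
  using swaps_mult_left[OF assms(2,1)] assms(1) by (simp add: D_def)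

lemma swaps_D_ap: "mode i \<Longrightarrow> mode j \<Longrightarrow> i \<noteq> j \<Longrightarrow> swaps (fermi i \<and> fermi j) (D i) (ap j)"
  by (intro swaps_D_right swaps_am_ap qbr_quot_swaps)

lemma swaps_D_D:
  assumes "mode i" "mode j" shows "swaps (fermi i \<and> fermi j) (D i) (D j)"
proof (cases "i = j")
  case True
  then show ?thesis
    using W_relations(3)[of i i] assms by (cases "fermi i") (simp_all add: D_def, simp add: swaps_def)
next
  case False
  have "swaps (fermi j \<and> fermi i) (D j) (am i)"
    by (intro swaps_D_right qbr_quot_swaps W_relations(3)) (use assms False in auto)
  then have "swaps (fermi i \<and> fermi j) (D j) (am i)"
    by (subst conj_commute)
  moreover have "swaps False (D j) (cls (qbr_quot (Num i + 1)))"
  proof (rule swaps_D_right)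
    show "swaps False (am j) (cls (qbr_quot (Num i + 1)))"
      using qbr_quot_swaps(2)[of i j] assms False by (blast intro: swaps_sym)
    have "N j * cls (qbr_quot (Num i + 1)) = cls (qbr_quot (Num i + 1)) * N j"
      using N_commute[OF assms] by (intro qbr_quot_commutes[symmetric]) (simp_all add: cls_1_mult)
    then show "swaps False (cls (qbr_quot (Num j + 1))) (cls (qbr_quot (Num i + 1)))"
      unfolding swaps_def if_False by (intro qbr_quot_commutes) (simp_all add: cls_1_mult)
  qed
  ultimately show ?thesis
    by (rule swaps_D_right[OF swaps_sym swaps_sym])
qed

lemma D_square: "mode i \<Longrightarrow> fermi i \<Longrightarrow> D i * D i = 0"
  by (simp add: D_def fermi_square)

lemma N_D:
  assumes "mode i" "mode j" shows "N i * D j = D j * N i + - of_bool (i = j) * D j"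
proof (cases "fermi j")
  case False
  have "cls (qbr_quot (Num j + 1)) * N i = N i * cls (qbr_quot (Num j + 1))"
    using N_commute[of i j] assms by (intro qbr_quot_commutes) (simp_all add: cls_1_mult)
  then have "N i * cls (qbr_quot (Num j + 1)) = cls (qbr_quot (Num j + 1)) * N i + 0 * cls (qbr_quot (Num j + 1))"
    by simp
  from weight_mult[OF this N_am[OF assms]] mult_of_int_commute[of "- of_bool (i = j)"] False
  show ?thesis by (simp add: D_def)
next
  case True
  then show ?thesis using N_am[OF assms] by (simp only: D_fermi)
qed

lemma D_ap_boson:
  assumes "mode i" "\<not> fermi i" shows "D i * ap i = cls (qbr (Num i + 1))"
proof -
  have "D i * ap i = cls (qbr_quot (Num i + 1)) * (am i * ap i)"
    using assms by (simp only: D_def mult.assoc if_False)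
  also have "am i * ap i = con (Num i + 1)"
    using W_relations(1)[of i i] assms by (simp add: N_eq con_arith)
  finally show ?thesis by (simp only: cls_mult [symmetric] qbr_quot_mult)
qed

lemma ap_D_boson:
  assumes "mode i" "\<not> fermi i" shows "ap i * D i = cls (qbr (Num i))"
proof -
  have "con (Num i) * ap i = ap i * con (Num i + 1)"
    using N_ap[of i i] assms by (simp add: con_arith distrib_left cls_1_mult)
  then have "cls (qbr_quot (Num i)) * ap i = ap i * cls (qbr_quot (Num i + 1))"
    unfolding qbr_quot_def by (rule subst_intertwines)
  then have "ap i * D i = cls (qbr_quot (Num i)) * (ap i * am i)"
    using assms by (simp add: D_def mult.assoc [symmetric])
  then show ?thesis
    unfolding N_eq [symmetric] by (simp only: cls_mult [symmetric] qbr_quot_mult)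
qed

lemma ap_D_fermi:
  assumes "mode i" "fermi i" shows "ap i * D i = N i" "D i * ap i = con 1 - N i"
  using assms W_relations(1)[of i i] by (simp_all add: D_def N_eq)

definition q_sum where "q_sum = cls (scalar (qh + inverse qh))"

lemma q_sum_central: "q_sum * t = t * q_sum"
  unfolding q_sum_def by (rule scalar_commutes)

lemma q_sum_left_commute: "t * (q_sum * u) = q_sum * (t * u)"
  unfolding q_sum_def by (rule scalar_left_commute)

text \<open>
  Every term is \<open>D\<^sub>i\<close> (or \<open>A\<^sub>i\<^sup>+\<close>) times a \<open>q\<close>-number of \<open>N\<^sub>i\<close> with a shift, and the sum is
  \<open>[x+1] + [x-1] - (q + q\<^sup>-\<^sup>1) [x]\<close> for \<open>x = N\<^sub>i\<close> (or \<open>x = N\<^sub>i + 1\<close>).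
\<close>

lemma serre_D_ap:
  assumes "mode i" "\<not> fermi i"
  shows "serre_cubic q_sum (D i) (ap i) = 0" "serre_cubic q_sum (ap i) (D i) = 0"
proof -
  have comm: "con (Num i) * D i = D i * con (Num i - 1)" "con (Num i + 1) * ap i = ap i * con (Num i + 1 + 1)"
    "con (Num i + 1) * D i = D i * con (Num i)" "con (Num i) * ap i = ap i * con (Num i + 1)"
    using N_D[of i i] N_ap[of i i] assms
    by (simp_all add: con_arith cls_1_mult D_corner algebra_simps)
  have sh: "cls (qbr (Num i)) * D i = D i * cls (qbr (Num i - 1))"
    "cls (qbr (Num i + 1)) * ap i = ap i * cls (qbr (Num i + 1 + 1))"
    "cls (qbr (Num i + 1)) * D i = D i * cls (qbr (Num i))"
    "cls (qbr (Num i)) * ap i = ap i * cls (qbr (Num i + 1))"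
    unfolding qbr_def by (rule subst_intertwines comm)+
  have "serre_cubic q_sum (D i) (ap i)
      = D i * (D i * ap i) - q_sum * ((D i * ap i) * D i) + (ap i * D i) * D i"
    by (simp add: serre_cubic_def power2_eq_square mult.assoc)
  also have "\<dots> = D i * (cls (qbr (Num i + 1)) + cls (qbr (Num i - 1)) - q_sum * cls (qbr (Num i)))"
    unfolding D_ap_boson[OF assms] ap_D_boson[OF assms] sh
    by (simp add: right_diff_distrib distrib_left q_sum_left_commute[of "D i"])
  finally show "serre_cubic q_sum (D i) (ap i) = 0"
    using qbr_recurrence[of "Num i"] by (simp add: q_sum_def)
  have "serre_cubic q_sum (ap i) (D i)
      = ap i * (ap i * D i) - q_sum * ((ap i * D i) * ap i) + (D i * ap i) * ap i"
    by (simp add: serre_cubic_def power2_eq_square mult.assoc)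
  also have "\<dots> = ap i * (cls (qbr (Num i + 1 + 1)) + cls (qbr (Num i + 1 - 1)) - q_sum * cls (qbr (Num i + 1)))"
    unfolding D_ap_boson[OF assms] ap_D_boson[OF assms] sh
    by (simp add: right_diff_distrib distrib_left q_sum_left_commute[of "ap i"])
  finally show "serre_cubic q_sum (ap i) (D i) = 0"
    using qbr_recurrence[of "Num i + 1"] by (simp add: q_sum_def)
qed

section \<open>Cartan elements\<close>

lemma con_const_commutes: "con (const c) * t = t * con (const c)"
  unfolding fps_const_const by (rule scalar_commutes)

lemma con_sum: "con (sum f A) = (\<Sum>a\<in>A. con (f a))"
  by (induction A rule: infinite_finite_induct) (simp_all add: con_arith cls_0 del: fps_const_add)

text \<open>
  An operator that changes the number of particles in mode \<open>j\<close> by \<open>w\<close>, and no other, changes \<open>p - N\<close>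
  by \<open>-w\<close>.
\<close>

lemma p_minus_N_weight:
  assumes "mode j" and w: "\<And>k. mode k \<Longrightarrow> N k * t = t * N k + of_int (w * of_bool (k = j)) * t"
  shows "con p_minus_N * t = t * con p_minus_N + of_int (- w) * t"
proof -
  have "(\<Sum>k=1..n+m-1. N k) * t = (\<Sum>k=1..n+m-1. t * N k + of_int (w * of_bool (k = j)) * t)"
    unfolding sum_distrib_right by (intro sum.cong refl w) auto
  also have "\<dots> = t * (\<Sum>k=1..n+m-1. N k) + of_int (\<Sum>k=1..n+m-1. w * of_bool (k = j)) * t"
    by (simp only: sum.distrib sum_distrib_left sum_distrib_right of_int_sum)
  also have "(\<Sum>k=1..n+m-1. w * of_bool (k = j)) = w"
    using assms(1) by (simp add: of_bool_def if_distrib cong: if_cong)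
  finally show ?thesis
    using con_const_commutes[of p t]
    by (simp add: p_minus_N_def Ntot_def con_arith con_sum left_diff_distrib right_diff_distrib del: fps_const_sub)
qed

definition cartan :: "nat \<Rightarrow> wgen free_alg" where
  "cartan i = (if i = 1 then p_minus_N else Num (i - 1))"

text \<open>
  The weight of \<open>A\<^sub>k\<^sup>+\<close> under the image of \<open>h\<^sub>i\<close>; the weight of \<open>D\<^sub>k\<close> is its negative.
\<close>

definition cartan_weight :: "nat \<Rightarrow> nat \<Rightarrow> int" where
  "cartan_weight i k = (if i = 1 then - 1 else of_bool (i = k + 1))"

lemma cartan_ap:
  assumes "i \<in> {1..n+m}" "mode k"
  shows "con (cartan i) * ap k = ap k * con (cartan i) + of_int (cartan_weight i k) * ap k"
proof (cases "i = 1")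
  case True
  have "con p_minus_N * ap k = ap k * con p_minus_N + of_int (- 1) * ap k"
    by (rule p_minus_N_weight[OF assms(2)]) (use N_ap[OF _ assms(2)] in simp)
  with True show ?thesis by (simp add: cartan_def cartan_weight_def)
next
  case False
  then have "(i - 1 = k) = (i = k + 1)" "mode (i - 1)" using assms by auto
  with False show ?thesis using N_ap[of "i - 1" k] assms by (simp add: cartan_def cartan_weight_def)
qed

lemma cartan_D:
  assumes "i \<in> {1..n+m}" "mode k"
  shows "con (cartan i) * D k = D k * con (cartan i) + of_int (- cartan_weight i k) * D k"
proof (cases "i = 1")
  case True
  have "con p_minus_N * D k = D k * con p_minus_N + of_int (- (- 1)) * D k"
    by (rule p_minus_N_weight[OF assms(2)]) (use N_D[OF _ assms(2)] in simp)
  with True show ?thesis by (simp add: cartan_def cartan_weight_def)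
next
  case False
  then have "(i - 1 = k) = (i = k + 1)" "mode (i - 1)" using assms by auto
  with False show ?thesis using N_D[of "i - 1" k] assms by (simp add: cartan_def cartan_weight_def)
qed

lemma cartan_N:
  assumes "i \<in> {1..n+m}" "mode k"
  shows "con (cartan i) * N k = N k * con (cartan i)"
proof (cases "i = 1")
  case True
  have "con p_minus_N * N k = N k * con p_minus_N + of_int (- 0) * N k"
    by (rule p_minus_N_weight[OF assms(2)]) (use N_commute[OF _ assms(2)] in simp)
  with True show ?thesis by (simp add: cartan_def)
next
  case False
  then have "mode (i - 1)" using assms by auto
  with False show ?thesis using N_commute[of "i - 1" k] assms by (simp add: cartan_def)
qed

lemma cartan_commute:
  assumes "i \<in> {1..n+m}" "j \<in> {1..n+m}"
  shows "con (cartan i) * con (cartan j) = con (cartan j) * con (cartan i)"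
proof (cases "j = 1")
  case True
  show ?thesis
  proof (cases "i = 1")
    case False
    then have "mode (i - 1)" using assms by auto
    with False show ?thesis using cartan_N[of j "i - 1"] assms True by (simp add: cartan_def)
  qed (use True in simp)
next
  case False
  then have "mode (j - 1)" using assms by auto
  with False show ?thesis using cartan_N[of i "j - 1"] assms by (simp add: cartan_def)
qed

lemma commuting_qbr:
  "con x * con y = con y * con x \<Longrightarrow> cls (qbr x) * con y = con y * cls (qbr x)"
  "con x * con y = con y * con x \<Longrightarrow> con y * cls (qbr x) = cls (qbr x) * con y"
  unfolding qbr_def by (simp_all add: subst_intertwines)

lemma commuting_qbr_qbr:
  assumes "con x * con y = con y * con x"
  shows "cls (qbr x) * cls (qbr y) = cls (qbr y) * cls (qbr x)"
  unfolding qbr_def[of x] by (rule subst_intertwines) (rule commuting_qbr(2)[OF assms [symmetric]])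

section \<open>The images of the generators\<close>

text \<open>
  At \<open>i = 1\<close> the factor \<open>[p - N]\<close> replaces the missing creation operator \<open>A\<^sub>0\<^sup>+\<close>, and \<open>1\<close> replaces \<open>D\<^sub>0\<close>.
\<close>

definition left :: "nat \<Rightarrow> wgen free_alg quotients fps" where
  "left i = (if i = 1 then cls (qbr p_minus_N) else ap (i - 1))"

definition right :: "nat \<Rightarrow> wgen free_alg quotients fps" where
  "right i = (if i = 1 then 1 else D (i - 1))"

definition eW :: "nat \<Rightarrow> wgen free_alg quotients fps" where "eW i = left i * D i"
definition fW :: "nat \<Rightarrow> wgen free_alg quotients fps" where "fW i = ap i * right i"

lemma cartan_eW:
  assumes i: "i \<in> {1..n+m}" and "mode j"
  shows "con (cartan i) * eW j = eW j * con (cartan i) + (of_bool (i = j) - of_bool (i = j + 1)) * eW j"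
proof -
  have int: "of_int a * t = t * of_int a" for a and t :: "wgen free_alg quotients fps"
    by (rule mult_of_int_commute)
  show ?thesis
  proof (cases "j = 1")
    case True
    have "con (cartan i) * con (cartan 1) = con (cartan 1) * con (cartan i)"
      using i by (intro cartan_commute) auto
    then have "con (cartan i) * left j = left j * con (cartan i) + of_int 0 * left j"
      using True commuting_qbr(2)[of p_minus_N "cartan i"] by (simp add: left_def cartan_def)
    from weight_mult[OF this cartan_D[OF i assms(2)] int] show ?thesis
      using True i by (simp add: eW_def cartan_weight_def)
  next
    case False
    then have "mode (j - 1)" using assms by auto
    then have "con (cartan i) * left j = left j * con (cartan i) + of_int (cartan_weight i (j - 1)) * left j"
      using False cartan_ap[OF i] by (simp add: left_def)
    from weight_mult[OF this cartan_D[OF i assms(2)] int]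
    have c: "con (cartan i) * eW j = eW j * con (cartan i)
        + of_int (cartan_weight i (j - 1) - cartan_weight i j) * eW j"
      by (simp add: eW_def)
    have w: "cartan_weight i (j - 1) - cartan_weight i j = of_bool (i = j) - of_bool (i = j + 1)"
      using False assms by (auto simp: cartan_weight_def)
    show ?thesis using c unfolding w by simp
  qed
qed

lemma cartan_fW:
  assumes i: "i \<in> {1..n+m}" and "mode j"
  shows "con (cartan i) * fW j = fW j * con (cartan i) + (- of_bool (i = j) + of_bool (i = j + 1)) * fW j"
proof -
  have int: "of_int a * t = t * of_int a" for a and t :: "wgen free_alg quotients fps"
    by (rule mult_of_int_commute)
  show ?thesis
  proof (cases "j = 1")
    case True
    then show ?thesis
      using cartan_ap[OF i, of 1] assms(2) i by (simp add: fW_def right_def cartan_weight_def)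
  next
    case False
    then have "mode (j - 1)" using assms by auto
    then have "con (cartan i) * right j = right j * con (cartan i) + of_int (- cartan_weight i (j - 1)) * right j"
      using False cartan_D[OF i] by (simp add: right_def)
    from weight_mult[OF cartan_ap[OF i assms(2)] this int]
    have c: "con (cartan i) * fW j = fW j * con (cartan i)
        + of_int (cartan_weight i j - cartan_weight i (j - 1)) * fW j"
      by (simp add: fW_def)
    have w: "cartan_weight i j - cartan_weight i (j - 1) = - of_bool (i = j) + of_bool (i = j + 1)"
      using False assms by (auto simp: cartan_weight_def)
    show ?thesis using c unfolding w by simp
  qed
qed

text \<open>
  Only \<open>e\<^sub>n\<close> mixes a Bose with a Fermi mode, so only for \<open>j = n\<close> do the two signs fail to cancel.
\<close>

lemma swaps_eW:
  assumes "mode j" "2 \<le> j" "mode k"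
  shows "k \<noteq> j - 1 \<Longrightarrow> swaps (fermi k \<and> j = n) (D k) (eW j)"
    and "k \<noteq> j \<Longrightarrow> swaps (fermi k \<and> j = n) (ap k) (eW j)"
proof -
  have j1: "mode (j - 1)" using assms by auto
  have par: "((fermi k \<and> fermi (j - 1)) \<noteq> (fermi k \<and> fermi j)) = (fermi k \<and> j = n)"
    using assms by auto
  have e: "eW j = ap (j - 1) * D j" using assms by (simp add: eW_def left_def)
  show "swaps (fermi k \<and> j = n) (D k) (eW j)" if "k \<noteq> j - 1"
    unfolding e par[symmetric] using assms that j1
    by (intro swaps_mult_right swaps_D_ap swaps_D_D) auto
  show "swaps (fermi k \<and> j = n) (ap k) (eW j)" if "k \<noteq> j"
    unfolding e par[symmetric] using assms that j1 swaps_sym[OF swaps_D_ap, of j k]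
    by (intro swaps_mult_right W_relations(2)) (auto simp: conj_commute)
qed

lemma swaps_fW:
  assumes "mode j" "2 \<le> j" "mode k"
  shows "k \<noteq> j \<Longrightarrow> swaps (fermi k \<and> j = n) (D k) (fW j)"
    and "k \<noteq> j - 1 \<Longrightarrow> swaps (fermi k \<and> j = n) (ap k) (fW j)"
proof -
  have j1: "mode (j - 1)" using assms by auto
  have par: "((fermi k \<and> fermi j) \<noteq> (fermi k \<and> fermi (j - 1))) = (fermi k \<and> j = n)"
    using assms by auto
  have e: "fW j = ap j * D (j - 1)" using assms by (simp add: fW_def right_def)
  show "swaps (fermi k \<and> j = n) (D k) (fW j)" if "k \<noteq> j"
    unfolding e par[symmetric] using assms that j1
    by (intro swaps_mult_right swaps_D_ap swaps_D_D) auto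
  show "swaps (fermi k \<and> j = n) (ap k) (fW j)" if "k \<noteq> j - 1"
    unfolding e par[symmetric] using assms that j1 swaps_sym[OF swaps_D_ap, of "j - 1" k]
    by (intro swaps_mult_right W_relations(2)) (auto simp: conj_commute)
qed

lemma qbr_shift_commutes:
  assumes "con p_minus_N * t = t * con p_minus_N" "cls 1 * t = t" "t * cls 1 = t"
  shows "swaps False (cls (qbr p_minus_N)) t" "swaps False (cls (qbr (p_minus_N - 1))) t"
  unfolding swaps_def qbr_def if_False
  by (rule subst_intertwines, simp add: con_arith left_diff_distrib right_diff_distrib assms)+

lemma p_minus_N_swaps:
  assumes "mode j" "2 \<le> j"
  shows "swaps False (cls (qbr p_minus_N)) (eW j)" "swaps False (cls (qbr (p_minus_N - 1))) (eW j)"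
    "swaps False (cls (qbr p_minus_N)) (fW j)" 
proof -
  have 1: "1 \<in> {1..n+m}" using n by simp
  have "cls 1 * eW j = eW j" "eW j * cls 1 = eW j" "cls 1 * fW j = fW j" "fW j * cls 1 = fW j"
    using assms by (simp_all add: eW_def fW_def left_def right_def mult.assoc D_corner cls_1_mult
        flip: mult.assoc[of "cls 1"])
  then show "swaps False (cls (qbr p_minus_N)) (eW j)" "swaps False (cls (qbr (p_minus_N - 1))) (eW j)"
    "swaps False (cls (qbr p_minus_N)) (fW j)"
    using cartan_eW[OF 1, of j] cartan_fW[OF 1, of j] assms
    by (auto intro!: qbr_shift_commutes simp: cartan_def)
qed

lemma D_p_minus_N: "mode k \<Longrightarrow> D k * cls (qbr p_minus_N) = cls (qbr (p_minus_N - 1)) * D k"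
proof -
  assume k: "mode k"
  have "con (p_minus_N - 1) * D k = D k * con p_minus_N"
    using cartan_D[of 1 k] n k
    by (simp add: cartan_def cartan_weight_def con_arith left_diff_distrib D_corner)
  then show ?thesis unfolding qbr_def by (metis subst_intertwines)
qed

lemma left_swaps_eW:
  assumes "mode i" "i \<le> n" "mode j" "i < j" shows "swaps False (left i) (eW j)"
proof (cases "i = 1")
  case False
  then have "\<not> fermi (i - 1)" "mode (i - 1)" "i - 1 \<noteq> j" "2 \<le> j" using assms by auto
  with False show ?thesis using swaps_eW(2)[of j "i - 1"] assms by (simp add: left_def)
qed (use p_minus_N_swaps(1)[of j] assms in \<open>simp add: left_def\<close>)

lemma right_swaps_fW:
  assumes "mode i" "i \<le> n" "mode j" "i < j" shows "swaps False (right i) (fW j)"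
proof (cases "i = 1")
  case False
  then have "\<not> fermi (i - 1)" "mode (i - 1)" "i - 1 \<noteq> j" "2 \<le> j" using assms by auto
  with False show ?thesis using swaps_fW(1)[of j "i - 1"] assms by (simp add: right_def)
qed (simp add: right_def swaps_def)

lemma passes_D_left:
  assumes "mode i" "mode k" "k \<noteq> i - 1" shows "passes (D k) (left i)"
proof (cases "i = 1")
  case True
  then show ?thesis using D_p_minus_N[of k] assms by (auto simp: left_def passes_def)
next
  case False
  then have "mode (i - 1)" using assms by auto
  with False show ?thesis using passes_swaps[OF swaps_D_ap[of k "i - 1"]] assms by (auto simp: left_def)
qed

lemma passes_ap_right:
  assumes "mode i" "mode k" "k \<noteq> i - 1" shows "passes (ap k) (right i)"
proof (cases "i = 1")
  case True
  then show ?thesis by (auto simp: right_def passes_def intro: exI[of _ 1])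
next
  case False
  then have "mode (i - 1)" using assms by auto
  with False show ?thesis using passes_swaps[OF swaps_sym[OF swaps_D_ap[of "i - 1" k]]] assms
    by (auto simp: right_def)
qed

lemma passes_ap_D: "mode i \<Longrightarrow> mode k \<Longrightarrow> k \<noteq> i \<Longrightarrow> passes (ap k) (D i)"
  and passes_D_ap: "mode i \<Longrightarrow> mode k \<Longrightarrow> k \<noteq> i \<Longrightarrow> passes (D k) (ap i)"
  and passes_D_D: "mode i \<Longrightarrow> mode k \<Longrightarrow> passes (D k) (D i)"
  and passes_ap_ap: "mode i \<Longrightarrow> mode k \<Longrightarrow> passes (ap k) (ap i)"
  using passes_swaps[OF swaps_D_ap] passes_swaps[OF swaps_sym[OF swaps_D_ap]]
    passes_swaps[OF swaps_D_D] passes_swaps[OF W_relations(2)] by blast+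

lemma boson_commutes:
  assumes "mode i" "mode j" "\<not> fermi i"
  shows "i \<noteq> j \<Longrightarrow> D i * ap j = ap j * D i" "i \<noteq> j \<Longrightarrow> ap i * D j = D j * ap i"
    "D i * D j = D j * D i" "ap i * ap j = ap j * ap i"
  using swaps_D_ap[of i j] swaps_D_ap[of j i] swaps_D_D[of i j] W_relations(2)[of i j] assms
  by (simp_all add: swaps_def)

section \<open>Commuting generators\<close>

lemma eW_commute:
  assumes "mode i" "mode j" "i + 2 \<le> j" shows "eW i * eW j = eW j * eW i"
proof (cases "i = 1")
  case True
  then have "swaps (False \<noteq> (fermi i \<and> j = n)) (left i * D i) (eW j)"
    using assms swaps_eW(1)[of j i] p_minus_N_swaps(1)[of j]
    by (intro swaps_mult_left) (auto simp: left_def)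
  moreover have "\<not> (fermi i \<and> j = n)" using True assms by auto
  ultimately show ?thesis by (simp add: swaps_def eW_def[of i])
next
  case False
  then have "mode (i - 1)" "i - 1 \<noteq> j" "i \<noteq> j - 1" "2 \<le> j" using assms by auto
  with False have "swaps ((fermi (i - 1) \<and> j = n) \<noteq> (fermi i \<and> j = n)) (left i * D i) (eW j)"
    using assms swaps_eW(1)[of j i] swaps_eW(2)[of j "i - 1"]
    by (intro swaps_mult_left) (auto simp: left_def)
  moreover have "((fermi (i - 1) \<and> j = n) \<noteq> (fermi i \<and> j = n)) = False" using False assms by auto
  ultimately show ?thesis by (simp only: swaps_def eW_def[of i] if_False)
qed

lemma fW_commute:
  assumes "mode i" "mode j" "i + 2 \<le> j" shows "fW i * fW j = fW j * fW i"
proof (cases "i = 1")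
  case True
  moreover have "\<not> (fermi i \<and> j = n)" "i \<noteq> j - 1" "2 \<le> j" using True assms by auto
  ultimately show ?thesis
    using assms swaps_fW(2)[of j i] by (auto simp: swaps_def fW_def[of i] fW_def[of "Suc 0"] right_def)
next
  case False
  then have "mode (i - 1)" "i - 1 \<noteq> j" "i \<noteq> j - 1" "2 \<le> j" using assms by auto
  with False have "swaps ((fermi i \<and> j = n) \<noteq> (fermi (i - 1) \<and> j = n)) (ap i * right i) (fW j)"
    using assms swaps_fW(2)[of j i] swaps_fW(1)[of j "i - 1"]
    by (intro swaps_mult_left) (auto simp: right_def)
  moreover have "((fermi i \<and> j = n) \<noteq> (fermi (i - 1) \<and> j = n)) = False" using False assms by auto
  ultimately show ?thesis by (simp only: swaps_def fW_def[of i] if_False)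
qed

lemma eW_fW_commute:
  assumes "mode i" "mode j" "i \<noteq> j" shows "eW i * fW j = fW j * eW i"
proof (cases "j = 1")
  case True
  then have "swaps (fermi 1 \<and> i = n) (ap 1) (eW i)"
    using assms by (intro swaps_eW(2)) auto
  moreover have "\<not> (fermi 1 \<and> i = n)" using True assms by auto
  ultimately show ?thesis using True by (auto simp: swaps_def fW_def right_def)
next
  case j: False
  show ?thesis
  proof (cases "i = 1")
    case True
    then have "swaps (False \<noteq> (fermi i \<and> j = n)) (left i * D i) (fW j)"
      using assms j swaps_fW(1)[of j i] p_minus_N_swaps(3)[of j]
      by (intro swaps_mult_left) (auto simp: left_def)
    moreover have "\<not> (fermi i \<and> j = n)" using True j assms by auto
    ultimately show ?thesis by (simp add: swaps_def eW_def)
  next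
    case False
    then have "mode (i - 1)" "i - 1 \<noteq> j - 1" "2 \<le> j" using assms j by auto
    with False have "swaps ((fermi (i - 1) \<and> j = n) \<noteq> (fermi i \<and> j = n)) (left i * D i) (fW j)"
      using assms j swaps_fW(1)[of j i] swaps_fW(2)[of j "i - 1"]
      by (intro swaps_mult_left) (auto simp: left_def)
    moreover have "((fermi (i - 1) \<and> j = n) \<noteq> (fermi i \<and> j = n)) = False" using False j assms by auto
    ultimately show ?thesis by (simp only: swaps_def eW_def if_False)
  qed
qed

section \<open>Cartan relations\<close>

text \<open>
  For \<open>i \<le> n\<close> the factors of \<open>e\<^sub>i\<close> and \<open>f\<^sub>i\<close> outside mode \<open>i\<close> are bosonic or \<open>[p - N]\<close>, and contribute \<open>[h\<^sub>i]\<close> or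
  \<open>[h\<^sub>i + 1]\<close> depending on the order.
\<close>

lemma eW_fW_products:
  assumes "mode i" "i \<le> n"
  shows "eW i * fW i = cls (qbr (cartan i)) * (D i * ap i)"
    "fW i * eW i = cls (qbr (cartan i + 1)) * (ap i * D i)"
proof -
  have "eW i * fW i = cls (qbr (cartan i)) * (D i * ap i)
    \<and> fW i * eW i = cls (qbr (cartan i + 1)) * (ap i * D i)"
  proof (cases "i = 1")
    case True
    have "con (p_minus_N + 1) * ap i = ap i * con p_minus_N"
      using cartan_ap[of 1 i] n assms
      by (simp add: cartan_def cartan_weight_def con_arith distrib_right cls_1_mult)
    then have "ap i * cls (qbr p_minus_N) = cls (qbr (p_minus_N + 1)) * ap i"
      unfolding qbr_def by (metis subst_intertwines)
    then have "ap i * (cls (qbr p_minus_N) * D i) = cls (qbr (p_minus_N + 1)) * (ap i * D i)"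
      by (simp add: mult.assoc [symmetric])
    with True show ?thesis by (simp add: eW_def fW_def left_def right_def cartan_def mult.assoc)
  next
    case False
    then have b: "mode (i - 1)" "\<not> fermi (i - 1)" "i - 1 \<noteq> i" using assms by auto
    have "eW i * fW i = ap (i - 1) * (D i * ap i * D (i - 1))"
      using False by (simp add: eW_def fW_def left_def right_def mult.assoc)
    also have "D i * ap i * D (i - 1) = D (i - 1) * (D i * ap i)"
      using swaps_mult_right[of False "D (i - 1)" "D i" False "ap i"] boson_commutes[OF b(1) assms(1) b(2)] b(3)
      by (simp add: swaps_def)
    finally have ef: "eW i * fW i = (ap (i - 1) * D (i - 1)) * (D i * ap i)"
      by (simp only: mult.assoc)
    have "fW i * eW i = ap i * (D (i - 1) * ap (i - 1)) * D i"
      using False by (simp add: eW_def fW_def left_def right_def mult.assoc)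
    also have "ap i * (D (i - 1) * ap (i - 1)) = (D (i - 1) * ap (i - 1)) * ap i"
      using swaps_mult_left[of False "D (i - 1)" "ap i" False "ap (i - 1)"] boson_commutes[OF b(1) assms(1) b(2)] b(3)
      by (simp add: swaps_def)
    finally have fe: "fW i * eW i = (D (i - 1) * ap (i - 1)) * (ap i * D i)"
      by (simp only: mult.assoc)
    show ?thesis
      using False unfolding ef fe ap_D_boson[OF b(1,2)] D_ap_boson[OF b(1,2)] by (simp add: cartan_def)
  qed
  then show "eW i * fW i = cls (qbr (cartan i)) * (D i * ap i)"
    "fW i * eW i = cls (qbr (cartan i + 1)) * (ap i * D i)" by auto
qed

lemma cartan_Suc: "mode i \<Longrightarrow> cartan (i + 1) = Num i"
  by (simp add: cartan_def)

lemma N_idempotent: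
  assumes "mode k" "fermi k" shows "N k * N k = N k"
proof -
  have "N k * N k = ap k * ((am k * ap k) * am k)" by (simp only: N_eq mult.assoc)
  also have "\<dots> = ap k * am k"
    unfolding W_relations(1)[OF assms(1,1)] using assms fermi_square(2)[OF assms]
    by (simp add: distrib_right left_diff_distrib cls_1_mult mult.assoc)
  finally show ?thesis by (simp only: N_eq)
qed

text \<open>
  For \<open>i < n\<close> this is \<open>[a+1][b] - [a][b+1] = [b-a]\<close> with \<open>a = N\<^sub>i\<close> and \<open>b = h\<^sub>i\<close>.  For \<open>i > n\<close> both modes are Fermi,
  and the left side is \<open>N\<^sub>i\<^sub>-\<^sub>1 (1 - N\<^sub>i) - (1 - N\<^sub>i\<^sub>-\<^sub>1) N\<^sub>i = N\<^sub>i\<^sub>-\<^sub>1 - N\<^sub>i\<close>.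
\<close>

lemma eW_fW_even:
  assumes "mode i" "i \<noteq> n"
  shows "eW i * fW i - fW i * eW i = cls (qbr (cartan i - cartan (i + 1)))"
proof (cases "i < n")
  case True
  have comm: "N i * con (cartan i) = con (cartan i) * N i"
    using cartan_N[of i i] assms by auto
  then have "con (Num i + 1) * con (cartan i) = con (cartan i) * con (Num i + 1)"
    "con (Num i) * con (cartan i + 1) = con (cartan i + 1) * con (Num i)"
    by (simp_all add: con_arith distrib_left distrib_right cls_1_mult)
  from this[THEN commuting_qbr_qbr] qbr_commutator[OF comm] True assms
  show ?thesis
    by (simp add: eW_fW_products D_ap_boson ap_D_boson cartan_Suc[simplified])
next
  case False
  then have i: "mode (i - 1)" "fermi (i - 1)" "fermi i" "i \<noteq> 1" "i - 1 \<noteq> i" using assms n by auto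
  have sw: "swaps True (D i) (D (i - 1))" "swaps True (ap i) (D (i - 1))"
    "swaps True (ap i) (ap (i - 1))" "swaps True (D i) (ap (i - 1))"
    using swaps_D_D[of i "i - 1"] swaps_sym[OF swaps_D_ap[of "i - 1" i]] swaps_D_ap[of i "i - 1"]
      W_relations(2)[of i "i - 1"] assms(1) i by simp_all
  have even: "D i * ap i * D (i - 1) = D (i - 1) * (D i * ap i)"
    "ap i * (D (i - 1) * ap (i - 1)) = D (i - 1) * ap (i - 1) * ap i"
    using swaps_mult_left[OF sw(1,2)] swaps_mult_right[OF sw(2,3)] by (simp_all add: swaps_def)
  have "eW i * fW i = ap (i - 1) * (D i * ap i * D (i - 1))"
    using i by (simp add: eW_def fW_def left_def right_def mult.assoc)
  then have ef: "eW i * fW i = N (i - 1) * (con 1 - N i)"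
    unfolding even ap_D_fermi(1)[OF i(1,2), symmetric] ap_D_fermi(2)[OF assms(1) i(3), symmetric]
    by (simp add: mult.assoc)
  have "fW i * eW i = ap i * (D (i - 1) * ap (i - 1)) * D i"
    using i by (simp add: eW_def fW_def left_def right_def mult.assoc)
  then have fe: "fW i * eW i = (con 1 - N (i - 1)) * N i"
    unfolding even ap_D_fermi(2)[OF i(1,2), symmetric] ap_D_fermi(1)[OF assms(1) i(3), symmetric]
    by (simp add: mult.assoc)
  have idem: "N k * N k = N k" if "mode k" "fermi k" for k
    using that by (rule N_idempotent)
  have "cls (qbr (Num (i - 1) - Num i)) = con (Num (i - 1) - Num i)"
    using assms i by (intro qbr_diff_idempotents idem N_commute) auto
  then show ?thesis
    using i cartan_Suc[OF assms(1)]
    by (simp add: ef fe cartan_def con_arith right_diff_distrib left_diff_distrib cls_1_mult)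
qed

text \<open>
  With \<open>b = h\<^sub>n\<close>, the left side is \<open>[b] (1 - N\<^sub>n) + [b+1] N\<^sub>n\<close>.
\<close>

lemma eW_fW_odd:
  assumes "mode n"
  shows "eW n * fW n + fW n * eW n = cls (qbr (cartan n + cartan (n + 1)))"
proof -
  have "N n * N n = N n" using assms by (intro N_idempotent) auto
  moreover have "con (cartan n) * N n = N n * con (cartan n)"
    using assms by (intro cartan_N) auto
  ultimately show ?thesis
    using qbr_add_idempotent[of "cartan n" "Num n"] assms
    by (simp add: eW_fW_products ap_D_fermi cartan_Suc[simplified])
qed

section \<open>Serre relations\<close>

lemma eW_square: "mode n \<Longrightarrow> eW n * eW n = 0"
proof -
  assume n: "mode n"
  have "eW n * eW n = left n * (D n * left n * D n)" by (simp add: eW_def mult.assoc)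
  also have "D n * left n * D n = 0"
    using n by (intro sandwich_zero D_square passes_D_left) auto
  finally show ?thesis by simp
qed

lemma fW_square: "mode n \<Longrightarrow> fW n * fW n = 0"
proof -
  assume n: "mode n"
  have "fW n * fW n = (ap n * right n * ap n) * right n" by (simp add: fW_def mult.assoc)
  also have "ap n * right n * ap n = 0"
    using n by (intro sandwich_zero fermi_square passes_ap_right) auto
  finally show ?thesis by simp
qed

lemma eW_serre_up:
  assumes "mode i" "mode (i + 1)" "i \<noteq> n"
  shows "serre_cubic q_sum (eW i) (eW (i + 1)) = 0"
proof (cases "i < n")
  case True
  then have b: "\<not> fermi i" by simp
  have e1: "eW (i + 1) = ap i * D (i + 1)" using assms by (simp add: eW_def left_def)
  define L' where "L' = (if i = 1 then cls (qbr (p_minus_N - 1)) else left i)"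
  have L: "eW (i + 1) * left i = left i * eW (i + 1)"
    using left_swaps_eW[of i "i + 1"] assms True by (simp add: swaps_def)
  have L': "eW (i + 1) * L' = L' * eW (i + 1)"
    using L p_minus_N_swaps(2)[of "i + 1"] assms by (auto simp: L'_def swaps_def)
  have DL: "D i * left i = L' * D i"
  proof (cases "i = 1")
    case False
    then have "\<not> fermi (i - 1)" "mode (i - 1)" "i \<noteq> i - 1" using assms True by auto
    with False show ?thesis using swaps_D_ap[of i "i - 1"] assms by (simp add: L'_def left_def swaps_def)
  qed (use D_p_minus_N[of i] assms in \<open>simp add: L'_def left_def\<close>)
  show ?thesis
    unfolding eW_def[of i] e1
    by (rule serre_cubic_up[OF q_sum_central DL L[unfolded e1] L'[unfolded e1]
          boson_commutes(3)[OF assms(1,2) b] serre_D_ap(1)[OF assms(1) b]])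
next
  case False
  then have i: "mode (i - 1)" "fermi (i - 1)" "i \<noteq> 1" "i - 1 \<noteq> i" "i - 1 \<noteq> i + 1" using assms n by auto
  \<comment> \<open>The Fermi operator \<open>A\<^sub>i\<^sub>-\<^sub>1\<^sup>+\<close> occurs twice in every term, and its square is zero.\<close>
  let ?u = "ap (i - 1)"
  have e: "eW i = ?u * D i" using i by (simp add: eW_def left_def)
  have p: "passes ?u (D i)" "passes ?u (eW (i + 1))"
    using passes_ap_D[of i "i - 1"] passes_swaps[OF swaps_eW(2)[of "i + 1" "i - 1"]] assms i by auto
  have "?u * D i * ?u = 0" "?u * (D i * eW (i + 1)) * ?u = 0"
    using i p by (auto intro!: sandwich_zero fermi_square passes_mult)
  then have "eW i * eW i = 0" "eW i * eW (i + 1) * eW i = 0"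
    unfolding e by (simp_all add: mult.assoc [symmetric])
  then show ?thesis by (rule serre_cubic_nilpotent)
qed

lemma eW_serre_down:
  assumes "mode i" "mode (i + 1)" "i + 1 \<noteq> n"
  shows "serre_cubic q_sum (eW (i + 1)) (eW i) = 0"
proof (cases "i + 1 < n")
  case True
  then have b: "\<not> fermi i" by simp
  have e1: "eW (i + 1) = ap i * D (i + 1)" using assms by (simp add: eW_def left_def)
  have L: "eW (i + 1) * left i = left i * eW (i + 1)"
    using left_swaps_eW[of i "i + 1"] assms True by (simp add: swaps_def)
  show ?thesis
    unfolding eW_def[of i] e1
    using boson_commutes[OF assms(1,2) b]
    by (intro serre_cubic_down q_sum_central L[unfolded e1] serre_D_ap(2)[OF assms(1) b]) auto
next
  case False
  then have i: "fermi i" "fermi (i + 1)" "i + 1 \<noteq> i" "i + 1 \<noteq> i - 1" using assms by auto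
  \<comment> \<open>Here \<open>A\<^sub>i\<^sup>+\<close> would not do as the repeated factor: it does not pass \<open>D\<^sub>i\<close>.\<close>
  let ?u = "D (i + 1)"
  have e1: "eW (i + 1) = ap i * ?u" using assms by (simp add: eW_def left_def)
  have p: "passes ?u (ap i)" "passes ?u (left i)" "passes ?u (D i)"
    using assms i by (auto intro!: passes_D_ap passes_D_left passes_D_D)
  have "?u * ap i * ?u = 0" "?u * (eW i * ap i) * ?u = 0"
    unfolding eW_def using i assms p by (auto intro!: sandwich_zero D_square passes_mult)
  then have "eW (i + 1) * eW (i + 1) = 0" "eW (i + 1) * eW i * eW (i + 1) = 0"
    unfolding e1 by (simp_all add: mult.assoc)
  then show ?thesis by (rule serre_cubic_nilpotent)
qed

lemma fW_boson:
  assumes "mode i" "\<not> fermi i" shows "fW i = right i * ap i" "mode (i + 1) \<Longrightarrow> fW (i + 1) = D i * ap (i + 1)"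
proof -
  show "fW i = right i * ap i"
  proof (cases "i = 1")
    case False
    then have "mode (i - 1)" "i \<noteq> i - 1" using assms by auto
    with False show ?thesis using boson_commutes(2)[of i "i - 1"] assms by (simp add: fW_def right_def)
  qed (simp add: fW_def right_def)
  show "mode (i + 1) \<Longrightarrow> fW (i + 1) = D i * ap (i + 1)"
    using boson_commutes(1)[of i "i + 1"] assms by (simp add: fW_def right_def)
qed

lemma fW_serre_up:
  assumes "mode i" "mode (i + 1)" "i \<noteq> n"
  shows "serre_cubic q_sum (fW i) (fW (i + 1)) = 0"
proof (cases "i < n")
  case True
  then have b: "\<not> fermi i" by simp
  note f = fW_boson[OF assms(1) b]
  have L: "fW (i + 1) * right i = right i * fW (i + 1)"
    using right_swaps_fW[of i "i + 1"] assms True by (simp add: swaps_def)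
  have DL: "ap i * right i = right i * ap i" using f(1) by (simp add: fW_def)
  show ?thesis
    unfolding f(1) f(2)[OF assms(2)]
    by (rule serre_cubic_up[OF q_sum_central DL L[unfolded f(2)[OF assms(2)]] L[unfolded f(2)[OF assms(2)]]
          boson_commutes(4)[OF assms(1,2) b] serre_D_ap(2)[OF assms(1) b]])
next
  case False
  then have i: "mode (i - 1)" "fermi (i - 1)" "i \<noteq> 1" "i - 1 \<noteq> i" "i - 1 \<noteq> i + 1" using assms n by auto
  let ?u = "D (i - 1)"
  have f: "fW i = ap i * ?u" using i by (simp add: fW_def right_def)
  have p: "passes ?u (ap i)" "passes ?u (fW (i + 1))"
    using passes_D_ap[of i "i - 1"] passes_swaps[OF swaps_fW(1)[of "i + 1" "i - 1"]] assms i by auto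
  have "?u * ap i * ?u = 0" "?u * (fW (i + 1) * ap i) * ?u = 0"
    using i p by (auto intro!: sandwich_zero D_square passes_mult)
  then have "fW i * fW i = 0" "fW i * fW (i + 1) * fW i = 0"
    unfolding f by (simp_all add: mult.assoc)
  then show ?thesis by (rule serre_cubic_nilpotent)
qed

lemma fW_serre_down:
  assumes "mode i" "mode (i + 1)" "i + 1 \<noteq> n"
  shows "serre_cubic q_sum (fW (i + 1)) (fW i) = 0"
proof (cases "i + 1 < n")
  case True
  then have b: "\<not> fermi i" by simp
  note f = fW_boson[OF assms(1) b]
  have L: "fW (i + 1) * right i = right i * fW (i + 1)"
    using right_swaps_fW[of i "i + 1"] assms True by (simp add: swaps_def)
  show ?thesis
    unfolding f(1) f(2)[OF assms(2)]
    using boson_commutes[OF assms(1,2) b]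
    by (intro serre_cubic_down q_sum_central L[unfolded f(2)[OF assms(2)]] serre_D_ap(1)[OF assms(1) b]) auto
next
  case False
  then have i: "fermi i" "fermi (i + 1)" "i + 1 \<noteq> i" "i + 1 \<noteq> i - 1" using assms by auto
  let ?u = "ap (i + 1)"
  have f1: "fW (i + 1) = ?u * D i" using assms by (simp add: fW_def right_def)
  have p: "passes ?u (ap i)" "passes ?u (right i)" "passes ?u (D i)"
    using assms i by (auto intro!: passes_ap_ap passes_ap_right passes_ap_D)
  have "?u * D i * ?u = 0" "?u * (D i * fW i) * ?u = 0"
    unfolding fW_def using i assms p by (auto intro!: sandwich_zero fermi_square passes_mult)
  then have "fW (i + 1) * fW (i + 1) = 0" "fW (i + 1) * fW i * fW (i + 1) = 0"
    unfolding f1 by (simp_all add: mult.assoc [symmetric])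
  then show ?thesis by (rule serre_cubic_nilpotent)
qed

lemma eW_quartic:
  assumes "2 \<le> n" "n + 1 \<le> n + m - 1"
  shows "serre_quartic q_sum (eW n) (eW (n - 1)) (eW (n + 1)) = 0"
proof -
  have md: "mode (n - 1)" "mode n" "mode (n + 1)" and b: "\<not> fermi (n - 1)" and n1: "n - 1 \<noteq> n" "n - 1 \<noteq> n + 1"
    using assms by auto
  have e: "eW n = ap (n - 1) * D n" using assms by (simp add: eW_def left_def)
  have L: "eW n * left (n - 1) = left (n - 1) * eW n" "eW (n + 1) * left (n - 1) = left (n - 1) * eW (n + 1)"
    using left_swaps_eW[of "n - 1" n] left_swaps_eW[of "n - 1" "n + 1"] md assms by (simp_all add: swaps_def)
  have z: "eW (n + 1) * ap (n - 1) = ap (n - 1) * eW (n + 1)" "eW (n + 1) * D (n - 1) = D (n - 1) * eW (n + 1)"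
    using swaps_eW[of "n + 1" "n - 1"] md assms n1 by (auto simp: swaps_def)
  show ?thesis
    unfolding e eW_def[of "n - 1"]
    using boson_commutes[OF md(1,2) b] n1 z L[unfolded e] md
    by (intro serre_quartic_zero q_sum_central D_square serre_D_ap(2)[OF md(1) b]) auto
qed

lemma fW_quartic:
  assumes "2 \<le> n" "n + 1 \<le> n + m - 1"
  shows "serre_quartic q_sum (fW n) (fW (n - 1)) (fW (n + 1)) = 0"
proof -
  have md: "mode (n - 1)" "mode n" "mode (n + 1)" and b: "\<not> fermi (n - 1)" and n1: "n - 1 \<noteq> n" "n - 1 \<noteq> n + 1"
    using assms by auto
  have f: "fW n = D (n - 1) * ap n" using fW_boson(2)[OF md(1) b] md assms by simp
  have L: "fW n * right (n - 1) = right (n - 1) * fW n" "fW (n + 1) * right (n - 1) = right (n - 1) * fW (n + 1)"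
    using right_swaps_fW[of "n - 1" n] right_swaps_fW[of "n - 1" "n + 1"] md assms by (simp_all add: swaps_def)
  have z: "fW (n + 1) * ap (n - 1) = ap (n - 1) * fW (n + 1)" "fW (n + 1) * D (n - 1) = D (n - 1) * fW (n + 1)"
    using swaps_fW[of "n + 1" "n - 1"] md assms n1 by (auto simp: swaps_def)
  show ?thesis
    unfolding f fW_boson(1)[OF md(1) b]
    using boson_commutes[OF md(1,2) b] n1 z L[unfolded f] md
    by (intro serre_quartic_zero q_sum_central fermi_square serre_D_ap(1)[OF md(1) b]) auto
qed

section \<open>The homomorphism\<close>

definition generator_image :: "ugen \<Rightarrow> wgen cfree_alg" where
  "generator_image x = (case x of
      H i \<Rightarrow> fps_const (cartan i)
    | E i \<Rightarrow> if i = 1 then qbr_quot (Num 1 + 1) * qbr p_minus_N * Am 1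
        else if i < n then qbr_quot (Num i + 1) * Ap (i - 1) * Am i else Ap (i - 1) * Am i
    | F i \<Rightarrow> if i = 1 then Ap 1
        else if i \<le> n then qbr_quot (Num (i - 1) + 1) * Ap i * Am (i - 1) else Ap i * Am (i - 1))"

text \<open>
  For \<open>n = 1\<close> the factor \<open>[N\<^sub>1 + 1]/(N\<^sub>1 + 1)\<close> of \<open>e\<^sub>1\<close> stands before a Fermi annihilator, where it equals \<open>1\<close>.
\<close>

lemma cls_generator_image_E:
  assumes "mode i" shows "cls (generator_image (E i)) = eW i"
proof (cases "i = 1")
  case True
  let ?g = "cls (qbr_quot (Num 1 + 1))" and ?y = "cls (qbr p_minus_N)"
  have "N 1 * con p_minus_N = con p_minus_N * N 1"
    using cartan_N[of 1 1] n True assms by (simp add: cartan_def)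
  then have "?g * ?y = ?y * ?g"
    by (intro qbr_quot_commutes commuting_qbr(2)[of p_minus_N "Num 1"]) (simp_all add: cls_1_mult)
  then have "cls (generator_image (E i)) = ?y * (?g * am 1)"
    using True by (simp add: generator_image_def cls_mult mult.assoc [symmetric])
  also have "?g * am 1 = D 1"
  proof (cases "fermi 1")
    case fermi: True
    have "N 1 * am 1 = 0"
      using fermi_square(2)[of 1] fermi assms True by (simp add: N_eq mult.assoc)
    then have "con (Num 1 + 1) * am 1 = am 1 * con 1"
      by (simp add: con_arith distrib_right cls_1_mult)
    then have "?g * am 1 = am 1 * cls (qbr_quot 1)"
      unfolding qbr_quot_def by (rule subst_intertwines)
    then show ?thesis using fermi by (simp add: D_fermi qbr_quot_1 cls_1_mult)
  qed (simp add: D_boson)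
  finally show ?thesis using True by (simp add: eW_def left_def)
next
  case False
  then have i1: "mode (i - 1)" "i \<noteq> i - 1" using assms by auto
  show ?thesis
  proof (cases "fermi i")
    case True
    then show ?thesis using False by (simp add: generator_image_def cls_mult eW_def left_def D_fermi del: fps_const_mult)
  next
    case boson: False
    have "cls (generator_image (E i)) = cls (qbr_quot (Num i + 1)) * ap (i - 1) * am i"
      using boson False by (simp add: generator_image_def cls_mult del: fps_const_mult)
    also have "cls (qbr_quot (Num i + 1)) * ap (i - 1) = ap (i - 1) * cls (qbr_quot (Num i + 1))"
      using qbr_quot_swaps(1)[OF assms i1] by (simp add: swaps_def)
    finally show ?thesis using False boson by (simp add: eW_def left_def D_boson mult.assoc)
  qed
qed

lemma cls_generator_image_F:
  assumes "mode i" shows "cls (generator_image (F i)) = fW i"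
proof (cases "i = 1")
  case False
  then have i1: "mode (i - 1)" "i - 1 \<noteq> i" using assms by auto
  show ?thesis
  proof (cases "i \<le> n")
    case fermi: False
    then have "fermi (i - 1)" by auto
    then show ?thesis using False fermi by (simp add: generator_image_def cls_mult fW_def right_def D_fermi del: fps_const_mult)
  next
    case True
    then have boson: "\<not> fermi (i - 1)" using False assms by auto
    have "cls (generator_image (F i)) = cls (qbr_quot (Num (i - 1) + 1)) * ap i * am (i - 1)"
      using True False by (simp add: generator_image_def cls_mult del: fps_const_mult)
    also have "cls (qbr_quot (Num (i - 1) + 1)) * ap i = ap i * cls (qbr_quot (Num (i - 1) + 1))"
      using qbr_quot_swaps(1)[OF i1(1) assms i1(2)] by (simp add: swaps_def)
    finally show ?thesis using False boson by (simp add: fW_def right_def D_boson mult.assoc)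
  qed
qed (simp add: generator_image_def fW_def right_def)

text \<open>
  Evaluation at the images of the generators, reduced modulo the relations of \<open>W(n-1/m)\<close>.
\<close>

definition \<Psi> :: "ugen cfree_alg \<Rightarrow> wgen free_alg quotients fps" where
  "\<Psi> x = cls (evaluate generator_image x)"

lemma \<Psi>_add: "\<Psi> (x + y) = \<Psi> x + \<Psi> y"
  and \<Psi>_diff: "\<Psi> (x - y) = \<Psi> x - \<Psi> y"
  and \<Psi>_mult: "\<Psi> (x * y) = \<Psi> x * \<Psi> y"
  and \<Psi>_0: "\<Psi> 0 = 0"
  by (simp_all add: \<Psi>_def evaluate_add evaluate_diff evaluate_mult evaluate_0 cls_add cls_diff cls_mult cls_0)

lemma \<Psi>_q_sum: "\<Psi> (scalar (qh + inverse qh)) = q_sum"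
  by (simp add: \<Psi>_def evaluate_scalar q_sum_def)

lemma \<Psi>_of_bool: "\<Psi> (of_bool P * x) = of_bool P * \<Psi> x"
  by (cases P) (simp_all add: \<Psi>_0)

lemma \<Psi>_uminus: "\<Psi> (- x) = - \<Psi> x"
  using \<Psi>_diff[of 0 x] by (simp add: \<Psi>_0)

lemma \<Psi>_hh: "\<Psi> (hh i) = con (cartan i)"
  by (simp add: \<Psi>_def evaluate_var generator_image_def)
lemma \<Psi>_ee: "mode i \<Longrightarrow> \<Psi> (ee i) = eW i"
  by (simp add: \<Psi>_def evaluate_var cls_generator_image_E)
lemma \<Psi>_ff: "mode i \<Longrightarrow> \<Psi> (ff i) = fW i"
  by (simp add: \<Psi>_def evaluate_var cls_generator_image_F)

lemma \<Psi>_qbr: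
  "\<Psi> (qbr (var (H i) - var (H j))) = cls (qbr (cartan i - cartan j))"
  "\<Psi> (qbr (var (H i) + var (H j))) = cls (qbr (cartan i + cartan j))"
proof -
  have "evaluate generator_image (fps_const (var (H i) - var (H j))) = fps_const (cartan i - cartan j)"
    "evaluate generator_image (fps_const (var (H i) + var (H j))) = fps_const (cartan i + cartan j)"
    by (simp_all add: evaluate_add evaluate_diff evaluate_var generator_image_def
        flip: fps_const_add fps_const_sub)
  then show "\<Psi> (qbr (var (H i) - var (H j))) = cls (qbr (cartan i - cartan j))"
    "\<Psi> (qbr (var (H i) + var (H j))) = cls (qbr (cartan i + cartan j))"
    by (simp_all add: \<Psi>_def qbr_def evaluate_subst)
qed

lemma \<Psi>_cartan_kac:
  assumes "r \<in> cartan_kac_rels n m" shows "\<Psi> r = 0"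
  using assms
proof cases
  case (hh i j)
  then show ?thesis
    unfolding hh(1) \<Psi>_diff \<Psi>_mult \<Psi>_hh using cartan_commute[of i j] by simp
next
  case (he i j)
  then have "mode j" by auto
  then show ?thesis
    unfolding he(1) left_diff_distrib \<Psi>_diff \<Psi>_of_bool
    unfolding \<Psi>_mult \<Psi>_hh \<Psi>_ee[OF \<open>mode j\<close>]
    using cartan_eW[OF he(2) \<open>mode j\<close>] by (simp add: left_diff_distrib)
next
  case (hf i j)
  then have "mode j" by auto
  then show ?thesis
    unfolding hf(1) distrib_right mult_minus_left \<Psi>_diff \<Psi>_add \<Psi>_uminus \<Psi>_of_bool
    unfolding \<Psi>_mult \<Psi>_hh \<Psi>_ff[OF \<open>mode j\<close>]
    using cartan_fW[OF hf(2) \<open>mode j\<close>] by (simp add: distrib_right)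
next
  case (ef i j)
  then have "mode i" "mode j" by auto
  then show ?thesis
    unfolding ef(1) \<Psi>_diff \<Psi>_mult using eW_fW_commute[OF _ _ ef(4)] by (simp add: \<Psi>_ee \<Psi>_ff)
next
  case (ef_even i)
  then have "mode i" by auto
  then show ?thesis
    unfolding ef_even(1) \<Psi>_diff \<Psi>_mult \<Psi>_qbr using eW_fW_even[OF _ ef_even(3)] by (simp add: \<Psi>_ee \<Psi>_ff)
next
  case ef_odd
  then have "mode n" by auto
  then show ?thesis
    unfolding ef_odd(1) \<Psi>_diff \<Psi>_add \<Psi>_mult \<Psi>_qbr using eW_fW_odd by (simp add: \<Psi>_ee \<Psi>_ff)
qed

lemma \<Psi>_serre:
  assumes G: "\<And>i. mode i \<Longrightarrow> \<Psi> (g i) = G i"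
    and comm: "\<And>i j. mode i \<Longrightarrow> mode j \<Longrightarrow> i + 2 \<le> j \<Longrightarrow> G i * G j = G j * G i"
    and square: "mode n \<Longrightarrow> G n * G n = 0"
    and up: "\<And>i. mode i \<Longrightarrow> mode (i + 1) \<Longrightarrow> i \<noteq> n \<Longrightarrow> serre_cubic q_sum (G i) (G (i + 1)) = 0"
    and down: "\<And>i. mode i \<Longrightarrow> mode (i + 1) \<Longrightarrow> i + 1 \<noteq> n \<Longrightarrow> serre_cubic q_sum (G (i + 1)) (G i) = 0"
    and quartic: "2 \<le> n \<Longrightarrow> n + 1 \<le> n + m - 1 \<Longrightarrow> serre_quartic q_sum (G n) (G (n - 1)) (G (n + 1)) = 0"
    and r: "r \<in> serre_rels n m g"
  shows "\<Psi> r = 0"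
  using r
proof cases
  case (comm i j)
  then consider "i = j" | "i + 2 \<le> j" | "j + 2 \<le> i" by linarith
  then show ?thesis
    using comm assms(2)[of i j] assms(2)[of j i] by cases (simp_all add: \<Psi>_diff \<Psi>_mult \<Psi>_0 G)
next
  case square
  then show ?thesis using assms(3) by (simp add: power2_eq_square \<Psi>_mult G)
next
  case (cubic_up i)
  then have "mode i" "mode (i + 1)" "i \<noteq> n" using n by auto
  with up[OF this] show ?thesis
    unfolding cubic_up(1) power2_eq_square
    by (simp only: serre_cubic_def power2_eq_square \<Psi>_add \<Psi>_diff \<Psi>_mult \<Psi>_q_sum G)
next
  case (cubic_down i)
  then have "mode i" "mode (i + 1)" "i + 1 \<noteq> n" using n by auto
  with down[OF this] show ?thesis
    unfolding cubic_down(1) power2_eq_square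
    by (simp only: serre_cubic_def power2_eq_square \<Psi>_add \<Psi>_diff \<Psi>_mult \<Psi>_q_sum G)
next
  case quartic
  then have "mode n" "mode (n + 1)" "mode (n - 1)" "2 \<le> n" by auto
  with assms(6)[OF this(4) quartic(3)] show ?thesis
    unfolding quartic(1)
    by (simp only: serre_quartic_def \<Psi>_add \<Psi>_diff \<Psi>_mult \<Psi>_q_sum G)
qed

lemma \<Psi>_U_rels:
  assumes "r \<in> U_rels n m"
  shows "\<Psi> r = 0"
  using assms \<Psi>_cartan_kac
    \<Psi>_serre[OF \<Psi>_ee eW_commute eW_square eW_serre_up eW_serre_down eW_quartic]
    \<Psi>_serre[OF \<Psi>_ff fW_commute fW_square fW_serre_up fW_serre_down fW_quartic]
  unfolding U_rels_def by blast

lemma Num_graded: "mode i \<Longrightarrow> Num i \<in> graded_words (W_gens n m) (W_deg n) 0"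
  using graded_words_mult[OF graded_words_var graded_words_var, of "Cr i" "W_gens n m" "An i" "W_deg n"]
  by (simp add: Num_def W_gens_def)

lemma graded_words_diff:
  "a \<in> graded_words X deg d \<Longrightarrow> b \<in> graded_words X deg d \<Longrightarrow> a - b \<in> graded_words X deg d"
  unfolding graded_words_def using keys_diff[of a b] by blast

lemma cartan_graded: "i \<in> {1..n+m} \<Longrightarrow> cartan i \<in> graded_words (W_gens n m) (W_deg n) 0"
  by (auto simp: cartan_def p_minus_N_def Ntot_def intro!: graded_words_diff graded_words_const graded_words_sum Num_graded)

lemma generator_image_homog:
  assumes "x \<in> U_gens n m"
  shows "generator_image x \<in> homog (free_superalg (W_gens n m) (W_deg n)) (U_deg n x)"
proof -
  let ?H = "homog (free_superalg (W_gens n m) (W_deg n))"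
  have ap: "Ap i \<in> ?H (theta n i)" and am: "Am i \<in> ?H (theta n i)" if "mode i" for i
    using that homog_fps_const[OF graded_words_var, of "Cr i" "W_gens n m" "W_deg n"]
      homog_fps_const[OF graded_words_var, of "An i" "W_gens n m" "W_deg n"]
    by (simp_all add: W_gens_def)
  have qq: "qbr_quot (Num i + 1) \<in> ?H 0" if "mode i" for i
    unfolding qbr_quot_def using that graded_words_const[of 1 "W_gens n m" "W_deg n"]
    by (intro homog_subst graded_words_add Num_graded) auto
  have q: "qbr p_minus_N \<in> ?H 0"
    unfolding qbr_def using cartan_graded[of 1] n by (intro homog_subst) (simp add: cartan_def)
  have H: "fps_const (cartan i) \<in> ?H 0" if "i \<in> {1..n+m}" for i
    by (intro homog_fps_const cartan_graded that)
  have th0: "theta n 0 = 0" using n by (simp add: theta_def)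
  from assms consider (H) i where "x = H i" "i \<in> {1..n+m}" | (E) i where "x = E i" "mode i" | (F) i where "x = F i" "mode i"
    by (auto simp: U_gens_def)
  then show ?thesis
  proof cases
    case (E i)
    show ?thesis
    proof (cases "i = 1")
      case True
      have "qbr_quot (Num 1 + 1) * qbr p_minus_N * Am 1 \<in> ?H (0 + 0 + theta n 1)"
        using E True by (intro homog_mult qq q am) auto
      with E True th0 show ?thesis by (auto simp: generator_image_def)
    next
      case False
      then have i1: "mode (i - 1)" using E by auto
      have "Ap (i - 1) * Am i \<in> ?H (theta n (i - 1) + theta n i)"
        using E i1 by (intro homog_mult ap am) auto
      moreover have "qbr_quot (Num i + 1) * Ap (i - 1) * Am i \<in> ?H (0 + theta n (i - 1) + theta n i)"
        using E i1 by (intro homog_mult qq ap am) auto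
      ultimately show ?thesis using E False by (simp add: generator_image_def)
    qed
  next
    case (F i)
    show ?thesis
    proof (cases "i = 1")
      case True
      with F th0 ap[of 1] show ?thesis by (auto simp: generator_image_def)
    next
      case False
      then have i1: "mode (i - 1)" using F by auto
      have "Ap i * Am (i - 1) \<in> ?H (theta n i + theta n (i - 1))"
        using F i1 by (intro homog_mult ap am) auto
      then have AA: "Ap i * Am (i - 1) \<in> ?H (theta n (i - 1) + theta n i)"
        by (simp only: add.commute)
      have "qbr_quot (Num (i - 1) + 1) * (Ap i * Am (i - 1)) \<in> ?H (0 + (theta n (i - 1) + theta n i))"
        using i1 by (intro homog_mult qq AA)
      with AA show ?thesis using F False by (simp add: generator_image_def mult.assoc)
    qed
  qed (use H in \<open>simp add: generator_image_def\<close>)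
qed

lemma homomorphism_exists:
  "\<exists>\<phi> \<in> superalg_hom (U_alg n m) (W_alg n m). \<forall>x\<in>U_gens n m. \<phi> (U_elt n m (fps_const (var x))) = W_elt n m (generator_image x)"
  unfolding U_alg_def W_alg_def U_elt_def W_elt_def
proof (rule presented_superalg_hom[OF generator_image_homog U_rels_words_over[OF n] W_rels_words_over])
  fix r assume r: "r \<in> U_rels n m"
  have "evaluate generator_image r \<in> words_over (W_gens n m)"
    using U_rels_words_over[OF n] r homog_words_over[OF generator_image_homog]
    by (intro evaluate_words_over[of "U_gens n m"]) auto
  with \<Psi>_U_rels[OF r] show "evaluate generator_image r \<in> relation_ideal (W_gens n m) (W_deg n) (W_rels n m)"
    unfolding \<Psi>_def by (intro relation_ideal_if_cls_0 W_rels_words_over)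
qed

end

theorem proposition1:
  fixes n m :: nat and p :: complex
  assumes "n \<ge> 1" and "n + m \<ge> 2"
  shows "\<exists>\<phi> \<in> superalg_hom (U_alg n m) (W_alg n m).
    \<phi> (U_elt n m (hh 1)) = W_elt n m (fps_const (const p - Ntot n m)) \<and>
    (\<forall>i \<in> {2..n+m}. \<phi> (U_elt n m (hh i)) = W_elt n m (fps_const (Num (i - 1)))) \<and>
    \<phi> (U_elt n m (ee 1)) = W_elt n m (qbr_quot (Num 1 + 1) * qbr (const p - Ntot n m) * Am 1) \<and>
    (\<forall>i \<in> {2..n-1}. \<phi> (U_elt n m (ee i)) =
      W_elt n m (qbr_quot (Num i + 1) * Ap (i - 1) * Am i)) \<and>
    (\<forall>i \<in> {n..n+m-1}. i \<ge> 2 \<longrightarrow> \<phi> (U_elt n m (ee i)) = W_elt n m (Ap (i - 1) * Am i)) \<and>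
    \<phi> (U_elt n m (ff 1)) = W_elt n m (Ap 1) \<and>
    (\<forall>i \<in> {2..n}. i \<le> n+m-1 \<longrightarrow> \<phi> (U_elt n m (ff i)) =
      W_elt n m (qbr_quot (Num (i - 1) + 1) * Ap i * Am (i - 1))) \<and>
    (\<forall>i \<in> {n+1..n+m-1}. \<phi> (U_elt n m (ff i)) = W_elt n m (Ap i * Am (i - 1)))"
proof -
  interpret boson_fermion n m p using assms by unfold_locales
  obtain \<phi> where \<phi>: "\<phi> \<in> superalg_hom (U_alg n m) (W_alg n m)"
    and gens: "\<And>x. x \<in> U_gens n m \<Longrightarrow> \<phi> (U_elt n m (fps_const (var x))) = W_elt n m (generator_image x)"
    using homomorphism_exists by blast
  have "H i \<in> U_gens n m" if "1 \<le> i" "i \<le> n + m" for i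
    using that by (simp add: U_gens_def image_iff)
  moreover have "E i \<in> U_gens n m" "F i \<in> U_gens n m" if "1 \<le> i" "i \<le> n + m - 1" for i
    using that by (simp_all add: U_gens_def image_iff)
  ultimately show ?thesis
    using assms
    by (intro bexI[OF _ \<phi>] conjI ballI impI; subst gens)
      (auto simp: generator_image_def cartan_def p_minus_N_def)
qed

end
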